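(* Let $\pmb{p}=(p_1,p_2)$ be a bidegree. (a) If $p_k\ge1$ for some $k\in\{1,2\}$, then there exist an LR-mesh $\mathcal{M}$ and six pairwise distinct elements $B^1,\dots,B^6$ of $\mathcal{B}^{\mathcal{MS}}(\mathcal{M})$, together with nonzero real numbers $\alpha_1,\dots,\alpha_6$, such that $\sum_{j=1}^6\alpha_jB^j=0$ on $\mathbb{R}^2$. (b) If $p_k\ge2$ for some $k\in\{1,2\}$, then there exist an LR-mesh $\mathcal{M}$ and eight pairwise distinct elements $B^1,\dots,B^8$ of $\mathcal{B}^{\mathcal{LR}}(\mathcal{M})$, together with nonzero real numbers $\alpha_1,\dots,\alpha_8$, such that $\sum_{j=1}^8\alpha_jB^j=0$ on $\mathbb{R}^2$.
   Context: Meshes. Let $\Omega\subset\mathbb{R}^2$ be an axis-aligned rectangle. A box-partition $\mathcal{E}$ of $\Omega$ is a finite collection of axis-aligned rectangles (elements) with pairwise disjoint interiors and union $\Omega$. Its vertices are the vertices of its elements; a meshline is a segment (in the element boundaries) connecting two and only two vertices of $\mathcal{E}$; the collection $\mathcal{M}$ of meshlines is the box-mesh. Vertical meshlines are called 1-meshlines, horizontal ones 2-meshlines. Each meshline $\gamma$ carries an integer multiplicity $\mu(\gamma)\ge1$; for the fixed bidegree $\pmb{p}=(p_1,p_2)$ one assumes $\mu(\gamma)\le p_k+1$ for every $k$-meshline. An axis-aligned segment $\gamma$ traverses an element $\beta$ if $\beta\setminus\gamma$ is not connected. A split is a finite union of contiguous colinear segments, each of which either traverses an element or is a meshline of $\mathcal{M}$;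 vertical splits are 1-splits, horizontal splits are 2-splits. A split of $\mathcal{M}$ is a split made of meshlines of $\mathcal{M}$; it is maximal if it contains every meshline of $\mathcal{M}$ contiguous and colinear with it. $\mathcal{M}$ has constant splits if all meshlines in each maximal split have the same multiplicity; this defines $\mu(\gamma)$ for a split $\gamma$ of $\mathcal{M}$. Inserting a split $\gamma$ with multiplicity $\mu_\gamma\ge1$ gives $\mathcal{M}+\gamma$: each element traversed by $\gamma$ is cut in two along $\gamma$; meshlines not in $\gamma$ keep their multiplicity, meshlines in $\gamma$ already in $\mathcal{M}$ have multiplicity increased by $\mu_\gamma$, and new meshlines in $\gamma$ get multiplicity $\mu_\gamma$. The length of a $k$-split is the number of orthogonal meshlines it intersects, counted with multiplicity (i.e. the sum, over the mesh vertices on it, of the maximal multiplicity of the orthogonal meshlines at that vertex). LR-mesh: a mesh $\mathcal{M}=\mathcal{M}_N$ obtained from a tensor product mesh $\mathcal{M}_1$ (the mesh of the elements $[\tau_{1,i},\tau_{1,i+1}]\times[\tau_{2,j},\tau_{2,j+1}]$ for two increasing sequences, with multiplicities and constant splits) by successive insertions $\mathcal{M}_{i+1}=\mathcal{M}_i+\gamma_i$, each $\mathcal{M}_{i+1}$ having constant splits. Standing assumptions: $\mathcal{M}_1$ has at least $p_1+2$ vertical and $p_2+2$ horizontal splits counted with multiplicity (LR-rule 1), and at every step every maximal $k$-split has length at least $p_{3-k}+2$, $k\in\{1,2\}$ (LR-rule 2). B-splines. For nondecreasing $\pmb{t}=(t_1,\dots,t_{p+2})$, $B[\pmb{t}]$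 is the univariate degree $p$ B-spline given by $B[\pmb{t}](t)=\frac{t-t_1}{t_{p+1}-t_1}B[t_1,\dots,t_{p+1}](t)+\frac{t_{p+2}-t}{t_{p+2}-t_2}B[t_2,\dots,t_{p+2}](t)$ (fractions with zero denominator are $0$), with $B[t_i,t_{i+1}]$ the indicator of $[t_i,t_{i+1})$. For $\pmb{x}=(x_1,\dots,x_{p_1+2})$, $\pmb{y}=(y_1,\dots,y_{p_2+2})$, $B[\pmb{x},\pmb{y}](x,y)=B[\pmb{x}](x)B[\pmb{y}](y)$, with support $[x_1,x_{p_1+2}]\times[y_1,y_{p_2+2}]$. The splits of $B[\pmb{x},\pmb{y}]$ are the segments $\{x_i\}\times[y_1,y_{p_2+2}]$ and $[x_1,x_{p_1+2}]\times\{y_j\}$, with multiplicity that of $x_i$ in $\pmb{x}$, resp. $y_j$ in $\pmb{y}$. A split $\gamma$ traverses $B[\pmb{x},\pmb{y}]$ if it divides the interior of the support into two parts. MS B-splines. $B[\pmb{x},\pmb{y}]$ has support in $\mathcal{M}$ if its support lies in $\Omega$ and every split of it of multiplicity $m$ is contained in a split $\gamma$ of $\mathcal{M}$ with $\mu(\gamma)\ge m$. It has minimal support in $\mathcal{M}$ (is an MS B-spline) if in addition, for every split $\gamma$ of $\mathcal{M}$ meeting the interior of its support, $\gamma$ traverses $B[\pmb{x},\pmb{y}]$ if and only if a split of $B[\pmb{x},\pmb{y}]$ of multiplicity $\mu(\gamma)$ is contained in $\gamma$. $\mathcal{B}^{\mathcal{MS}}(\mathcal{M})$ is the set of all MS B-splines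 of bidegree $\pmb{p}$ on $\mathcal{M}$. LR B-splines. Given the construction sequence $\mathcal{M}_1,\dots,\mathcal{M}_N=\mathcal{M}$, let $\mathcal{B}_1$ be the set of tensor product B-splines of bidegree $\pmb{p}$ on $\mathcal{M}_1$ (those with consecutive knots in the two knot vectors of $\mathcal{M}_1$). For $i=1,\dots,N-1$ start with $\mathcal{B}_{i+1}=\mathcal{B}_i$ and, while some $B[\pmb{x},\pmb{y}]\in\mathcal{B}_{i+1}$ does not have minimal support on $\mathcal{M}_{i+1}$, perform knot insertion: insert into $\pmb{x}$ (or $\pmb{y}$) the knot of a split of $\mathcal{M}_{i+1}$ traversing it, and replace $B[\pmb{x},\pmb{y}]$ in $\mathcal{B}_{i+1}$ by the two B-splines obtained from the first and the last $p_1+2$ (resp. $p_2+2$) knots of the enlarged knot vector, the other knot vector being unchanged. Then $\mathcal{B}^{\mathcal{LR}}(\mathcal{M})=\mathcal{B}_N$. *)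

theory Defs
  imports "HOL-Analysis.Analysis"
begin

section \<open>Coordinates and axis-aligned segments\<close>

text \<open>The index \<open>k \<in> {1,2}\<close> is the two-element type \<open>axis\<close>, so a bidegree is a function
  \<open>p :: axis \<Rightarrow> nat\<close> and \<open>other k\<close> is \<open>3 - k\<close>. A \<open>k\<close>-segment is one on which the \<open>k\<close>-th coordinate is
  constant: \<open>Ax1\<close>-segments are vertical, \<open>Ax2\<close>-segments horizontal.\<close>

datatype axis = Ax1 | Ax2

fun other :: "axis \<Rightarrow> axis" where
  "other Ax1 = Ax2"
| "other Ax2 = Ax1"

type_synonym point = "real \<times> real"

fun coord :: "axis \<Rightarrow> point \<Rightarrow> real" where
  "coord Ax1 z = fst z"
| "coord Ax2 z = snd z"

fun kpoint :: "axis \<Rightarrow> real \<Rightarrow> real \<Rightarrow> point" where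
  "kpoint Ax1 c s = (c, s)"
| "kpoint Ax2 c s = (s, c)"

definition kseg :: "axis \<Rightarrow> real \<Rightarrow> real \<Rightarrow> real \<Rightarrow> point set" where
  "kseg k c a b = kpoint k c ` {a..b}"

definition is_kseg :: "axis \<Rightarrow> point set \<Rightarrow> bool" where
  "is_kseg k \<gamma> \<longleftrightarrow> (\<exists>c a b. a < b \<and> \<gamma> = kseg k c a b)"

section \<open>Box-partitions and box-meshes\<close>

definition rectangle :: "point set \<Rightarrow> bool" where
  "rectangle R \<longleftrightarrow> (\<exists>a b c d. a < b \<and> c < d \<and> R = cbox (a, c) (b, d))"

definition box_partition :: "point set \<Rightarrow> point set set \<Rightarrow> bool" where
  "box_partition \<Omega> E \<longleftrightarrow>
     rectangle \<Omega> \<and> finite E \<and> (\<forall>\<beta>\<in>E. rectangle \<beta>) \<and>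
     (\<forall>\<beta>\<in>E. \<forall>\<beta>'\<in>E. \<beta> \<noteq> \<beta>' \<longrightarrow> interior \<beta> \<inter> interior \<beta>' = {}) \<and> \<Union>E = \<Omega>"

definition vertices :: "point set set \<Rightarrow> point set" where
  "vertices E = {v. \<exists>a b c d. a < b \<and> c < d \<and> cbox (a, c) (b, d) \<in> E \<and> v \<in> {a, b} \<times> {c, d}}"

definition kmeshlines :: "axis \<Rightarrow> point set set \<Rightarrow> point set set" where
  "kmeshlines k E =
     {kseg k c a b | c a b. a < b \<and> kseg k c a b \<subseteq> (\<Union>\<beta>\<in>E. frontier \<beta>) \<and>
        kseg k c a b \<inter> vertices E = {kpoint k c a, kpoint k c b}}"

definition meshlines :: "point set set \<Rightarrow> point set set" where
  "meshlines E = (\<Union>k. kmeshlines k E)"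

text \<open>Only the values of \<open>mu\<close> on the meshlines of \<open>elems\<close> are meaningful.\<close>

record mesh =
  elems :: "point set set"
  mu :: "point set \<Rightarrow> nat"

section \<open>Splits\<close>

definition traverses :: "point set \<Rightarrow> point set \<Rightarrow> bool" where
  "traverses \<gamma> S \<longleftrightarrow> \<not> connected (S - \<gamma>)"

text \<open>Contiguity and colinearity of the pieces is expressed by requiring their union to be a
  \<open>k\<close>-segment. A piece traversing an element is a chord of it (\<open>\<sigma> \<subseteq> \<beta>\<close>), so that a split does not end
  in the interior of an element.\<close>

definition is_split :: "axis \<Rightarrow> point set set \<Rightarrow> point set \<Rightarrow> bool" where
  "is_split k E \<gamma> \<longleftrightarrow> is_kseg k \<gamma> \<and>
     (\<exists>\<Gamma>. finite \<Gamma> \<and> \<gamma> = \<Union>\<Gamma> \<and>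
        (\<forall>\<sigma>\<in>\<Gamma>. is_kseg k \<sigma> \<and> (\<sigma> \<in> kmeshlines k E \<or> (\<exists>\<beta>\<in>E. \<sigma> \<subseteq> \<beta> \<and> traverses \<sigma> \<beta>))))"

text \<open>\<open>mesh_split\<close> is a split \<^emph>\<open>of\<close> the mesh, i.e. one made of meshlines.\<close>

definition mesh_split :: "axis \<Rightarrow> point set set \<Rightarrow> point set \<Rightarrow> bool" where
  "mesh_split k E \<gamma> \<longleftrightarrow> is_kseg k \<gamma> \<and> (\<exists>\<Gamma>. finite \<Gamma> \<and> \<Gamma> \<subseteq> kmeshlines k E \<and> \<gamma> = \<Union>\<Gamma>)"

definition maximal_split :: "axis \<Rightarrow> point set set \<Rightarrow> point set \<Rightarrow> bool" where
  "maximal_split k E \<gamma> \<longleftrightarrow> mesh_split k E \<gamma> \<and>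
     (\<forall>\<sigma>\<in>kmeshlines k E. is_kseg k (\<sigma> \<union> \<gamma>) \<longrightarrow> \<sigma> \<subseteq> \<gamma>)"

definition constant_splits :: "mesh \<Rightarrow> bool" where
  "constant_splits M \<longleftrightarrow>
     (\<forall>k \<gamma>. maximal_split k (elems M) \<gamma> \<longrightarrow>
        (\<forall>\<sigma>\<in>kmeshlines k (elems M). \<forall>\<tau>\<in>kmeshlines k (elems M).
           \<sigma> \<subseteq> \<gamma> \<and> \<tau> \<subseteq> \<gamma> \<longrightarrow> mu M \<sigma> = mu M \<tau>))"

text \<open>Meaningful for splits of a mesh with constant splits.\<close>

definition split_mult :: "mesh \<Rightarrow> point set \<Rightarrow> nat" where
  "split_mult M \<gamma> = (THE m. \<forall>\<sigma>\<in>meshlines (elems M). \<sigma> \<subseteq> \<gamma> \<longrightarrow> mu M \<sigma> = m)"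

definition split_length :: "mesh \<Rightarrow> axis \<Rightarrow> point set \<Rightarrow> nat" where
  "split_length M k \<gamma> =
     (\<Sum>v\<in>vertices (elems M) \<inter> \<gamma>. Max (mu M ` {\<sigma>\<in>kmeshlines (other k) (elems M). v \<in> \<sigma>}))"

text \<open>Insertion of the split \<open>\<gamma> = kseg k c a b\<close> with multiplicity \<open>m\<close>. A vertex created by \<open>\<gamma>\<close> may
  subdivide a meshline \<open>\<tau>\<close> of \<open>M\<close>; its pieces \<open>\<sigma> \<subseteq> \<tau>\<close> inherit the multiplicity of \<open>\<tau>\<close>.\<close>

definition insert_split :: "mesh \<Rightarrow> axis \<Rightarrow> real \<Rightarrow> real \<Rightarrow> real \<Rightarrow> nat \<Rightarrow> mesh" where
  "insert_split M k c a b m =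
     \<lparr> elems = {\<beta> \<in> elems M. \<not> traverses (kseg k c a b) \<beta>} \<union>
         (\<Union>\<beta>\<in>{\<beta> \<in> elems M. traverses (kseg k c a b) \<beta>}.
            {{z \<in> \<beta>. coord k z \<le> c}, {z \<in> \<beta>. c \<le> coord k z}}),
       mu = (\<lambda>\<sigma>.
         (if \<exists>\<tau>\<in>meshlines (elems M). \<sigma> \<subseteq> \<tau>
          then mu M (THE \<tau>. \<tau> \<in> meshlines (elems M) \<and> \<sigma> \<subseteq> \<tau>) else 0) +
         (if \<sigma> \<subseteq> kseg k c a b then m else 0)) \<rparr>"

section \<open>LR-meshes\<close>

text \<open>The standing assumptions on every mesh of a construction sequence. The last conjunct is
  LR-rule 2.\<close>

definition admissible :: "(axis \<Rightarrow> nat) \<Rightarrow> mesh \<Rightarrow> bool" where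
  "admissible p M \<longleftrightarrow>
     (\<exists>\<Omega>. box_partition \<Omega> (elems M)) \<and>
     (\<forall>k. \<forall>\<sigma>\<in>kmeshlines k (elems M). 1 \<le> mu M \<sigma> \<and> mu M \<sigma> \<le> p k + 1) \<and>
     constant_splits M \<and>
     (\<forall>k \<gamma>. maximal_split k (elems M) \<gamma> \<longrightarrow> p (other k) + 2 \<le> split_length M k \<gamma>)"

text \<open>\<open>X\<close> and \<open>Y\<close> are the knot vectors of the tensor product mesh, i.e. the two increasing sequences
  with each entry repeated as often as the multiplicity of its split.\<close>

definition tensor_mesh :: "real list \<Rightarrow> real list \<Rightarrow> mesh \<Rightarrow> bool" where
  "tensor_mesh X Y M \<longleftrightarrow> sorted X \<and> sorted Y \<and>
     elems M = {cbox (X ! i, Y ! j) (X ! Suc i, Y ! Suc j) | i j.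
        Suc i < length X \<and> Suc j < length Y \<and> X ! i < X ! Suc i \<and> Y ! j < Y ! Suc j} \<and>
     (\<forall>c a b. kseg Ax1 c a b \<in> kmeshlines Ax1 (elems M) \<longrightarrow> mu M (kseg Ax1 c a b) = count_list X c) \<and>
     (\<forall>c a b. kseg Ax2 c a b \<in> kmeshlines Ax2 (elems M) \<longrightarrow> mu M (kseg Ax2 c a b) = count_list Y c)"

text \<open>The first mesh of a construction; the length bounds are LR-rule 1.\<close>

definition initial_mesh :: "(axis \<Rightarrow> nat) \<Rightarrow> real list \<Rightarrow> real list \<Rightarrow> mesh \<Rightarrow> bool" where
  "initial_mesh p X Y M \<longleftrightarrow> tensor_mesh X Y M \<and>
     p Ax1 + 2 \<le> length X \<and> p Ax2 + 2 \<le> length Y \<and> admissible p M"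

definition mesh_step :: "(axis \<Rightarrow> nat) \<Rightarrow> mesh \<Rightarrow> mesh \<Rightarrow> bool" where
  "mesh_step p M M' \<longleftrightarrow>
     (\<exists>k c a b m. is_split k (elems M) (kseg k c a b) \<and> 1 \<le> m \<and> M' = insert_split M k c a b m) \<and>
     admissible p M'"

inductive LR_mesh :: "(axis \<Rightarrow> nat) \<Rightarrow> mesh \<Rightarrow> bool" for p where
  initial: "initial_mesh p X Y M \<Longrightarrow> LR_mesh p M"
| step: "LR_mesh p M \<Longrightarrow> mesh_step p M M' \<Longrightarrow> LR_mesh p M'"

section \<open>B-splines\<close>

text \<open>Division by zero is zero in HOL, as required by the recurrence.\<close>

function bspline :: "real list \<Rightarrow> real \<Rightarrow> real" where
  "bspline [] t = 0"
| "bspline [a] t = 0"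
| "bspline [a, b] t = (if a \<le> t \<and> t < b then 1 else 0)"
| "bspline (a # b # c # ts) t =
     (t - a) / (last (butlast (a # b # c # ts)) - a) * bspline (butlast (a # b # c # ts)) t +
     (last (c # ts) - t) / (last (c # ts) - b) * bspline (b # c # ts) t"
  by pat_completeness auto
termination by (relation "Wellfounded.measure (length \<circ> fst)") auto

type_synonym knot_pair = "real list \<times> real list"

fun tensor_bspline :: "knot_pair \<Rightarrow> point \<Rightarrow> real" where
  "tensor_bspline (x, y) (s, t) = bspline x s * bspline y t"

fun knots :: "axis \<Rightarrow> knot_pair \<Rightarrow> real list" where
  "knots Ax1 (x, y) = x"
| "knots Ax2 (x, y) = y"

fun set_knots :: "axis \<Rightarrow> real list \<Rightarrow> knot_pair \<Rightarrow> knot_pair" where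
  "set_knots Ax1 z (x, y) = (z, y)"
| "set_knots Ax2 z (x, y) = (x, z)"

definition is_knot_pair :: "(axis \<Rightarrow> nat) \<Rightarrow> knot_pair \<Rightarrow> bool" where
  "is_knot_pair p B \<longleftrightarrow> (\<forall>k. sorted (knots k B) \<and> length (knots k B) = p k + 2)"

fun supp :: "knot_pair \<Rightarrow> point set" where
  "supp (x, y) = cbox (hd x, hd y) (last x, last y)"

text \<open>The split of \<open>B\<close> at the knot \<open>t\<close> of its \<open>k\<close>-th knot vector; its multiplicity is
  \<open>count_list (knots k B) t\<close>.\<close>

definition bspline_split :: "axis \<Rightarrow> real \<Rightarrow> knot_pair \<Rightarrow> point set" where
  "bspline_split k t B = kseg k t (hd (knots (other k) B)) (last (knots (other k) B))"

section \<open>Minimal support B-splines\<close>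

definition has_support :: "mesh \<Rightarrow> knot_pair \<Rightarrow> bool" where
  "has_support M B \<longleftrightarrow> supp B \<subseteq> \<Union>(elems M) \<and>
     (\<forall>k. \<forall>t\<in>set (knots k B). \<exists>\<gamma>. mesh_split k (elems M) \<gamma> \<and>
        bspline_split k t B \<subseteq> \<gamma> \<and> count_list (knots k B) t \<le> split_mult M \<gamma>)"

definition minimal_support :: "mesh \<Rightarrow> knot_pair \<Rightarrow> bool" where
  "minimal_support M B \<longleftrightarrow> has_support M B \<and>
     (\<forall>k \<gamma>. mesh_split k (elems M) \<gamma> \<and> \<gamma> \<inter> interior (supp B) \<noteq> {} \<longrightarrow>
        (traverses \<gamma> (interior (supp B)) \<longleftrightarrow>
         (\<exists>t\<in>set (knots k B). bspline_split k t B \<subseteq> \<gamma> \<and>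
            count_list (knots k B) t = split_mult M \<gamma>)))"

definition MS_bsplines :: "(axis \<Rightarrow> nat) \<Rightarrow> mesh \<Rightarrow> (point \<Rightarrow> real) set" where
  "MS_bsplines p M = tensor_bspline ` {B. is_knot_pair p B \<and> minimal_support M B}"

section \<open>LR B-splines\<close>

definition initial_bsplines :: "(axis \<Rightarrow> nat) \<Rightarrow> real list \<Rightarrow> real list \<Rightarrow> knot_pair set" where
  "initial_bsplines p X Y =
     {(take (p Ax1 + 2) (drop i X), take (p Ax2 + 2) (drop j Y)) | i j.
        i + (p Ax1 + 2) \<le> length X \<and> j + (p Ax2 + 2) \<le> length Y}"

text \<open>One knot insertion: the knot \<open>c\<close> of a split of the mesh that traverses \<open>B\<close> and whose
  multiplicity \<open>B\<close> does not yet account for.\<close>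

definition knot_insertion :: "mesh \<Rightarrow> knot_pair set \<Rightarrow> knot_pair set \<Rightarrow> bool" where
  "knot_insertion M S S' \<longleftrightarrow>
     (\<exists>B\<in>S. \<not> minimal_support M B \<and>
        (\<exists>k c a b. mesh_split k (elems M) (kseg k c a b) \<and>
           traverses (kseg k c a b) (interior (supp B)) \<and>
           count_list (knots k B) c < split_mult M (kseg k c a b) \<and>
           S' = (S - {B}) \<union>
             {set_knots k (butlast (insort c (knots k B))) B,
              set_knots k (tl (insort c (knots k B))) B}))"

text \<open>\<open>LR_knots p M S\<close>: some construction sequence ending in \<open>M\<close>, and some run of the refinement
  procedure along it, end with the set \<open>S\<close>.\<close>

inductive LR_knots :: "(axis \<Rightarrow> nat) \<Rightarrow> mesh \<Rightarrow> knot_pair set \<Rightarrow> bool" for p where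
  initial: "initial_mesh p X Y M \<Longrightarrow> LR_knots p M (initial_bsplines p X Y)"
| step: "LR_knots p M S \<Longrightarrow> mesh_step p M M' \<Longrightarrow> (knot_insertion M')\<^sup>*\<^sup>* S S' \<Longrightarrow>
     (\<forall>B\<in>S'. minimal_support M' B) \<Longrightarrow> LR_knots p M' S'"

definition LR_bsplines :: "(axis \<Rightarrow> nat) \<Rightarrow> mesh \<Rightarrow> (point \<Rightarrow> real) set \<Rightarrow> bool" where
  "LR_bsplines p M F \<longleftrightarrow> (\<exists>S. LR_knots p M S \<and> F = tensor_bspline ` S)"

end

theory Submission
  imports Defs "HOL-Library.Multiset"
begin

text \<open>Let \<open>B\<close> be a tensor product B-spline whose knots inside its support are a single line of multiplicity
  \<open>p k\<close> and, if \<open>q = p (other k)\<close> is positive, a single orthogonal line of multiplicity \<open>q\<close>. Four further partial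
  lines arranged as a pinwheel do not traverse \<open>B\<close>, so \<open>B\<close> keeps minimal support. Inserting the knot of one or the
  other or both of the two new \<open>k\<close>-lines into the \<open>k\<close>-knots of \<open>B\<close> gives three expansions of the \<open>k\<close>-factor of \<open>B\<close>,
  and they are available in the lower, upper and middle part of the support respectively. As the other factor of
  \<open>B\<close> splits into B-splines living on these three parts, \<open>B\<close> is a combination of five smaller minimal support
  B-splines.

  The refinement procedure does not produce the B-spline in the middle of the pinwheel, because only \<open>B\<close> could be
  its ancestor. With an inner line of multiplicity \<open>p k - 1\<close> and one more \<open>k\<close>-line, a neighbour of \<open>B\<close> crosses the inner
  line as well, and its refinement supplies the middle part at the price of two more B-splines. Knot insertion
  always terminates and never removes a B-spline of minimal support, so it suffices to follow the ancestors of the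
  eight B-splines.

  In all meshes that occur the multiplicity of a meshline depends on its direction and coordinate only; such a mesh
  is determined, as far as splits are concerned, by the union of its lines.\<close>

section \<open>Boxes and their edges\<close>

text \<open>The count of five comes from regrouping. Split the other factor of \<open>B\<close> into
  a lower, a middle and an upper piece and substitute a different expansion of the
  \<open>k\<close>-factor in each: this gives 2 + 3 + 2 products. One outer \<open>k\<close>-factor
  occurs in the lower and in the middle expansion, the opposite one in the middle and in the upper
  expansion; each such pair of products merges, because the other factors add up to one B-spline. In
  the second example the expansions have 2, 4 and 3 terms, and the same two mergers leave seven.
  LR-rule 2 restricts the geometry: an arm of the pinwheel is short and has to reach lines of high
  multiplicity. Boundary lines therefore carry the full multiplicity \<open>p j + 1\<close>, so that
  one of them and one further crossing already give the required length. The other obstacle is that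
  both degrees are parameters, while the definitions quantify over all splits of point sets. Splits,
  lengths and minimal support are reduced to conditions on a short list of lines with symbolic
  multiplicities, which simplification can decide.\<close>

lemma other_other [simp]: "other (other k) = k"
  by (cases k) auto

lemma other_neq [simp]: "other k \<noteq> k" "k \<noteq> other k"
  by (cases k; simp)+

lemma axis_eq_other_iff: "j \<noteq> k \<longleftrightarrow> j = other k"
  by (cases j; cases k) auto

lemma all_axis: "(\<forall>j. Q j) \<longleftrightarrow> Q k \<and> Q (other k)"
  by (metis axis_eq_other_iff)

lemma coord_kpoint [simp]: "coord k (kpoint k c t) = c" "coord (other k) (kpoint k c t) = t"
  by (cases k; simp)+

lemma kpoint_coord [simp]: "kpoint k (coord k z) (coord (other k) z) = z"
  by (cases k) auto

lemma kpoint_other: "kpoint (other k) t c = kpoint k c t"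
  by (cases k) auto

lemma kpoint_eq_iff [simp]: "kpoint k c t = kpoint k c' t' \<longleftrightarrow> c = c' \<and> t = t'"
  by (cases k) auto

lemma mem_kseg: "z \<in> kseg k c a b \<longleftrightarrow> coord k z = c \<and> a \<le> coord (other k) z \<and> coord (other k) z \<le> b"
  by (cases k; cases z) (auto simp: kseg_def)

lemma kpoint_mem_kseg [simp]: "kpoint k c t \<in> kseg k c' a b \<longleftrightarrow> c = c' \<and> a \<le> t \<and> t \<le> b"
  by (simp add: mem_kseg)

lemma kseg_subset_iff: "a \<le> b \<Longrightarrow> kseg k c a b \<subseteq> kseg k c' a' b' \<longleftrightarrow> c = c' \<and> a' \<le> a \<and> b \<le> b'"
proof
  assume "a \<le> b" "kseg k c a b \<subseteq> kseg k c' a' b'"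
  moreover from \<open>a \<le> b\<close> have "kpoint k c a \<in> kseg k c a b" "kpoint k c b \<in> kseg k c a b" by auto
  ultimately show "c = c' \<and> a' \<le> a \<and> b \<le> b'" by (metis (no_types) kpoint_mem_kseg subsetD)
qed (auto simp: mem_kseg)

lemma kseg_inject: "a < b \<Longrightarrow> a' < b' \<Longrightarrow> kseg k c a b = kseg k c' a' b' \<longleftrightarrow> c = c' \<and> a = a' \<and> b = b'"
  by (smt (verit, best) kseg_subset_iff subset_refl)

lemma kseg_subset_axis:
  assumes "kseg k c a b \<subseteq> kseg k' c' a' b'" "a < b"
  shows "k = k'"
proof (rule ccontr)
  assume "k \<noteq> k'"
  then have k': "k' = other k" by (metis axis_eq_other_iff)
  have "kpoint k c a \<in> kseg k' c' a' b'" "kpoint k c b \<in> kseg k' c' a' b'"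
    by (rule subsetD[OF assms(1)], use assms(2) in simp)+
  then show False using assms(2) unfolding k' by (simp add: mem_kseg)
qed

lemma continuous_on_coord [continuous_intros]: "continuous_on A (coord k)"
  by (cases k) (simp_all add: continuous_on_fst continuous_on_snd continuous_on_Pair)

lemma continuous_on_kpoint: "continuous_on A (kpoint k c)"
  by (cases k) (simp_all add: continuous_on_fst continuous_on_snd continuous_on_Pair)

text \<open>Bounds are functions of the axis, so that one argument serves both directions and
  halving along \<open>k\<close> is the update \<open>u(k := c)\<close>.\<close>

definition Box :: "(axis \<Rightarrow> real) \<Rightarrow> (axis \<Rightarrow> real) \<Rightarrow> point set" where
  "Box l u = {z. \<forall>k. l k \<le> coord k z \<and> coord k z \<le> u k}"

lemma Box_eq_cbox: "Box l u = cbox (l Ax1, l Ax2) (u Ax1, u Ax2)"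
  by (auto simp: Box_def all_axis[of _ Ax1] cbox_Pair_eq)

lemma cbox_eq_Box: "cbox (a, c) (b, d) = Box (case_axis a c) (case_axis b d)"
  by (simp add: Box_eq_cbox)

lemma mem_interior_Box: "z \<in> interior (Box l u) \<longleftrightarrow> (\<forall>k. l k < coord k z \<and> coord k z < u k)"
  by (cases z) (auto simp: Box_eq_cbox all_axis[of _ Ax1] mem_box Basis_prod_def)

lemma mem_Box: "z \<in> Box l u \<longleftrightarrow> (\<forall>k. l k \<le> coord k z \<and> coord k z \<le> u k)"
  by (simp add: Box_def)

lemma rectangle_iff: "rectangle R \<longleftrightarrow> (\<exists>l u. (\<forall>k. l k < u k) \<and> R = Box l u)"
proof
  assume "rectangle R"
  then obtain a b c d where "a < b" "c < d" "R = cbox (a, c) (b, d)" by (auto simp: rectangle_def)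
  then show "\<exists>l u. (\<forall>k. l k < u k) \<and> R = Box l u"
    by (intro exI[of _ "case_axis a c"] exI[of _ "case_axis b d"])
       (simp add: cbox_eq_Box all_axis[of _ Ax1])
next
  assume "\<exists>l u. (\<forall>k. l k < u k) \<and> R = Box l u"
  then show "rectangle R" unfolding rectangle_def by (metis Box_eq_cbox)
qed

lemma frontier_Box: "frontier (Box l u) = Box l u - interior (Box l u)"
  by (simp add: frontier_def Box_eq_cbox)

lemma Box_inject:
  assumes "\<forall>k. l k < u k" "\<forall>k. l' k < u' k" "Box l u = Box l' u'"
  shows "l = l'" "u = u'"
proof -
  have "l' k \<le> l k \<and> u k \<le> u' k \<and> l k \<le> l' k \<and> u' k \<le> u k" for k
  proof -
    have "kpoint k (l k) (l (other k)) \<in> Box l' u'" "kpoint k (u k) (u (other k)) \<in> Box l' u'"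
      using assms(1) by (subst assms(3)[symmetric], simp add: mem_Box all_axis[of _ k] less_imp_le)+
    moreover have "kpoint k (l' k) (l' (other k)) \<in> Box l u" "kpoint k (u' k) (u' (other k)) \<in> Box l u"
      using assms(2) by (subst assms(3), simp add: mem_Box all_axis[of _ k] less_imp_le)+
    ultimately show ?thesis by (simp add: mem_Box all_axis[of _ k])
  qed
  then show "l = l'" "u = u'" by (auto simp: fun_eq_iff intro: antisym)
qed

text \<open>A point set rather than a family of segments: cutting a meshline at a new vertex does
  not change it. The sides are closed, so corners belong to the edges of both directions.\<close>

definition edges :: "axis \<Rightarrow> point set set \<Rightarrow> point set" where
  "edges k E = {z. \<exists>l u. Box l u \<in> E \<and> (\<forall>j. l j < u j) \<and> z \<in> Box l u \<and> coord k z \<in> {l k, u k}}"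

lemma edgesI:
  "Box l u \<in> E \<Longrightarrow> \<forall>j. l j < u j \<Longrightarrow> z \<in> Box l u \<Longrightarrow> coord k z \<in> {l k, u k} \<Longrightarrow> z \<in> edges k E"
  unfolding edges_def by blast

lemma edgesE:
  assumes "z \<in> edges k E"
  obtains l u where "Box l u \<in> E" "\<forall>j. l j < u j" "z \<in> Box l u" "coord k z \<in> {l k, u k}"
  using assms unfolding edges_def by blast

section \<open>Vertices as crossings of edges\<close>

lemma vertices_iff:
  "z \<in> vertices E \<longleftrightarrow> (\<exists>l u. Box l u \<in> E \<and> (\<forall>j. l j < u j) \<and> (\<forall>j. coord j z \<in> {l j, u j}))"
proof
  assume "z \<in> vertices E"
  then obtain a b c d where "a < b" "c < d" "cbox (a, c) (b, d) \<in> E" "z \<in> {a, b} \<times> {c, d}"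
    by (auto simp: vertices_def)
  then show "\<exists>l u. Box l u \<in> E \<and> (\<forall>j. l j < u j) \<and> (\<forall>j. coord j z \<in> {l j, u j})"
    by (intro exI[of _ "case_axis a c"] exI[of _ "case_axis b d"])
       (auto simp: cbox_eq_Box all_axis[of _ Ax1])
next
  assume "\<exists>l u. Box l u \<in> E \<and> (\<forall>j. l j < u j) \<and> (\<forall>j. coord j z \<in> {l j, u j})"
  then obtain l u where *: "Box l u \<in> E" "\<forall>j. l j < u j" "\<forall>j. coord j z \<in> {l j, u j}" by blast
  then have "z \<in> {l Ax1, u Ax1} \<times> {l Ax2, u Ax2}"
    by (cases z) (auto simp: all_axis[of _ Ax1])
  then show "z \<in> vertices E" unfolding vertices_def using * by (auto simp: Box_eq_cbox) blast+
qed

lemma vertices_subset_edges: "vertices E \<subseteq> edges k E"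
proof
  fix z assume "z \<in> vertices E"
  then obtain l u where *: "Box l u \<in> E" "\<forall>j. l j < u j" "\<forall>j. coord j z \<in> {l j, u j}"
    by (auto simp: vertices_iff)
  then have "z \<in> Box l u" by (smt (verit) insert_iff mem_Box singletonD)
  then show "z \<in> edges k E" using * by (blast intro: edgesI)
qed

lemma interval_overlap:
  fixes l u :: real
  assumes "l < u" "x \<in> {l, u}" "l' < x" "x < u'"
  shows "\<exists>y. l < y \<and> y < u \<and> l' < y \<and> y < u'"
proof -
  have "max l l' < min u u'" using assms by auto
  from dense[OF this] show ?thesis by auto
qed

text \<open>Two edges of different direction through a point that is a corner of neither element would make the
  interiors of the two elements overlap.\<close>

lemma vertices_eq_edges:
  assumes "box_partition \<Omega> E"
  shows "vertices E = edges k E \<inter> edges (other k) E"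
proof
  show "vertices E \<subseteq> edges k E \<inter> edges (other k) E" using vertices_subset_edges by blast
  show "edges k E \<inter> edges (other k) E \<subseteq> vertices E"
  proof
    fix z assume "z \<in> edges k E \<inter> edges (other k) E"
    then obtain l u l' u' where 1: "Box l u \<in> E" "\<forall>j. l j < u j" "z \<in> Box l u" "coord k z \<in> {l k, u k}"
      and 2: "Box l' u' \<in> E" "\<forall>j. l' j < u' j" "z \<in> Box l' u'" "coord (other k) z \<in> {l' (other k), u' (other k)}"
      by (auto elim!: edgesE)
    show "z \<in> vertices E"
    proof (rule ccontr)
      assume nv: "z \<notin> vertices E"
      have "coord (other k) z \<notin> {l (other k), u (other k)}"
        using nv 1 unfolding vertices_iff all_axis[of _ k] by blast
      then have a: "l (other k) < coord (other k) z" "coord (other k) z < u (other k)"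
        using 1(3) by (auto simp: mem_Box order.strict_iff_order)
      have "coord k z \<notin> {l' k, u' k}"
        using nv 2 unfolding vertices_iff all_axis[of _ k] by blast
      then have b: "l' k < coord k z" "coord k z < u' k"
        using 2(3) by (auto simp: mem_Box order.strict_iff_order)
      have ne: "Box l u \<noteq> Box l' u'"
        using 1 2 b Box_inject[of l u l' u'] by (metis insert_iff less_irrefl singletonD)
      have "\<exists>x. l k < x \<and> x < u k \<and> l' k < x \<and> x < u' k"
        using interval_overlap[of "l k" "u k" "coord k z" "l' k" "u' k"] 1 b by simp
      then obtain x where x: "l k < x" "x < u k" "l' k < x" "x < u' k" by blast
      have "\<exists>y. l' (other k) < y \<and> y < u' (other k) \<and> l (other k) < y \<and> y < u (other k)"
        using interval_overlap[of "l' (other k)" "u' (other k)" "coord (other k) z" "l (other k)" "u (other k)"]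
          2 a by simp
      then obtain y where y: "l (other k) < y" "y < u (other k)" "l' (other k) < y" "y < u' (other k)" by blast
      have "kpoint k x y \<in> interior (Box l u) \<inter> interior (Box l' u')"
        using x y by (simp add: mem_interior_Box all_axis[of _ k])
      moreover have "interior (Box l u) \<inter> interior (Box l' u') = {}"
        using assms 1(1) 2(1) ne by (auto simp: box_partition_def)
      ultimately show False by blast
    qed
  qed
qed

lemma box_partition_Box:
  assumes "box_partition \<Omega> E" "\<beta> \<in> E"
  obtains l u where "\<beta> = Box l u" "\<forall>j. l j < u j"
  using assms unfolding box_partition_def by (metis rectangle_iff)

lemma finite_vertices:
  assumes "box_partition \<Omega> E"
  shows "finite (vertices E)"
proof -
  \<comment> \<open>\<open>Inf\<close> and \<open>Sup\<close> of the coordinates recover the bounds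
    from an element given as a set, so its corners become a function of the element and finiteness
    of \<open>E\<close> can be used.\<close>
  have "vertices E \<subseteq> (\<Union>\<beta>\<in>E. {z. \<forall>j. coord j z \<in> {Inf (coord j ` \<beta>), Sup (coord j ` \<beta>)}})"
  proof
    fix z assume "z \<in> vertices E"
    then obtain l u where *: "Box l u \<in> E" "\<forall>j. l j < u j" "\<forall>j. coord j z \<in> {l j, u j}"
      by (auto simp: vertices_iff)
    have "coord j ` Box l u = {l j..u j}" for j
    proof
      show "{l j..u j} \<subseteq> coord j ` Box l u"
      proof
        fix x assume "x \<in> {l j..u j}"
        then have "kpoint j x (l (other j)) \<in> Box l u" using *(2) by (auto simp: mem_Box all_axis[of _ j] less_imp_le)
        then show "x \<in> coord j ` Box l u" by (metis coord_kpoint(1) image_eqI)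
      qed
    qed (auto simp: mem_Box)
    then have "Inf (coord j ` Box l u) = l j" "Sup (coord j ` Box l u) = u j" for j
      using *(2) by (simp_all add: less_imp_le)
    then show "z \<in> (\<Union>\<beta>\<in>E. {z. \<forall>j. coord j z \<in> {Inf (coord j ` \<beta>), Sup (coord j ` \<beta>)}})"
      using * by (intro UN_I[of "Box l u"]) auto
  qed
  moreover have "finite {z. \<forall>j. coord j z \<in> {f j, g j}}" for f g
  proof -
    have "{z. \<forall>j. coord j z \<in> {f j, g j}} = {f Ax1, g Ax1} \<times> {f Ax2, g Ax2}"
      by (auto simp: all_axis[of _ Ax1])
    then show ?thesis by simp
  qed
  ultimately show ?thesis
    using assms by (elim finite_subset) (auto simp: box_partition_def)
qed

lemma edges_subset:
  assumes "box_partition \<Omega> E" shows "edges k E \<subseteq> \<Omega>"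
  using assms by (auto simp: box_partition_def elim!: edgesE)

section \<open>Traversing a product of intervals\<close>

lemma convex_coords:
  assumes "convex I" "convex J"
  shows "convex {z. coord k z \<in> I \<and> coord (other k) z \<in> J}"
proof (cases k)
  case Ax1
  then have "{z. coord k z \<in> I \<and> coord (other k) z \<in> J} = I \<times> J" by auto
  then show ?thesis using assms by (simp add: convex_Times)
next
  case Ax2
  then have "{z. coord k z \<in> I \<and> coord (other k) z \<in> J} = J \<times> I" by auto
  then show ?thesis using assms by (simp add: convex_Times)
qed

lemma connected_Un_or_empty:
  "connected s \<Longrightarrow> connected t \<Longrightarrow> t = {} \<or> s \<inter> t \<noteq> {} \<Longrightarrow> connected (s \<union> t)"
  using connected_Un by auto

text \<open>What remains after removing the segment is a union of four convex pieces: the two sides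
  of the line, and the strips beyond \<open>b\<close> and before \<open>a\<close>. A nonempty strip
  spans all of \<open>I\<close> and links the two sides; if both strips are empty, the set is
  disconnected exactly when both sides are nonempty. The point \<open>x1\<close> rules out
  \<open>I = {c}\<close>, where removing a middle portion disconnects without crossing. General
  convex \<open>I\<close> and \<open>J\<close> cover closed elements as well as open interiors of
  supports.\<close>

lemma traverses_iff:
  assumes I: "convex (I :: real set)" and J: "convex (J :: real set)" "J \<noteq> {}" and x1: "x1 \<in> I" "x1 \<noteq> c"
  shows "traverses (kseg k c a b) {z. coord k z \<in> I \<and> coord (other k) z \<in> J} \<longleftrightarrow>
    (\<exists>x\<in>I. x < c) \<and> (\<exists>x\<in>I. c < x) \<and> J \<subseteq> {a..b}" (is "traverses ?g ?S \<longleftrightarrow> ?R")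
proof
  assume R: ?R
  then obtain x x' where x: "x \<in> I" "x < c" and x': "x' \<in> I" "c < x'" by blast
  obtain y where y: "y \<in> J" using J by blast
  show "traverses ?g ?S"
    unfolding traverses_def
  proof
    assume "connected (?S - ?g)"
    then have conn: "connected (coord k ` (?S - ?g))"
      by (intro connected_continuous_image continuous_on_coord)
    have "x \<in> coord k ` (?S - ?g)" "x' \<in> coord k ` (?S - ?g)"
      using x x' y by (auto simp: mem_kseg intro!: image_eqI[of _ "coord k" "kpoint k _ y"])
    then have "c \<in> coord k ` (?S - ?g)"
      using connectedD_interval[OF conn, of x x' c] x x' by auto
    then show False using R by (auto simp: mem_kseg)
  qed
next
  assume tr: "traverses ?g ?S"
  define T where "T I' J' = {z. coord k z \<in> I' \<and> coord (other k) z \<in> J'}" for I' J'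
  let ?A = "T (I \<inter> {..<c}) J" and ?C = "T (I \<inter> {c<..}) J"
  let ?B = "T I (J \<inter> {b<..})" and ?D = "T I (J \<inter> {..<a})"
  have conn: "connected ?A" "connected ?B" "connected ?C" "connected ?D"
    unfolding T_def by (intro convex_connected convex_coords convex_Int I J convex_real_interval)+
  have eq: "?S - ?g = ?A \<union> ?C \<union> ?B \<union> ?D" by (auto simp: T_def mem_kseg)
  have inT: "kpoint k x y \<in> T I' J' \<longleftrightarrow> x \<in> I' \<and> y \<in> J'" for x y I' J' by (simp add: T_def)
  have emp: "T I' J' = {} \<longleftrightarrow> I' = {} \<or> J' = {}" for I' J'
  proof -
    have "T I' J' \<noteq> {}" if "x \<in> I'" "y \<in> J'" for x y using inT[of x y I' J'] that by blast
    then show ?thesis by (auto simp: T_def)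
  qed
  have int: "T I' J' \<inter> T I'' J'' = T (I' \<inter> I'') (J' \<inter> J'')" for I' J' I'' J''
    by (auto simp: T_def)
  have x1': "x1 < c \<or> c < x1" using x1 by auto
  show ?R
  proof (rule ccontr)
    assume nR: "\<not> ?R"
    have "(\<exists>y\<in>J. b < y) \<or> (\<exists>y\<in>J. y < a) \<or> ?A = {} \<and> c < x1 \<or> ?C = {} \<and> x1 < c"
    proof (cases "J \<subseteq> {a..b}")
      case True
      then have "(\<forall>x\<in>I. \<not> x < c) \<or> (\<forall>x\<in>I. \<not> c < x)" using nR by blast
      then show ?thesis using x1 x1' unfolding emp by blast
    next
      case False
      then show ?thesis by force
    qed
    then consider (b) y where "y \<in> J" "b < y" | (d) y where "y \<in> J" "y < a"
      | (A) "?A = {}" "c < x1" | (C) "?C = {}" "x1 < c"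
      by blast
    then have "connected (?S - ?g)"
    proof cases
      case b
      have "connected (((?B \<union> ?A) \<union> ?C) \<union> ?D)"
        by (intro connected_Un_or_empty conn) (use b x1 x1' in \<open>auto simp: Int_Un_distrib2 Int_Un_distrib int emp\<close>)
      then show ?thesis by (simp add: eq Un_ac)
    next
      case d
      have "connected (((?D \<union> ?A) \<union> ?C) \<union> ?B)"
        by (intro connected_Un_or_empty conn) (use d x1 x1' in \<open>auto simp: Int_Un_distrib2 Int_Un_distrib int emp\<close>)
      then show ?thesis by (simp add: eq Un_ac)
    next
      case A
      have "connected ((?C \<union> ?D) \<union> ?B)"
        by (intro connected_Un_or_empty conn) (use A x1 J in \<open>auto simp: Int_Un_distrib2 Int_Un_distrib int emp\<close>)
      then show ?thesis using A by (simp add: eq Un_ac)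
    next
      case C
      have "connected ((?A \<union> ?D) \<union> ?B)"
        by (intro connected_Un_or_empty conn) (use C x1 J in \<open>auto simp: Int_Un_distrib2 Int_Un_distrib int emp\<close>)
      then show ?thesis using C by (simp add: eq Un_ac)
    qed
    then show False using tr by (simp add: traverses_def)
  qed
qed

lemma traverses_Box_iff:
  assumes "\<forall>j. l j < u j"
  shows "traverses (kseg k c a b) (Box l u) \<longleftrightarrow> l k < c \<and> c < u k \<and> a \<le> l (other k) \<and> u (other k) \<le> b"
proof -
  have lu: "l k < u k" "l (other k) < u (other k)" using assms by auto
  have S: "Box l u = {z. coord k z \<in> {l k..u k} \<and> coord (other k) z \<in> {l (other k)..u (other k)}}"
    by (auto simp: Box_def all_axis[of _ k])
  obtain x1 where "x1 \<in> {l k..u k}" "x1 \<noteq> c"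
    using lu(1) by (metis atLeastAtMost_iff less_imp_le order.refl order.strict_iff_order)
  then show ?thesis
    unfolding S using lu
    by (subst traverses_iff[of _ _ x1]) (auto simp: convex_real_interval intro: bexI[of _ "l k"] bexI[of _ "u k"])
qed

lemma traverses_interior_Box_iff:
  assumes "\<forall>j. l j < u j"
  shows "traverses (kseg k c a b) (interior (Box l u)) \<longleftrightarrow> l k < c \<and> c < u k \<and> a \<le> l (other k) \<and> u (other k) \<le> b"
proof -
  have lu: "l k < u k" "l (other k) < u (other k)" using assms by auto
  have S: "interior (Box l u) = {z. coord k z \<in> {l k<..<u k} \<and> coord (other k) z \<in> {l (other k)<..<u (other k)}}"
    by (auto simp: mem_interior_Box all_axis[of _ k])
  obtain x where x: "l k < x" "x < u k" using lu dense by blast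
  obtain x' where x': "l k < x'" "x' < x" using x dense by blast
  obtain x1 where "x1 \<in> {l k<..<u k}" "x1 \<noteq> c"
    using x x' that[of x] that[of x'] by (cases "x = c") auto
  moreover have "{l (other k)<..<u (other k)} \<subseteq> {a..b} \<longleftrightarrow> a \<le> l (other k) \<and> u (other k) \<le> b"
    using lu by (simp add: greaterThanLessThan_subseteq_atLeastAtMost_iff)
  moreover have "(\<exists>x\<in>{l k<..<u k}. x < c) \<and> (\<exists>x\<in>{l k<..<u k}. c < x) \<longleftrightarrow> l k < c \<and> c < u k"
    using dense[of "l k" "min c (u k)"] dense[of "max c (l k)" "u k"] lu by fastforce
  ultimately show ?thesis
    unfolding S using lu dense[OF lu(2)]
    by (subst traverses_iff[of _ _ x1]) (auto simp: convex_real_interval)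
qed

section \<open>Meshlines and splits\<close>

lemma kmeshlineE:
  assumes "\<sigma> \<in> kmeshlines k E"
  obtains c a b where "a < b" "\<sigma> = kseg k c a b"
  using assms unfolding kmeshlines_def by blast

lemma kmeshline_iff:
  assumes "a < b"
  shows "kseg k c a b \<in> kmeshlines k E \<longleftrightarrow>
    kseg k c a b \<subseteq> (\<Union>\<beta>\<in>E. frontier \<beta>) \<and> kseg k c a b \<inter> vertices E = {kpoint k c a, kpoint k c b}"
  (is "?L \<longleftrightarrow> ?R")
proof
  assume ?L
  then obtain c' a' b' where *: "a' < b'" "kseg k c a b = kseg k c' a' b'"
    "kseg k c' a' b' \<subseteq> (\<Union>\<beta>\<in>E. frontier \<beta>)" "kseg k c' a' b' \<inter> vertices E = {kpoint k c' a', kpoint k c' b'}"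
    unfolding kmeshlines_def by blast
  then have "c' = c" "a' = a" "b' = b" using kseg_inject[of a b a' b' k c c'] assms by auto
  then show ?R using * by simp
next
  assume ?R
  then show ?L using assms unfolding kmeshlines_def by blast
qed

lemma kmeshline_vertex_iff:
  assumes "kseg k c a b \<in> kmeshlines k E" "a < b" "a \<le> t" "t \<le> b"
  shows "kpoint k c t \<in> vertices E \<longleftrightarrow> t = a \<or> t = b"
proof -
  have "kpoint k c t \<in> kseg k c a b" using assms by simp
  then have "kpoint k c t \<in> vertices E \<longleftrightarrow> kpoint k c t \<in> {kpoint k c a, kpoint k c b}"
    using assms(1) unfolding kmeshline_iff[OF assms(2)] by blast
  then show ?thesis by simp
qed

lemma side_vertices:
  assumes "Box l u \<in> E" "\<forall>j. l j < u j" "c \<in> {l k, u k}"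
  shows "kpoint k c (l (other k)) \<in> vertices E" "kpoint k c (u (other k)) \<in> vertices E"
  unfolding vertices_iff all_axis[of _ k]
  using assms all_axis[of "\<lambda>j. l j < u j" k] by (intro exI[of _ l] exI[of _ u]; simp)+

lemma finite_line_vertices:
  assumes "box_partition \<Omega> E"
  shows "finite {t. kpoint k c t \<in> vertices E}"
proof -
  have "inj (kpoint k c)" by (simp add: inj_on_def)
  then show ?thesis using finite_vimageI[OF finite_vertices[OF assms]] by (simp add: vimage_def)
qed

text \<open>A point of a meshline could lie on an orthogonal side of an element. Choosing
  \<open>t\<close> away from the finitely many coordinates of vertices excludes this, so the point
  is on a \<open>k\<close>-side. The ends of that side are vertices and cannot fall strictly inside
  the meshline.\<close>

lemma kmeshline_on_side:
  assumes bp: "box_partition \<Omega> E" and ml: "kseg k c a b \<in> kmeshlines k E" and ab: "a < b"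
  obtains l u where "Box l u \<in> E" "\<forall>j. l j < u j" "c \<in> {l k, u k}" "l (other k) \<le> a" "b \<le> u (other k)"
proof -
  define F where "F = coord (other k) ` vertices E"
  have "finite F" unfolding F_def using finite_vertices[OF bp] by simp
  then have "infinite ({a<..<b} - F)" using infinite_Ioo[OF ab] by simp
  then obtain t where t: "a < t" "t < b" "t \<notin> F"
    by (metis DiffE ex_in_conv greaterThanLessThan_iff infinite_imp_nonempty)
  have "kpoint k c t \<in> kseg k c a b" using t by simp
  then obtain \<beta> where "\<beta> \<in> E" "kpoint k c t \<in> frontier \<beta>"
    using ml unfolding kmeshline_iff[OF ab] by blast
  then obtain l u where lu: "Box l u \<in> E" "\<forall>j. l j < u j" "kpoint k c t \<in> frontier (Box l u)"
    using box_partition_Box[OF bp] by metis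
  note V = side_vertices[OF lu(1,2)]
  have "l (other k) \<in> F" "u (other k) \<in> F"
    unfolding F_def by (intro image_eqI[OF _ V(1)[of "l k" k]] image_eqI[OF _ V(2)[of "l k" k]]; simp)+
  then have "t \<noteq> l (other k)" "t \<noteq> u (other k)" using t by auto
  then have c: "c \<in> {l k, u k}" "l (other k) \<le> t" "t \<le> u (other k)"
    using lu(3) by (auto simp: frontier_Box mem_interior_Box mem_Box all_axis[of _ k])
  have "\<not> (a < l (other k))" "\<not> (u (other k) < b)"
    using kmeshline_vertex_iff[OF ml ab, of "l (other k)"] kmeshline_vertex_iff[OF ml ab, of "u (other k)"]
      V[of c k] c t by auto
  then show thesis using that[of l u] lu c by auto
qed

lemma kmeshline_edges:
  assumes "box_partition \<Omega> E" "\<sigma> \<in> kmeshlines k E"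
  shows "\<sigma> \<subseteq> edges k E"
proof -
  obtain c a b where s: "a < b" "\<sigma> = kseg k c a b" using assms(2) by (rule kmeshlineE)
  obtain l u where lu: "Box l u \<in> E" "\<forall>j. l j < u j" "c \<in> {l k, u k}" "l (other k) \<le> a" "b \<le> u (other k)"
    using kmeshline_on_side[OF assms(1)] assms(2) s by metis
  show ?thesis
  proof
    fix z assume "z \<in> \<sigma>"
    then have "z \<in> Box l u" "coord k z \<in> {l k, u k}" 
      using lu s all_axis[of "\<lambda>j. l j < u j" k] by (auto simp: mem_kseg mem_Box all_axis[of _ k])
    then show "z \<in> edges k E" using lu by (blast intro: edgesI)
  qed
qed

text \<open>The side through the given point ends at vertices, so it reaches over all of
  \<open>[a, b]\<close>. The meshline is then cut out by the nearest vertices outside the open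
  interval, which still lie on this side.\<close>

lemma meshline_containing:
  assumes bp: "box_partition \<Omega> E" and nv: "\<And>t. a < t \<Longrightarrow> t < b \<Longrightarrow> kpoint k c t \<notin> vertices E"
    and t: "a < t" "t < b" "kpoint k c t \<in> edges k E"
  obtains a' b' where "a' \<le> a" "b \<le> b'" "kseg k c a' b' \<in> kmeshlines k E"
proof -
  obtain l u where lu: "Box l u \<in> E" "\<forall>j. l j < u j" "kpoint k c t \<in> Box l u" "c \<in> {l k, u k}"
    using t(3) by (auto elim!: edgesE)
  have ltu: "l (other k) \<le> t" "t \<le> u (other k)" using lu(3) by (auto simp: mem_Box all_axis[of _ k])
  note V = side_vertices[OF lu(1,2,4)]
  have "\<not> a < l (other k)" using nv[of "l (other k)"] V ltu t by auto
  moreover have "\<not> u (other k) < b" using nv[of "u (other k)"] V ltu t by auto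
  ultimately have la: "l (other k) \<le> a" "b \<le> u (other k)" by auto
  define W where "W = {t. kpoint k c t \<in> vertices E}"
  have fW: "finite W" using finite_line_vertices[OF bp] by (simp add: W_def)
  define a' where "a' = Max {v\<in>W. v \<le> a}"
  define b' where "b' = Min {v\<in>W. b \<le> v}"
  have lW: "l (other k) \<in> {v\<in>W. v \<le> a}" "u (other k) \<in> {v\<in>W. b \<le> v}" using V la by (auto simp: W_def)
  have a': "a' \<in> {v\<in>W. v \<le> a}" unfolding a'_def using fW lW by (intro Max_in) auto
  have b': "b' \<in> {v\<in>W. b \<le> v}" unfolding b'_def using fW lW by (intro Min_in) auto
  have la': "l (other k) \<le> a'" unfolding a'_def using fW lW by (intro Max_ge) auto
  have ub': "b' \<le> u (other k)" unfolding b'_def using fW lW by (intro Min_le) auto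
  have ab': "a' < b'" using a' b' t by auto
  have "kseg k c a' b' \<subseteq> (\<Union>\<beta>\<in>E. frontier \<beta>)"
  proof
    fix z assume "z \<in> kseg k c a' b'"
    then have "z \<in> frontier (Box l u)"
      using la' ub' lu(2,4) all_axis[of "\<lambda>j. l j < u j" k]
      by (auto simp: mem_kseg frontier_Box mem_interior_Box mem_Box all_axis[of _ k])
    then show "z \<in> (\<Union>\<beta>\<in>E. frontier \<beta>)" using lu(1) by blast
  qed
  moreover have "kseg k c a' b' \<inter> vertices E = {kpoint k c a', kpoint k c b'}"
  proof
    show "{kpoint k c a', kpoint k c b'} \<subseteq> kseg k c a' b' \<inter> vertices E"
      using a' b' ab' by (auto simp: W_def)
    show "kseg k c a' b' \<inter> vertices E \<subseteq> {kpoint k c a', kpoint k c b'}"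
    proof
      fix z assume z: "z \<in> kseg k c a' b' \<inter> vertices E"
      define s where "s = coord (other k) z"
      have zs: "z = kpoint k c s" using z by (auto simp: s_def mem_kseg)
      then have s: "a' \<le> s" "s \<le> b'" "s \<in> W" using z by (auto simp: W_def)
      have "s \<le> a \<Longrightarrow> s \<le> a'" unfolding a'_def using fW s by (intro Max_ge) auto
      moreover have "b \<le> s \<Longrightarrow> b' \<le> s" unfolding b'_def using fW s by (intro Min_le) auto
      ultimately have "s = a' \<or> s = b'" using nv[of s] s by (force simp: W_def)
      then show "z \<in> {kpoint k c a', kpoint k c b'}" using zs by auto
    qed
  qed
  ultimately show thesis using that[of a' b'] a' b' ab' by (auto simp: kmeshline_iff)
qed

lemma meshlineE:
  assumes "\<tau> \<in> meshlines E"
  obtains k c a b where "a < b" "\<tau> = kseg k c a b" "\<tau> \<in> kmeshlines k E"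
proof -
  obtain k where "\<tau> \<in> kmeshlines k E" using assms by (auto simp: meshlines_def)
  then show thesis using kmeshlineE that by metis
qed

text \<open>If two meshlines of one line overlap but differ, an end of one is a third vertex on the
  other. This makes the definite description in \<open>insert_split\<close> meaningful.\<close>

lemma meshline_unique:
  assumes ab: "a < b" and 1: "\<tau> \<in> meshlines E" "kseg k c a b \<subseteq> \<tau>" and 2: "\<tau>' \<in> meshlines E" "kseg k c a b \<subseteq> \<tau>'"
  shows "\<tau> = \<tau>'"
proof -
  have form: "\<exists>x y. \<sigma> = kseg k c x y \<and> x \<le> a \<and> b \<le> y \<and> \<sigma> \<in> kmeshlines k E"
    if \<sigma>: "\<sigma> \<in> meshlines E" "kseg k c a b \<subseteq> \<sigma>" for \<sigma>
  proof -
    obtain k' c' x y where *: "x < y" "\<sigma> = kseg k' c' x y" "\<sigma> \<in> kmeshlines k' E"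
      using \<sigma>(1) by (rule meshlineE)
    then have "k' = k" using kseg_subset_axis[of k c a b k' c' x y] \<sigma> ab by auto
    then show ?thesis using * \<sigma>(2) ab kseg_subset_iff[of a b k c c' x y] by auto
  qed
  obtain x y x' y' where x: "\<tau> = kseg k c x y" "x \<le> a" "b \<le> y" "kseg k c x y \<in> kmeshlines k E"
    and x': "\<tau>' = kseg k c x' y'" "x' \<le> a" "b \<le> y'" "kseg k c x' y' \<in> kmeshlines k E"
    using form[OF 1] form[OF 2] by blast
  have "\<not> x < x'" "\<not> y' < y" "\<not> x' < x" "\<not> y < y'"
    using kmeshline_vertex_iff[OF x(4)] kmeshline_vertex_iff[OF x'(4)] x x' ab by (smt (verit, best))+
  then show ?thesis using x x' by simp
qed

lemma consecutive_around:
  fixes t :: real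
  assumes "finite W" "a \<in> W" "b \<in> W" "a < b" "a \<le> t" "t \<le> b"
  obtains v v' where "v \<in> W" "v' \<in> W" "v < v'" "v \<le> t" "t \<le> v'" "a \<le> v" "v' \<le> b"
    "\<And>x. v < x \<Longrightarrow> x < v' \<Longrightarrow> x \<notin> W"
proof (cases "t < b")
  case True
  define v where "v = Max {v\<in>W. v \<le> t}"
  define v' where "v' = Min {v\<in>W. t < v}"
  have "v \<in> {v\<in>W. v \<le> t}" unfolding v_def using assms by (intro Max_in) auto
  moreover have "v' \<in> {v\<in>W. t < v}" unfolding v'_def using assms True by (intro Min_in) auto
  moreover have "x \<le> v" if "x \<in> W" "x \<le> t" for x unfolding v_def using assms that by (intro Max_ge) auto
  moreover have "v' \<le> x" if "x \<in> W" "t < x" for x unfolding v'_def using assms that by (intro Min_le) auto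
  ultimately show thesis using that[of v v'] assms True by (auto; smt (verit, best))
next
  case False
  define v where "v = Max {v\<in>W. v < b}"
  have "v \<in> {v\<in>W. v < b}" unfolding v_def using assms by (intro Max_in) auto
  moreover have "x \<le> v" if "x \<in> W" "x < b" for x unfolding v_def using assms that by (intro Max_ge) auto
  ultimately show thesis using that[of v b] assms False by (auto; smt (verit, best))
qed

text \<open>Since both ends are vertices, cutting the segment at the vertices on it gives complete
  meshlines. The family consists of all meshlines inside the segment; it is finite because each is
  determined by a pair of vertices.\<close>

lemma mesh_split_intro:
  assumes bp: "box_partition \<Omega> E" and ab: "a < b"
    and v: "kpoint k c a \<in> vertices E" "kpoint k c b \<in> vertices E"
    and e: "\<And>t. a < t \<Longrightarrow> t < b \<Longrightarrow> kpoint k c t \<in> edges k E"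
  shows "mesh_split k E (kseg k c a b)"
proof -
  define W where "W = {t. kpoint k c t \<in> vertices E}"
  have fW: "finite W" using finite_line_vertices[OF bp] by (simp add: W_def)
  define \<Gamma> where "\<Gamma> = {\<sigma> \<in> kmeshlines k E. \<sigma> \<subseteq> kseg k c a b}"
  have "\<Gamma> \<subseteq> (\<lambda>(s, t). kseg k c s t) ` (W \<times> W)"
  proof
    fix \<sigma> assume \<sigma>: "\<sigma> \<in> \<Gamma>"
    then obtain c' s t where st: "s < t" "\<sigma> = kseg k c' s t" by (auto simp: \<Gamma>_def elim: kmeshlineE)
    then have "c' = c" using \<sigma> kseg_subset_iff[of s t k c' c a b] by (auto simp: \<Gamma>_def)
    then have "kseg k c s t \<in> kmeshlines k E" using \<sigma> st by (simp add: \<Gamma>_def)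
    then have "(s, t) \<in> W \<times> W" using st kmeshline_vertex_iff[of k c s t E] by (simp add: W_def)
    then show "\<sigma> \<in> (\<lambda>(s, t). kseg k c s t) ` (W \<times> W)"
      using st \<open>c' = c\<close> by (intro image_eqI[of _ _ "(s, t)"]) auto
  qed
  then have "finite \<Gamma>" using fW by (meson finite_SigmaI finite_imageI finite_subset)
  moreover have "kseg k c a b = \<Union>\<Gamma>"
  proof
    show "kseg k c a b \<subseteq> \<Union>\<Gamma>"
    proof
      fix z assume z: "z \<in> kseg k c a b"
      define t where "t = coord (other k) z"
      have zt: "z = kpoint k c t" "a \<le> t" "t \<le> b" using z by (auto simp: t_def mem_kseg)
      obtain x y where xy: "x \<in> W" "y \<in> W" "x < y" "x \<le> t" "t \<le> y" "a \<le> x" "y \<le> b"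
          "\<And>s. x < s \<Longrightarrow> s < y \<Longrightarrow> s \<notin> W"
        by (rule consecutive_around[OF fW _ _ ab zt(2,3)]) (use v in \<open>auto simp: W_def\<close>)
      obtain s where s: "x < s" "s < y" using dense xy by blast
      obtain a' b' where ab': "a' \<le> x" "y \<le> b'" "kseg k c a' b' \<in> kmeshlines k E"
        by (rule meshline_containing[OF bp, of x y k c s]) (use xy s e[of s] in \<open>auto simp: W_def\<close>)
      then have "x = a' \<or> x = b'" "y = a' \<or> y = b'"
        using kmeshline_vertex_iff[OF ab'(3)] xy by (auto simp: W_def)
      then have "x = a'" "y = b'" using ab' xy by auto
      then show "z \<in> \<Union>\<Gamma>" using ab' xy zt
        by (intro UnionI[of "kseg k c a' b'"]) (auto simp: \<Gamma>_def kseg_subset_iff)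
    qed
  qed (auto simp: \<Gamma>_def)
  ultimately show ?thesis unfolding mesh_split_def is_kseg_def using ab \<Gamma>_def by blast
qed

lemma mesh_splitE:
  assumes "mesh_split k E \<gamma>"
  obtains c a b where "a < b" "\<gamma> = kseg k c a b"
  using assms unfolding mesh_split_def is_kseg_def by blast

lemma mesh_split_edges:
  assumes "box_partition \<Omega> E" "mesh_split k E \<gamma>"
  shows "\<gamma> \<subseteq> edges k E"
  using assms kmeshline_edges[OF assms(1)] unfolding mesh_split_def by blast

lemma mesh_split_meshline:
  assumes "mesh_split k E \<gamma>" "z \<in> \<gamma>"
  obtains \<sigma> where "\<sigma> \<in> kmeshlines k E" "\<sigma> \<subseteq> \<gamma>" "z \<in> \<sigma>"
  using assms unfolding mesh_split_def by blast

lemma mesh_split_ends: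
  assumes "mesh_split k E (kseg k c a b)" "a < b" "t \<in> {a, b}"
  shows "kpoint k c t \<in> vertices E"
proof -
  have "kpoint k c t \<in> kseg k c a b" using assms by auto
  then obtain \<sigma> where \<sigma>: "\<sigma> \<in> kmeshlines k E" "\<sigma> \<subseteq> kseg k c a b" "kpoint k c t \<in> \<sigma>"
    using mesh_split_meshline[OF assms(1)] by metis
  obtain c' x y where xy: "x < y" "\<sigma> = kseg k c' x y" using \<sigma>(1) by (rule kmeshlineE)
  then have "c' = c" "a \<le> x" "y \<le> b" using \<sigma>(2) kseg_subset_iff[of x y k c' c a b] by auto
  then show ?thesis using \<sigma> xy assms(3) kmeshline_vertex_iff[of k c x y E t] by force
qed

lemma edge_in_meshline:
  assumes "box_partition \<Omega> E" "z \<in> edges k E"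
  obtains \<sigma> where "\<sigma> \<in> kmeshlines k E" "z \<in> \<sigma>"
proof -
  obtain l u where lu: "Box l u \<in> E" "\<forall>j. l j < u j" "z \<in> Box l u" "coord k z \<in> {l k, u k}"
    using assms(2) by (rule edgesE)
  have "mesh_split k E (kseg k (coord k z) (l (other k)) (u (other k)))"
  proof (rule mesh_split_intro[OF assms(1)])
    fix t assume "l (other k) < t" "t < u (other k)"
    then have "kpoint k (coord k z) t \<in> Box l u" using lu(3) by (auto simp: mem_Box all_axis[of _ k])
    then show "kpoint k (coord k z) t \<in> edges k E" using lu by (intro edgesI[OF lu(1,2)]) auto
  qed (use lu side_vertices[OF lu(1,2,4)] in auto)
  moreover have "z \<in> kseg k (coord k z) (l (other k)) (u (other k))"
    using lu(3) by (auto simp: mem_kseg mem_Box)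
  ultimately show thesis using mesh_split_meshline that by metis
qed

text \<open>If edges continued beyond an end of the split, the meshline starting at that end would
  be contiguous and colinear with it, against maximality.\<close>

lemma maximal_split_contains:
  assumes bp: "box_partition \<Omega> E" and mx: "maximal_split k E (kseg k c a b)" and ab: "a < b"
    and s: "a \<le> s" "s \<le> b" "a' \<le> s" "s \<le> b'"
    and e: "\<And>t. a' \<le> t \<Longrightarrow> t \<le> b' \<Longrightarrow> kpoint k c t \<in> edges k E"
  shows "a \<le> a' \<and> b' \<le> b"
proof -
  define W where "W = {t. kpoint k c t \<in> vertices E}"
  have fW: "finite W" using finite_line_vertices[OF bp] by (simp add: W_def)
  have ms: "mesh_split k E (kseg k c a b)" using mx by (simp add: maximal_split_def)
  have abW: "a \<in> W" "b \<in> W" using mesh_split_ends[OF ms ab] by (auto simp: W_def)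
  have mx': "kseg k c x y \<subseteq> kseg k c a b"
    if "kseg k c x y \<in> kmeshlines k E" "x < y" "x = b \<or> y = a" for x y
  proof -
    have "kseg k c x y \<union> kseg k c a b = kseg k c (min x a) (max y b)"
      using that ab by (auto simp: mem_kseg)
    then have "is_kseg k (kseg k c x y \<union> kseg k c a b)"
      unfolding is_kseg_def using ab by (metis min.strict_coboundedI2 max.strict_coboundedI2)
    then show ?thesis using mx that(1) unfolding maximal_split_def by blast
  qed
  have "b' \<le> b"
  proof (rule ccontr)
    assume bb': "\<not> b' \<le> b"
    \<comment> \<open>The next vertex after \<open>b\<close>, capped by \<open>b'\<close>: up to
      \<open>x\<close> there is no vertex, and the points in between are known to lie on
      edges.\<close>
    define x where "x = Min (insert b' {v\<in>W. b < v})"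
    have "x \<in> insert b' {v\<in>W. b < v}" unfolding x_def using fW by (intro Min_in) auto
    then have bx: "b < x" using bb' by auto
    have xl: "x \<le> v" if "v = b' \<or> v \<in> W \<and> b < v" for v unfolding x_def using fW that by (intro Min_le) auto
    obtain t where t: "b < t" "t < x" using dense bx by blast
    have "kpoint k c t \<in> edges k E" using e[of t] t xl[of b'] s by auto
    moreover have "\<And>y. b < y \<Longrightarrow> y < x \<Longrightarrow> kpoint k c y \<notin> vertices E"
      using xl by (force simp: W_def)
    ultimately obtain \<alpha> \<beta> where \<alpha>: "\<alpha> \<le> b" "x \<le> \<beta>" "kseg k c \<alpha> \<beta> \<in> kmeshlines k E"
      using meshline_containing[OF bp, of b x k c t] t by blast
    then have "\<alpha> = b" using kmeshline_vertex_iff[OF \<alpha>(3), of b] abW bx by (auto simp: W_def)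
    then show False using mx'[OF \<alpha>(3)] \<alpha> bx kseg_subset_iff[of \<alpha> \<beta> k c c a b] by auto
  qed
  moreover have "a \<le> a'"
  proof (rule ccontr)
    assume aa': "\<not> a \<le> a'"
    define x where "x = Max (insert a' {v\<in>W. v < a})"
    have "x \<in> insert a' {v\<in>W. v < a}" unfolding x_def using fW by (intro Max_in) auto
    then have xa: "x < a" using aa' by auto
    have xl: "v \<le> x" if "v = a' \<or> v \<in> W \<and> v < a" for v unfolding x_def using fW that by (intro Max_ge) auto
    obtain t where t: "x < t" "t < a" using dense xa by blast
    have "kpoint k c t \<in> edges k E" using e[of t] t xl[of a'] s by auto
    moreover have "\<And>y. x < y \<Longrightarrow> y < a \<Longrightarrow> kpoint k c y \<notin> vertices E"
      using xl by (force simp: W_def)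
    ultimately obtain \<alpha> \<beta> where \<alpha>: "\<alpha> \<le> x" "a \<le> \<beta>" "kseg k c \<alpha> \<beta> \<in> kmeshlines k E"
      using meshline_containing[OF bp, of x a k c t] t by blast
    then have "\<beta> = a" using kmeshline_vertex_iff[OF \<alpha>(3), of a] abW xa by (auto simp: W_def)
    then show False using mx'[OF \<alpha>(3)] \<alpha> xa kseg_subset_iff[of \<alpha> \<beta> k c c a b] by auto
  qed
  ultimately show ?thesis by simp
qed

section \<open>Meshes whose multiplicities depend on the line only\<close>

text \<open>The weight belongs to the whole line, so subdividing a meshline or inserting a disjoint
  piece of the same line never changes the prescribed value, and splits are constant
  automatically.\<close>

definition weighted :: "(axis \<Rightarrow> real \<Rightarrow> nat) \<Rightarrow> mesh \<Rightarrow> bool" where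
  "weighted w M \<longleftrightarrow> (\<forall>k c a b. kseg k c a b \<in> kmeshlines k (elems M) \<longrightarrow> a < b \<longrightarrow> mu M (kseg k c a b) = w k c)"

lemma split_mult_weighted:
  assumes w: "weighted w M" and ms: "mesh_split k (elems M) (kseg k c a b)" and ab: "a < b"
  shows "split_mult M (kseg k c a b) = w k c"
proof -
  have eq: "mu M \<sigma> = w k c" if \<sigma>: "\<sigma> \<in> meshlines (elems M)" "\<sigma> \<subseteq> kseg k c a b" for \<sigma>
  proof -
    obtain k' c' x y where *: "x < y" "\<sigma> = kseg k' c' x y" "\<sigma> \<in> kmeshlines k' (elems M)"
      using \<sigma>(1) by (rule meshlineE)
    then have "k' = k" using kseg_subset_axis[of k' c' x y k c a b] \<sigma> by auto
    then have "c' = c" using * \<sigma>(2) kseg_subset_iff[of x y k c' c a b] by auto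
    then show ?thesis using * w \<open>k' = k\<close> by (auto simp: weighted_def)
  qed
  have "kpoint k c a \<in> kseg k c a b" using ab by simp
  then obtain \<sigma> where "\<sigma> \<in> kmeshlines k (elems M)" "\<sigma> \<subseteq> kseg k c a b"
    using mesh_split_meshline[OF ms] by metis
  then have "\<sigma> \<in> meshlines (elems M)" "\<sigma> \<subseteq> kseg k c a b" by (auto simp: meshlines_def)
  then show ?thesis unfolding split_mult_def using eq by (intro the_equality) auto
qed

lemma constant_splits_weighted:
  assumes "weighted w M"
  shows "constant_splits M"
  unfolding constant_splits_def
proof (intro allI impI ballI)
  fix k \<gamma> \<sigma> \<tau>
  assume mx: "maximal_split k (elems M) \<gamma>" and \<sigma>: "\<sigma> \<in> kmeshlines k (elems M)"
    and \<tau>: "\<tau> \<in> kmeshlines k (elems M)" and sub: "\<sigma> \<subseteq> \<gamma> \<and> \<tau> \<subseteq> \<gamma>"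
  obtain c a b where "a < b" "\<gamma> = kseg k c a b"
    using mx unfolding maximal_split_def by (auto elim: mesh_splitE)
  moreover obtain c' a' b' where "a' < b'" "\<sigma> = kseg k c' a' b'" using \<sigma> by (rule kmeshlineE)
  moreover obtain c'' a'' b'' where "a'' < b''" "\<tau> = kseg k c'' a'' b''" using \<tau> by (rule kmeshlineE)
  ultimately show "mu M \<sigma> = mu M \<tau>"
    using assms \<sigma> \<tau> sub kseg_subset_iff[of a' b' k c' c a b] kseg_subset_iff[of a'' b'' k c'' c a b]
    by (auto simp: weighted_def)
qed

text \<open>LR-rule 2 is a lower bound, so exhibiting some crossings \<open>T\<close> is enough. A
  crossing lies on edges of both directions and hence is a vertex, and the maximum there is taken
  over a single value.\<close>

lemma split_length_ge:
  assumes bp: "box_partition \<Omega> (elems M)" and w: "weighted w M"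
    and mx: "maximal_split k (elems M) (kseg k c a b)" and ab: "a < b"
    and T: "T \<subseteq> {a..b}" "\<And>t. t \<in> T \<Longrightarrow> kpoint k c t \<in> edges (other k) (elems M)"
  shows "sum (w (other k)) T \<le> split_length M k (kseg k c a b)"
proof -
  let ?f = "\<lambda>v. Max (mu M ` {\<sigma>\<in>kmeshlines (other k) (elems M). v \<in> \<sigma>})"
  have ms: "mesh_split k (elems M) (kseg k c a b)" using mx by (simp add: maximal_split_def)
  have f: "?f (kpoint k c t) = w (other k) t" if t: "t \<in> T" for t
  proof -
    have "mu M \<sigma> = w (other k) t" if \<sigma>: "\<sigma> \<in> kmeshlines (other k) (elems M)" "kpoint k c t \<in> \<sigma>" for \<sigma>
    proof -
      obtain c' x y where xy: "x < y" "\<sigma> = kseg (other k) c' x y" using \<sigma>(1) by (rule kmeshlineE)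
      moreover have "c' = t" using \<sigma>(2) xy by (simp add: mem_kseg)
      ultimately show ?thesis using w \<sigma>(1) by (auto simp: weighted_def)
    qed
    moreover obtain \<sigma> where "\<sigma> \<in> kmeshlines (other k) (elems M)" "kpoint k c t \<in> \<sigma>"
      using edge_in_meshline[OF bp T(2)[OF t]] by metis
    ultimately have "mu M ` {\<sigma>\<in>kmeshlines (other k) (elems M). kpoint k c t \<in> \<sigma>} = {w (other k) t}"
      by auto
    then show ?thesis by simp
  qed
  have sub: "kpoint k c ` T \<subseteq> vertices (elems M) \<inter> kseg k c a b"
  proof
    fix z assume "z \<in> kpoint k c ` T"
    then obtain t where t: "t \<in> T" "z = kpoint k c t" by blast
    then have "z \<in> kseg k c a b" using T(1) by auto
    moreover have "z \<in> edges k (elems M)" using mesh_split_edges[OF bp ms] calculation by blast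
    ultimately show "z \<in> vertices (elems M) \<inter> kseg k c a b"
      using T(2) t vertices_eq_edges[OF bp, of k] by blast
  qed
  have "sum (w (other k)) T = sum ?f (kpoint k c ` T)"
    using f by (subst sum.reindex) (auto simp: inj_on_def)
  also have "\<dots> \<le> sum ?f (vertices (elems M) \<inter> kseg k c a b)"
    using sub finite_vertices[OF bp] by (intro sum_mono2) auto
  finally show ?thesis unfolding split_length_def .
qed

text \<open>\<open>S k\<close> lists the lines of direction \<open>k\<close> as triples (coordinate, start, end).\<close>

definition drawn :: "point set \<Rightarrow> (axis \<Rightarrow> real \<Rightarrow> nat) \<Rightarrow> (axis \<Rightarrow> (real \<times> real \<times> real) set) \<Rightarrow> mesh \<Rightarrow> bool" where
  "drawn \<Omega> w S M \<longleftrightarrow> box_partition \<Omega> (elems M) \<and> weighted w M \<and>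
     (\<forall>k. edges k (elems M) = (\<Union>(c, a, b)\<in>S k. kseg k c a b)) \<and> (\<forall>k. \<forall>(c, a, b)\<in>S k. a < b)"

lemma drawn_edges_iff:
  assumes "drawn \<Omega> w S M"
  shows "z \<in> edges k (elems M) \<longleftrightarrow>
    (\<exists>a b. (coord k z, a, b) \<in> S k \<and> a \<le> coord (other k) z \<and> coord (other k) z \<le> b)"
proof -
  have "edges k (elems M) = (\<Union>(c, a, b)\<in>S k. kseg k c a b)" using assms by (simp add: drawn_def)
  then show ?thesis by (simp add: Bex_def split_paired_Ex mem_kseg)
qed

text \<open>Only the union of the lines matters; this allows two contiguous pieces to be listed as
  one line.\<close>

lemma drawn_cong:
  assumes "drawn \<Omega> w S M" "\<And>k. (\<Union>(c, a, b)\<in>S' k. kseg k c a b) = (\<Union>(c, a, b)\<in>S k. kseg k c a b)"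
    "\<And>k c a b. (c, a, b) \<in> S' k \<Longrightarrow> a < b"
  shows "drawn \<Omega> w S' M"
  using assms(1,2) assms(3) unfolding drawn_def by fastforce

text \<open>Lengths are required for listed lines instead of maximal splits: a maximal split starts
  on some listed line and by maximality contains all of it, so the crossings of that line count for
  the split.\<close>

lemma admissible_drawn:
  assumes dr: "drawn \<Omega> w S M"
    and wt: "\<And>k c a b. (c, a, b) \<in> S k \<Longrightarrow> 1 \<le> w k c \<and> w k c \<le> p k + 1"
    and len: "\<And>k c a b. (c, a, b) \<in> S k \<Longrightarrow> \<exists>T. T \<subseteq> {a..b} \<and>
      (\<forall>t\<in>T. \<exists>a' b'. (t, a', b') \<in> S (other k) \<and> a' \<le> c \<and> c \<le> b') \<and> p (other k) + 2 \<le> sum (w (other k)) T"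
  shows "admissible p M"
proof -
  have bp: "box_partition \<Omega> (elems M)" and w: "weighted w M" using dr by (auto simp: drawn_def)
  have "1 \<le> mu M \<sigma> \<and> mu M \<sigma> \<le> p k + 1" if \<sigma>: "\<sigma> \<in> kmeshlines k (elems M)" for k \<sigma>
  proof -
    obtain c a b where s: "a < b" "\<sigma> = kseg k c a b" using \<sigma> by (rule kmeshlineE)
    then have "kpoint k c a \<in> edges k (elems M)" using kmeshline_edges[OF bp \<sigma>] by auto
    then have "1 \<le> w k c \<and> w k c \<le> p k + 1" using wt by (auto simp: drawn_edges_iff[OF dr])
    then show ?thesis using w s \<sigma> by (auto simp: weighted_def)
  qed
  moreover have "p (other k) + 2 \<le> split_length M k \<gamma>" if mx: "maximal_split k (elems M) \<gamma>" for k \<gamma>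
  proof -
    have ms: "mesh_split k (elems M) \<gamma>" using mx by (simp add: maximal_split_def)
    obtain c a b where s: "a < b" "\<gamma> = kseg k c a b" using ms by (rule mesh_splitE)
    then have "kpoint k c a \<in> edges k (elems M)" using mesh_split_edges[OF bp ms] by auto
    then obtain a' b' where S: "(c, a', b') \<in> S k" "a' \<le> a" "a \<le> b'" by (auto simp: drawn_edges_iff[OF dr])
    have e: "kpoint k c t \<in> edges k (elems M)" if "a' \<le> t" "t \<le> b'" for t
      using S that by (auto simp: drawn_edges_iff[OF dr])
    have sub: "a \<le> a' \<and> b' \<le> b"
      by (rule maximal_split_contains[OF bp mx[unfolded s] s(1), of a]) (use S e s in auto)
    obtain T where T: "T \<subseteq> {a'..b'}" "p (other k) + 2 \<le> sum (w (other k)) T"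
      "\<forall>t\<in>T. \<exists>x y. (t, x, y) \<in> S (other k) \<and> x \<le> c \<and> c \<le> y"
      using len[OF S(1)] by blast
    have "T \<subseteq> {a..b}" using T sub by auto
    moreover have "kpoint k c t \<in> edges (other k) (elems M)" if "t \<in> T" for t
      using T(3) that by (auto simp: drawn_edges_iff[OF dr])
    ultimately have "sum (w (other k)) T \<le> split_length M k \<gamma>"
      unfolding s(2) by (intro split_length_ge[OF bp w mx[unfolded s] s(1)]) auto
    then show ?thesis using T by simp
  qed
  ultimately show ?thesis
    unfolding admissible_def using bp constant_splits_weighted[OF w] by blast
qed

section \<open>Insertion of a split\<close>

lemma closed_Box: "closed (Box l u)"
  unfolding Box_eq_cbox by (rule closed_cbox)

lemma convex_Box: "convex (Box l u)"
  unfolding Box_eq_cbox by (rule convex_box)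

text \<open>A point of an element is a limit of interior points of that element, while the interiors
  of two elements are disjoint open sets. So an edge of one element cannot enter the interior of
  another.\<close>

lemma interior_not_edge:
  assumes bp: "box_partition \<Omega> E" and lu: "Box l u \<in> E" and z: "z \<in> interior (Box l u)"
  shows "z \<notin> edges j E"
proof
  assume "z \<in> edges j E"
  then obtain l' u' where lu': "Box l' u' \<in> E" "\<forall>j. l' j < u' j" "z \<in> Box l' u'" "coord j z \<in> {l' j, u' j}"
    by (rule edgesE)
  have "z \<notin> interior (Box l' u')" using lu'(4) by (auto simp: mem_interior_Box intro!: exI[of _ j])
  then have "Box l u \<noteq> Box l' u'" using z by metis
  then have "interior (Box l u) \<inter> interior (Box l' u') = {}"
    using bp lu lu' unfolding box_partition_def by blast
  then have "interior (Box l u) \<inter> closure (interior (Box l' u')) = {}"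
    by (simp add: open_Int_closure_eq_empty)
  moreover have "interior (Box l' u') \<noteq> {}"
  proof -
    obtain x y where "l' Ax1 < x" "x < u' Ax1" "l' Ax2 < y" "y < u' Ax2"
      using lu'(2) dense by meson
    then have "(x, y) \<in> interior (Box l' u')" by (simp add: mem_interior_Box all_axis[of _ Ax1])
    then show ?thesis by blast
  qed
  moreover have "convex (Box l' u')" "closed (Box l' u')" by (simp_all add: closed_Box convex_Box)
  ultimately show False using convex_closure_interior[of "Box l' u'"] lu' z by auto
qed

text \<open>An inner point of the segment is not on a \<open>k\<close>-edge, so it lies strictly
  between the two \<open>k\<close>-sides of its element. That element cannot reach past
  \<open>a\<close> or \<open>b\<close>, since the ends lie on orthogonal edges, which avoid
  interiors. Hence it is traversed.\<close>

lemma insertion_chords: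
  assumes bp: "box_partition \<Omega> E" and ab: "a < b"
    and ends: "kpoint k c a \<in> edges (other k) E" "kpoint k c b \<in> edges (other k) E"
    and free: "\<forall>t. a < t \<and> t < b \<longrightarrow> kpoint k c t \<notin> edges k E"
  shows "(\<Union>\<beta>\<in>{\<beta>\<in>E. traverses (kseg k c a b) \<beta>}. {z\<in>\<beta>. coord k z = c}) = kseg k c a b" (is "?U = ?g")
proof
  show "?U \<subseteq> ?g"
  proof
    fix z assume "z \<in> ?U"
    then obtain \<beta> where \<beta>: "\<beta> \<in> E" "traverses ?g \<beta>" "z \<in> \<beta>" "coord k z = c" by blast
    obtain l u where lu: "\<beta> = Box l u" "\<forall>j. l j < u j" using box_partition_Box[OF bp \<beta>(1)] by metis
    then show "z \<in> ?g" using \<beta> traverses_Box_iff[OF lu(2), of k c a b]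
      by (auto simp: mem_kseg mem_Box intro: order_trans)
  qed
  have inner: "kpoint k c t \<in> ?U" if t: "a < t" "t < b" for t
  proof -
    obtain lo hi where \<Omega>: "\<Omega> = Box lo hi" "\<forall>j. lo j < hi j"
      using bp by (auto simp: box_partition_def rectangle_iff)
    have "kpoint k c a \<in> Box lo hi" "kpoint k c b \<in> Box lo hi"
      using edges_subset[OF bp] ends \<Omega> by auto
    then have "kpoint k c t \<in> \<Omega>" using t \<Omega> by (simp add: mem_Box all_axis[of _ k])
    then obtain \<beta> where \<beta>: "\<beta> \<in> E" "kpoint k c t \<in> \<beta>" using bp by (auto simp: box_partition_def)
    obtain l u where lu: "\<beta> = Box l u" "\<forall>j. l j < u j" using box_partition_Box[OF bp \<beta>(1)] by metis
    have c: "l k \<le> c" "c \<le> u k" "l (other k) \<le> t" "t \<le> u (other k)"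
      using \<beta>(2) lu by (auto simp: mem_Box all_axis[of _ k])
    have "kpoint k c t \<notin> edges k E" using free t by simp
    then have "c \<notin> {l k, u k}" using edgesI[of l u E "kpoint k c t" k] \<beta> lu by auto
    then have c': "l k < c" "c < u k" using c by auto
    have nl: False if "l (other k) < s" "s < u (other k)" "kpoint k c s \<in> edges (other k) E" for s
      using interior_not_edge[OF bp, of l u "kpoint k c s" "other k"] that c' \<beta> lu
      by (simp add: mem_interior_Box all_axis[of _ k])
    have lou: "l (other k) < u (other k)" using lu by simp
    have "a \<le> l (other k)" "u (other k) \<le> b"
      using nl[OF _ _ ends(1)] nl[OF _ _ ends(2)] c t by force+
    then have "traverses ?g \<beta>" using traverses_Box_iff[OF lu(2), of k c a b] c' lu by simp
    then show ?thesis using \<beta> by auto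
  qed
  \<comment> \<open>The end points may lie on \<open>k\<close>-edges, where the argument for inner
    points fails; they are reached as limits of inner points.\<close>
  have "closed ?U"
  proof (rule closed_UN)
    show "finite {\<beta> \<in> E. traverses ?g \<beta>}" using bp by (auto simp: box_partition_def)
    show "\<forall>\<beta>\<in>{\<beta> \<in> E. traverses ?g \<beta>}. closed {z \<in> \<beta>. coord k z = c}"
    proof
      fix \<beta> assume "\<beta> \<in> {\<beta> \<in> E. traverses ?g \<beta>}"
      then obtain l u where "\<beta> = Box l u" using box_partition_Box[OF bp] by blast
      then have "closed \<beta>" by (simp add: closed_Box)
      moreover have "closed {z. coord k z = c}"
        by (intro closed_Collect_eq continuous_on_coord continuous_on_const)
      moreover have "{z \<in> \<beta>. coord k z = c} = \<beta> \<inter> {z. coord k z = c}" by auto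
      ultimately show "closed {z \<in> \<beta>. coord k z = c}" by auto
    qed
  qed
  then have "closed (kpoint k c -` ?U)"
    by (intro closed_vimage continuous_on_kpoint)
  moreover have "{a<..<b} \<subseteq> kpoint k c -` ?U" using inner by auto
  ultimately have "closure {a<..<b} \<subseteq> kpoint k c -` ?U" by (intro closure_minimal)
  then have "{a..b} \<subseteq> kpoint k c -` ?U" using ab by simp
  then show "?g \<subseteq> ?U" unfolding kseg_def by blast
qed

lemma Box_halves:
  assumes "l k < c" "c < u k"
  shows "{z \<in> Box l u. coord k z \<le> c} = Box l (u(k := c))" "{z \<in> Box l u. c \<le> coord k z} = Box (l(k := c)) u"
  using assms by (auto simp: mem_Box all_axis[of _ k])

lemma insert_split_elems_cases:
  assumes "\<beta> \<in> elems (insert_split M k c a b m)" and bp: "box_partition \<Omega> (elems M)"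
  obtains (old) "\<beta> \<in> elems M" "\<not> traverses (kseg k c a b) \<beta>"
  | (lower) l u where "Box l u \<in> elems M" "\<forall>j. l j < u j" "traverses (kseg k c a b) (Box l u)"
      "l k < c" "c < u k" "\<beta> = Box l (u(k := c))"
  | (upper) l u where "Box l u \<in> elems M" "\<forall>j. l j < u j" "traverses (kseg k c a b) (Box l u)"
      "l k < c" "c < u k" "\<beta> = Box (l(k := c)) u"
proof -
  consider "\<beta> \<in> elems M" "\<not> traverses (kseg k c a b) \<beta>"
    | \<beta>' where "\<beta>' \<in> elems M" "traverses (kseg k c a b) \<beta>'"
        "\<beta> \<in> {{z \<in> \<beta>'. coord k z \<le> c}, {z \<in> \<beta>'. c \<le> coord k z}}"
    using assms(1) by (auto simp: insert_split_def)
  then show thesis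
  proof cases
    case 2
    obtain l u where lu: "\<beta>' = Box l u" "\<forall>j. l j < u j" using box_partition_Box[OF bp 2(1)] by metis
    then have c: "l k < c" "c < u k" using 2(2) traverses_Box_iff[OF lu(2), of k c a b] by auto
    then show thesis using 2 lu lower[of l u] upper[of l u] Box_halves[of l k c u] by auto
  qed (use old in auto)
qed

lemma insert_split_elemsI:
  assumes "\<beta> \<in> elems M"
  shows "\<not> traverses (kseg k c a b) \<beta> \<Longrightarrow> \<beta> \<in> elems (insert_split M k c a b m)"
    and "traverses (kseg k c a b) \<beta> \<Longrightarrow> {z \<in> \<beta>. coord k z \<le> c} \<in> elems (insert_split M k c a b m)"
    and "traverses (kseg k c a b) \<beta> \<Longrightarrow> {z \<in> \<beta>. c \<le> coord k z} \<in> elems (insert_split M k c a b m)"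
  using assms by (auto simp: insert_split_def)

lemma Box_subset_parts:
  assumes "l k < c" "c < u k"
  shows "Box l (u(k := c)) \<subseteq> Box l u" "Box (l(k := c)) u \<subseteq> Box l u"
  using assms by (auto simp: mem_Box all_axis[of _ k])

lemma box_partition_insert_split:
  assumes bp: "box_partition \<Omega> (elems M)"
  shows "box_partition \<Omega> (elems (insert_split M k c a b m))" (is "box_partition \<Omega> ?E")
proof -
  let ?g = "kseg k c a b"
  \<comment> \<open>Each new element remembers the old element it comes from. Different parents pass
    on disjointness; equal parents leave only the two opposite halves.\<close>
  have parent: "\<exists>\<pi>\<in>elems M. \<beta> \<subseteq> \<pi> \<and> (\<beta> = \<pi> \<and> \<not> traverses ?g \<pi> \<or>
     traverses ?g \<pi> \<and> (\<exists>l u. (\<forall>j. l j < u j) \<and> l k < c \<and> c < u k \<and> \<pi> = Box l u \<and> (\<beta> = Box l (u(k := c)) \<or> \<beta> = Box (l(k := c)) u)))"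
    if "\<beta> \<in> ?E" for \<beta>
    using that bp
  proof (cases rule: insert_split_elems_cases)
    case old
    then show ?thesis by blast
  next
    case (lower l u)
    then show ?thesis using Box_subset_parts[of l k c u] by (intro bexI[of _ "Box l u"]) auto
  next
    case (upper l u)
    then show ?thesis using Box_subset_parts[of l k c u] by (intro bexI[of _ "Box l u"]) auto
  qed
  have "finite ?E" using bp by (auto simp: box_partition_def insert_split_def)
  moreover have "rectangle \<beta>" if "\<beta> \<in> ?E" for \<beta>
    using that bp
  proof (cases rule: insert_split_elems_cases)
    case old
    then show ?thesis using bp by (simp add: box_partition_def)
  next
    case (lower l u)
    then show ?thesis unfolding rectangle_iff by (intro exI[of _ l] exI[of _ "u(k := c)"]) auto
  next
    case (upper l u)
    then show ?thesis unfolding rectangle_iff by (intro exI[of _ "l(k := c)"] exI[of _ u]) auto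
  qed
  moreover have "interior \<beta> \<inter> interior \<beta>' = {}" if \<beta>: "\<beta> \<in> ?E" "\<beta>' \<in> ?E" "\<beta> \<noteq> \<beta>'" for \<beta> \<beta>'
  proof -
    obtain \<pi> where \<pi>: "\<pi>\<in>elems M" "\<beta> \<subseteq> \<pi>" "\<beta> = \<pi> \<and> \<not> traverses ?g \<pi> \<or>
     traverses ?g \<pi> \<and> (\<exists>l u. (\<forall>j. l j < u j) \<and> l k < c \<and> c < u k \<and> \<pi> = Box l u \<and> (\<beta> = Box l (u(k := c)) \<or> \<beta> = Box (l(k := c)) u))"
      using parent[OF \<beta>(1)] by blast
    obtain \<pi>' where \<pi>': "\<pi>'\<in>elems M" "\<beta>' \<subseteq> \<pi>'" "\<beta>' = \<pi>' \<and> \<not> traverses ?g \<pi>' \<or>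
     traverses ?g \<pi>' \<and> (\<exists>l u. (\<forall>j. l j < u j) \<and> l k < c \<and> c < u k \<and> \<pi>' = Box l u \<and> (\<beta>' = Box l (u(k := c)) \<or> \<beta>' = Box (l(k := c)) u))"
      using parent[OF \<beta>(2)] by blast
    show ?thesis
    proof (cases "\<pi> = \<pi>'")
      case False
      then have "interior \<pi> \<inter> interior \<pi>' = {}" using bp \<pi>(1) \<pi>'(1) by (auto simp: box_partition_def)
      then show ?thesis using interior_mono[OF \<pi>(2)] interior_mono[OF \<pi>'(2)] by blast
    next
      case True
      then obtain l u l' u' where lu: "\<forall>j. l j < u j" "\<pi> = Box l u" "\<beta> = Box l (u(k := c)) \<or> \<beta> = Box (l(k := c)) u"
        and lu': "\<forall>j. l' j < u' j" "\<pi> = Box l' u'" "\<beta>' = Box l' (u'(k := c)) \<or> \<beta>' = Box (l'(k := c)) u'"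
        using \<pi>(3) \<pi>'(3) \<beta>(3) by blast
      then have "l' = l" "u' = u" using Box_inject[of l u l' u'] by auto
      then consider "\<beta> = Box l (u(k := c))" "\<beta>' = Box (l(k := c)) u" | "\<beta>' = Box l (u(k := c))" "\<beta> = Box (l(k := c)) u"
        using lu lu' \<beta>(3) by blast
      then show ?thesis by cases (auto simp: mem_interior_Box all_axis[of _ k])
    qed
  qed
  moreover have "\<Union>?E = \<Union>(elems M)"
  proof
    show "\<Union>?E \<subseteq> \<Union>(elems M)" using parent by blast
    show "\<Union>(elems M) \<subseteq> \<Union>?E"
    proof
      fix z assume "z \<in> \<Union>(elems M)"
      then obtain \<beta> where \<beta>: "\<beta> \<in> elems M" "z \<in> \<beta>" by blast
      have "z \<in> {z \<in> \<beta>. coord k z \<le> c} \<or> z \<in> {z \<in> \<beta>. c \<le> coord k z}" using \<beta> by auto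
      then show "z \<in> \<Union>?E" using insert_split_elemsI[OF \<beta>(1), of k c a b m] \<beta>(2) by blast
    qed
  qed
  ultimately show ?thesis using bp by (simp add: box_partition_def)
qed

lemma edges_insert_split:
  assumes bp: "box_partition \<Omega> (elems M)" and ab: "a < b"
    and ends: "kpoint k c a \<in> edges (other k) (elems M)" "kpoint k c b \<in> edges (other k) (elems M)"
    and free: "\<forall>t. a < t \<and> t < b \<longrightarrow> kpoint k c t \<notin> edges k (elems M)"
  shows "edges j (elems (insert_split M k c a b m)) = edges j (elems M) \<union> (if j = k then kseg k c a b else {})"
    (is "edges j ?E = ?R")
proof
  let ?g = "kseg k c a b"
  note chords = insertion_chords[OF bp ab ends free]
  show "edges j ?E \<subseteq> ?R"
  proof
    fix z assume "z \<in> edges j ?E"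
    then obtain l' u' where lu': "Box l' u' \<in> ?E" "\<forall>j. l' j < u' j" "z \<in> Box l' u'" "coord j z \<in> {l' j, u' j}"
      by (rule edgesE)
    have main: "z \<in> ?R" if lu: "Box l u \<in> elems M" "\<forall>j. l j < u j" "traverses ?g (Box l u)" "z \<in> Box l u"
      "coord j z \<in> {l j, u j} \<or> j = k \<and> coord j z = c" for l u
      using lu(5)
    proof
      assume "j = k \<and> coord j z = c"
      then show ?thesis using chords lu by fastforce
    next
      assume "coord j z \<in> {l j, u j}"
      then show ?thesis using edgesI[OF lu(1,2,4)] by simp
    qed
    from lu'(1) bp show "z \<in> ?R"
    proof (cases rule: insert_split_elems_cases)
      case old
      then show ?thesis using edgesI[OF _ lu'(2-4)] by simp
    next
      case (lower l u)
      then have eq: "l' = l" "u' = u(k := c)" using Box_inject[of l' u' l "u(k := c)"] lu'(2) by auto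
      show ?thesis using main[OF lower(1-3)] lu'(3,4) Box_subset_parts(1)[of l k c u, OF lower(4,5)] unfolding eq
        by (cases "j = k") auto
    next
      case (upper l u)
      then have eq: "l' = l(k := c)" "u' = u" using Box_inject[of l' u' "l(k := c)" u] lu'(2) by auto
      show ?thesis using main[OF upper(1-3)] lu'(3,4) Box_subset_parts(2)[of l k c u, OF upper(4,5)] unfolding eq
        by (cases "j = k") auto
    qed
  qed
  show "?R \<subseteq> edges j ?E"
  proof
    fix z assume z: "z \<in> ?R"
    have half: "z \<in> edges j ?E" if lu: "Box l u \<in> elems M" "\<forall>j. l j < u j" "traverses ?g (Box l u)" "z \<in> Box l u"
      "coord j z \<in> {l j, u j} \<or> j = k \<and> coord j z = c" for l u
    proof -
      have c: "l k < c" "c < u k" using traverses_Box_iff[OF lu(2), of k c a b] lu(3) by auto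
      have E: "Box l (u(k := c)) \<in> ?E" "Box (l(k := c)) u \<in> ?E"
        using insert_split_elemsI(2,3)[OF lu(1,3), of m] Box_halves[of l k c u, OF c] by auto
      have nd: "\<forall>j. l j < (u(k := c)) j" "\<forall>j. (l(k := c)) j < u j" using lu(2) c by auto
      show ?thesis
      \<comment> \<open>The lower half keeps the side through \<open>z\<close> unless
        \<open>z\<close> is above \<open>c\<close> or is required on the upper
        \<open>k\<close>-side, which only the upper half inherits.\<close>
      proof (cases "coord k z \<le> c \<and> (j = k \<longrightarrow> coord j z \<noteq> u k)")
        case True
        then have zin: "z \<in> Box l (u(k := c))" using lu(4) by (auto simp: mem_Box)
        show ?thesis using lu(5) True by (intro edgesI[OF E(1) nd(1) zin]) auto
      next
        case False
        then have zin: "z \<in> Box (l(k := c)) u" using lu(4) c by (auto simp: mem_Box)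
        show ?thesis using lu(5) False c by (intro edgesI[OF E(2) nd(2) zin]) auto
      qed
    qed
    from z consider "z \<in> edges j (elems M)" | "j = k" "z \<in> ?g" by (auto split: if_splits)
    then show "z \<in> edges j ?E"
    proof cases
      case 1
      then obtain l u where lu: "Box l u \<in> elems M" "\<forall>j. l j < u j" "z \<in> Box l u" "coord j z \<in> {l j, u j}"
        by (rule edgesE)
      show ?thesis
      proof (cases "traverses ?g (Box l u)")
        case True
        then show ?thesis using half lu by blast
      next
        case False
        then show ?thesis using insert_split_elemsI(1)[OF lu(1) False] lu by (intro edgesI[OF _ lu(2-4)]) auto
      qed
    next
      case 2
      then obtain \<beta> where \<beta>: "\<beta> \<in> elems M" "traverses ?g \<beta>" "z \<in> \<beta>" "coord k z = c" using chords by blast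
      obtain l u where lu: "\<beta> = Box l u" "\<forall>j. l j < u j" using box_partition_Box[OF bp \<beta>(1)] by metis
      then show ?thesis using half[of l u] \<beta> 2 by auto
    qed
  qed
qed

lemma is_split_chords:
  assumes bp: "box_partition \<Omega> E" and ab: "a < b"
    and ends: "kpoint k c a \<in> edges (other k) E" "kpoint k c b \<in> edges (other k) E"
    and free: "\<forall>t. a < t \<and> t < b \<longrightarrow> kpoint k c t \<notin> edges k E"
  shows "is_split k E (kseg k c a b)"
proof -
  let ?g = "kseg k c a b"
  define \<Gamma> where "\<Gamma> = (\<lambda>\<beta>. {z\<in>\<beta>. coord k z = c}) ` {\<beta>\<in>E. traverses ?g \<beta>}"
  have "finite \<Gamma>" using bp by (auto simp: \<Gamma>_def box_partition_def)
  moreover have "?g = \<Union>\<Gamma>" unfolding \<Gamma>_def using insertion_chords[OF bp ab ends free] by simp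
  moreover have "is_kseg k \<sigma> \<and> (\<exists>\<beta>\<in>E. \<sigma> \<subseteq> \<beta> \<and> traverses \<sigma> \<beta>)" if "\<sigma> \<in> \<Gamma>" for \<sigma>
  proof -
    obtain \<beta> where \<beta>: "\<beta> \<in> E" "traverses ?g \<beta>" "\<sigma> = {z\<in>\<beta>. coord k z = c}"
      using \<open>\<sigma> \<in> \<Gamma>\<close> by (auto simp: \<Gamma>_def)
    obtain l u where lu: "\<beta> = Box l u" "\<forall>j. l j < u j" using box_partition_Box[OF bp \<beta>(1)] by metis
    then have c: "l k < c" "c < u k" using \<beta>(2) traverses_Box_iff[OF lu(2), of k c a b] by auto
    have \<sigma>: "\<sigma> = kseg k c (l (other k)) (u (other k))"
      using \<beta>(3) lu c by (auto simp: mem_kseg mem_Box all_axis[of _ k])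
    have "is_kseg k \<sigma>" unfolding is_kseg_def \<sigma> using lu by blast
    moreover have "traverses \<sigma> \<beta>" unfolding \<sigma> lu(1) traverses_Box_iff[OF lu(2)] using c by simp
    ultimately show ?thesis using \<beta> by auto
  qed
  moreover have "is_kseg k ?g" unfolding is_kseg_def using ab by blast
  ultimately show ?thesis unfolding is_split_def by blast
qed

text \<open>The open segment meets no old \<open>k\<close>-edge, so multiplicities are never added.
  A new meshline either lies in the segment and receives \<open>w k c\<close>, or lies in exactly
  one old meshline and inherits its weight.\<close>

lemma weighted_insert_split:
  assumes bp: "box_partition \<Omega> (elems M)" and w: "weighted w M" and ab: "a < b"
    and ends: "kpoint k c a \<in> edges (other k) (elems M)" "kpoint k c b \<in> edges (other k) (elems M)"
    and free: "\<forall>t. a < t \<and> t < b \<longrightarrow> kpoint k c t \<notin> edges k (elems M)"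
  shows "weighted w (insert_split M k c a b (w k c))"
  unfolding weighted_def
proof (intro allI impI)
  fix k' c' a' b'
  let ?M = "insert_split M k c a b (w k c)" and ?g = "kseg k c a b" and ?s = "kseg k' c' a' b'"
  assume s: "?s \<in> kmeshlines k' (elems ?M)" and ab': "a' < b'"
  note bp' = box_partition_insert_split[OF bp, of k c a b "w k c"]
  note ed = edges_insert_split[where m = "w k c", OF bp ab ends free]
  have vm: "vertices (elems M) \<subseteq> vertices (elems ?M)"
    unfolding vertices_eq_edges[OF bp, of k] vertices_eq_edges[OF bp', of k] ed by auto
  have ve: "kpoint k c a \<in> vertices (elems ?M)" "kpoint k c b \<in> vertices (elems ?M)"
    unfolding vertices_eq_edges[OF bp', of k] ed using ends ab by auto
  have mu: "mu ?M ?s = (if \<exists>\<tau>\<in>meshlines (elems M). ?s \<subseteq> \<tau>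
      then mu M (THE \<tau>. \<tau> \<in> meshlines (elems M) \<and> ?s \<subseteq> \<tau>) else 0) + (if ?s \<subseteq> ?g then w k c else 0)"
    by (simp add: insert_split_def)
  obtain t where t: "a' < t" "t < b'" using dense ab' by blast
  show "mu ?M ?s = w k' c'"
  proof (cases "?s \<subseteq> ?g")
    case True
    then have "k' = k" using kseg_subset_axis ab' by blast
    then have eq: "c' = c" "a \<le> a'" "b' \<le> b" using True ab' kseg_subset_iff[of a' b' k c' c a b] by auto
    \<comment> \<open>No old meshline contains a piece of the new segment, so the first summand of
      the multiplicity takes its default value 0.\<close>
    have "\<not> ?s \<subseteq> \<tau>" if \<tau>: "\<tau> \<in> meshlines (elems M)" for \<tau>
    proof
      assume sub: "?s \<subseteq> \<tau>"
      obtain k'' c'' x y where *: "x < y" "\<tau> = kseg k'' c'' x y" "\<tau> \<in> kmeshlines k'' (elems M)"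
        using \<tau> by (rule meshlineE)
      then have "k'' = k" using sub kseg_subset_axis[of k' c' a' b' k'' c'' x y] ab' \<open>k' = k\<close> by simp
      then have "\<tau> \<subseteq> edges k (elems M)" using kmeshline_edges[OF bp] * by blast
      moreover have "kpoint k c t \<in> ?s" using t eq \<open>k' = k\<close> by simp
      ultimately show False using sub free t eq by auto
    qed
    then show ?thesis unfolding mu using True eq \<open>k' = k\<close> by auto
  next
    case False
    have "kpoint k' c' t \<in> edges k' (elems ?M)" using kmeshline_edges[OF bp' s] t by auto
    moreover have "\<not> (k' = k \<and> kpoint k' c' t \<in> ?g)"
    proof
      assume g: "k' = k \<and> kpoint k' c' t \<in> ?g"
      then have g': "k' = k" "c' = c" "a \<le> t" "t \<le> b" by auto
      then have "a' < a \<or> b < b'" using False kseg_subset_iff[of a' b' k c' c a b] ab' by auto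
      \<comment> \<open>The ends of the inserted segment are vertices of the new mesh, so a meshline
        cannot run from the segment across one of them.\<close>
      then show False
        using kmeshline_vertex_iff[OF s ab', of a] kmeshline_vertex_iff[OF s ab', of b] ve g' t by auto
    qed
    ultimately have e: "kpoint k' c' t \<in> edges k' (elems M)" unfolding ed by (auto split: if_splits)
    have nv: "kpoint k' c' y \<notin> vertices (elems M)" if "a' < y" "y < b'" for y
      using kmeshline_vertex_iff[OF s ab', of y] that vm by auto
    obtain x y where xy: "x \<le> a'" "b' \<le> y" "kseg k' c' x y \<in> kmeshlines k' (elems M)"
      by (rule meshline_containing[OF bp _ t e]) (use nv in blast)
    then have \<tau>: "kseg k' c' x y \<in> meshlines (elems M)" "?s \<subseteq> kseg k' c' x y"
      using ab' by (auto simp: meshlines_def kseg_subset_iff)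
    have "(THE \<tau>. \<tau> \<in> meshlines (elems M) \<and> ?s \<subseteq> \<tau>) = kseg k' c' x y"
      using \<tau> by (intro the_equality conjI meshline_unique[OF ab', of _ _ k' c']) simp_all
    then have "mu ?M ?s = mu M (kseg k' c' x y)" unfolding mu using False \<tau> by auto
    then show ?thesis using w xy ab' by (simp add: weighted_def)
  qed
qed

text \<open>The condition on the same line concerns the open segment only: an older piece may touch
  it at an end, which is the situation when a line is extended.\<close>

lemma drawn_insert_split:
  assumes dr: "drawn \<Omega> w S M" and ab: "a < b"
    and ends: "\<exists>a' b'. (a, a', b') \<in> S (other k) \<and> a' \<le> c \<and> c \<le> b'"
      "\<exists>a' b'. (b, a', b') \<in> S (other k) \<and> a' \<le> c \<and> c \<le> b'"
    and free: "\<And>a' b'. (c, a', b') \<in> S k \<Longrightarrow> b' \<le> a \<or> b \<le> a'"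
  shows "is_split k (elems M) (kseg k c a b)"
    and "drawn \<Omega> w (S(k := insert (c, a, b) (S k))) (insert_split M k c a b (w k c))"
proof -
  have bp: "box_partition \<Omega> (elems M)" and w: "weighted w M" using dr by (auto simp: drawn_def)
  have ends': "kpoint k c a \<in> edges (other k) (elems M)" "kpoint k c b \<in> edges (other k) (elems M)"
    using ends by (simp_all add: drawn_edges_iff[OF dr])
  have free': "\<forall>t. a < t \<and> t < b \<longrightarrow> kpoint k c t \<notin> edges k (elems M)"
    using free by (fastforce simp: drawn_edges_iff[OF dr])
  show "is_split k (elems M) (kseg k c a b)" using is_split_chords[OF bp ab ends' free'] .
  have "edges j (elems (insert_split M k c a b (w k c))) = (\<Union>(c', a', b')\<in>(S(k := insert (c, a, b) (S k))) j. kseg j c' a' b')" for j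
    unfolding edges_insert_split[OF bp ab ends' free'] using dr by (cases "j = k") (auto simp: drawn_def)
  then show "drawn \<Omega> w (S(k := insert (c, a, b) (S k))) (insert_split M k c a b (w k c))"
    using box_partition_insert_split[OF bp] weighted_insert_split[OF bp w ab ends' free'] dr ab
    by (simp add: drawn_def)
qed

section \<open>Tensor product meshes\<close>

definition adjacent :: "real set \<Rightarrow> real \<Rightarrow> real \<Rightarrow> bool" where
  "adjacent A x y \<longleftrightarrow> x \<in> A \<and> y \<in> A \<and> x < y \<and> (\<forall>v\<in>A. \<not> (x < v \<and> v < y))"

lemma adjacent_set_iff:
  assumes "sorted L"
  shows "adjacent (set L) x y \<longleftrightarrow> (\<exists>i. Suc i < length L \<and> L ! i < L ! Suc i \<and> x = L ! i \<and> y = L ! Suc i)"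
proof
  assume "\<exists>i. Suc i < length L \<and> L ! i < L ! Suc i \<and> x = L ! i \<and> y = L ! Suc i"
  then obtain i where i: "Suc i < length L" "L ! i < L ! Suc i" "x = L ! i" "y = L ! Suc i" by blast
  have "v \<le> x \<or> y \<le> v" if v: "v \<in> set L" for v
  proof -
    obtain j where j: "j < length L" "v = L ! j" using v by (auto simp: in_set_conv_nth)
    show ?thesis using sorted_nth_mono[OF assms, of j i] sorted_nth_mono[OF assms, of "Suc i" j] i j
      by (cases "j \<le> i") auto
  qed
  then show "adjacent (set L) x y" using i by (force simp: adjacent_def)
next
  assume ad: "adjacent (set L) x y"
  obtain i0 where i0: "i0 < length L" "L ! i0 = x" using ad by (auto simp: adjacent_def in_set_conv_nth)
  obtain j where j: "j < length L" "L ! j = y" using ad by (auto simp: adjacent_def in_set_conv_nth)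
  \<comment> \<open>The last index with value at most \<open>x\<close>: with repeated knots, only
    the last copy is followed by a strict increase.\<close>
  define i where "i = Max {i. i < length L \<and> L ! i \<le> x}"
  have fin: "finite {i. i < length L \<and> L ! i \<le> x}" by simp
  have "i \<in> {i. i < length L \<and> L ! i \<le> x}"
    unfolding i_def using i0 by (intro Max_in[OF fin]) auto
  then have i: "i < length L" "L ! i \<le> x" by auto
  have imax: "i' \<le> i" if "i' < length L" "L ! i' \<le> x" for i' using Max_ge[OF fin] that by (simp add: i_def)
  have xy: "x < y" using ad by (simp add: adjacent_def)
  have ij: "i < j"
  proof (rule ccontr)
    assume "\<not> i < j"
    then show False using sorted_nth_mono[OF assms, of j i] i j xy by simp
  qed
  have x: "L ! i = x" using imax[of i0] i0 i sorted_nth_mono[OF assms, of i0 i] by simp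
  have "x < L ! Suc i" using imax[of "Suc i"] ij j by force
  moreover have "L ! Suc i \<le> y" using sorted_nth_mono[OF assms, of "Suc i" j] ij j by simp
  moreover have "L ! Suc i \<in> set L" using ij j by simp
  ultimately have "L ! Suc i = y" using ad by (force simp: adjacent_def)
  then show "\<exists>i. Suc i < length L \<and> L ! i < L ! Suc i \<and> x = L ! i \<and> y = L ! Suc i"
    using x xy ij j by (intro exI[of _ i]) auto
qed

lemma adjacent_around:
  assumes "finite A" "a \<in> A" "b \<in> A" "a < b" "a \<le> t" "t \<le> b"
  obtains v v' where "adjacent A v v'" "v \<le> t" "t \<le> v'" "a \<le> v" "v' \<le> b"
  using consecutive_around[OF assms] unfolding adjacent_def by metis

lemma sorted_hd_last:
  assumes "sorted L" "x \<in> set L"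
  shows "hd L \<le> x" "x \<le> last L"
proof -
  obtain i where i: "i < length L" "x = L ! i" using assms(2) by (auto simp: in_set_conv_nth)
  then have "L \<noteq> []" by auto
  then show "hd L \<le> x" "x \<le> last L"
    using sorted_nth_mono[OF assms(1), of 0 i] sorted_nth_mono[OF assms(1), of i "length L - 1"] i
    by (auto simp: hd_conv_nth last_conv_nth)
qed

text \<open>A mesh stores multiplicities of point sets. A nondegenerate segment determines its
  direction and coordinate, so the choice has only one possible value.\<close>

definition line_mu :: "(axis \<Rightarrow> real \<Rightarrow> nat) \<Rightarrow> point set \<Rightarrow> nat" where
  "line_mu w \<sigma> = (SOME m. \<forall>k c a b. a < b \<and> \<sigma> = kseg k c a b \<longrightarrow> m = w k c)"

lemma line_mu_kseg [simp]:
  assumes "a < b" shows "line_mu w (kseg k c a b) = w k c"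
proof -
  have eq: "w k c = w k' c'" if "a' < b'" "kseg k c a b = kseg k' c' a' b'" for k' c' a' b'
  proof -
    have "k = k'" using kseg_subset_axis[of k c a b k' c' a' b'] that assms by simp
    then show ?thesis using kseg_inject[of a b a' b' k c c'] that assms by simp
  qed
  then have "\<forall>k' c' a' b'. a' < b' \<and> kseg k c a b = kseg k' c' a' b' \<longrightarrow> w k c = w k' c'" by blast
  then have "\<forall>k' c' a' b'. a' < b' \<and> kseg k c a b = kseg k' c' a' b' \<longrightarrow> line_mu w (kseg k c a b) = w k' c'"
    unfolding line_mu_def by (rule someI)
  then show ?thesis using assms by blast
qed

definition tensor_of :: "(axis \<Rightarrow> real list) \<Rightarrow> (axis \<Rightarrow> real \<Rightarrow> nat) \<Rightarrow> mesh" where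
  "tensor_of Z w = \<lparr> elems = {Box l u | l u. \<forall>k. adjacent (set (Z k)) (l k) (u k)}, mu = line_mu w \<rparr>"

lemma drawn_tensor_of:
  assumes Z: "\<And>k. sorted (Z k)" "\<And>k. Z k \<noteq> []" "\<And>k. hd (Z k) < last (Z k)"
  shows "drawn (Box (\<lambda>k. hd (Z k)) (\<lambda>k. last (Z k))) w
    (\<lambda>k. (\<lambda>c. (c, hd (Z (other k)), last (Z (other k)))) ` set (Z k)) (tensor_of Z w)"
    (is "drawn ?\<Omega> w ?S ?M")
proof -
  let ?E = "elems ?M"
  have E: "\<beta> \<in> ?E \<longleftrightarrow> (\<exists>l u. \<beta> = Box l u \<and> (\<forall>k. adjacent (set (Z k)) (l k) (u k)))" for \<beta>
    by (auto simp: tensor_of_def)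
  have ad: "x < y \<and> hd (Z k) \<le> x \<and> y \<le> last (Z k)" if "adjacent (set (Z k)) x y" for k x y
    using that sorted_hd_last[OF Z(1)[of k]] by (auto simp: adjacent_def)
  have "?E \<subseteq> (\<lambda>((a, b), (c, d)). Box (case_axis a c) (case_axis b d)) `
      ((set (Z Ax1) \<times> set (Z Ax1)) \<times> (set (Z Ax2) \<times> set (Z Ax2)))"
  proof
    fix \<beta> assume "\<beta> \<in> ?E"
    then obtain l u where lu: "\<beta> = Box l u" "\<forall>k. adjacent (set (Z k)) (l k) (u k)" by (auto simp: E)
    have "Box (case_axis (l Ax1) (l Ax2)) (case_axis (u Ax1) (u Ax2)) = Box l u"
      by (auto simp: mem_Box all_axis[of _ Ax1])
    then show "\<beta> \<in> (\<lambda>((a, b), (c, d)). Box (case_axis a c) (case_axis b d)) `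
      ((set (Z Ax1) \<times> set (Z Ax1)) \<times> (set (Z Ax2) \<times> set (Z Ax2)))"
      using lu by (intro image_eqI[of _ _ "((l Ax1, u Ax1), (l Ax2, u Ax2))"]) (auto simp: adjacent_def)
  qed
  then have fin: "finite ?E" by (rule finite_subset) auto
  have rect: "rectangle \<beta>" if \<beta>: "\<beta> \<in> ?E" for \<beta>
  proof -
    obtain l u where "\<beta> = Box l u" "\<forall>k. adjacent (set (Z k)) (l k) (u k)" using \<beta> by (auto simp: E)
    then show ?thesis unfolding rectangle_iff using ad by (intro exI[of _ l] exI[of _ u]) auto
  qed
  have disj: "interior \<beta> \<inter> interior \<beta>' = {}" if \<beta>: "\<beta> \<in> ?E" "\<beta>' \<in> ?E" "\<beta> \<noteq> \<beta>'" for \<beta> \<beta>'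
  proof (rule ccontr)
    assume "interior \<beta> \<inter> interior \<beta>' \<noteq> {}"
    then obtain z where z: "z \<in> interior \<beta>" "z \<in> interior \<beta>'" by blast
    obtain l u l' u' where lu: "\<beta> = Box l u" "\<forall>k. adjacent (set (Z k)) (l k) (u k)"
      and lu': "\<beta>' = Box l' u'" "\<forall>k. adjacent (set (Z k)) (l' k) (u' k)"
      using \<beta> by (auto simp: E)
    have "l k = l' k \<and> u k = u' k" for k
    proof -
      have "adjacent (set (Z k)) (l k) (u k)" "adjacent (set (Z k)) (l' k) (u' k)" using lu lu' by auto
      then have "\<not> (l k < l' k \<and> l' k < u k)" "\<not> (l k < u' k \<and> u' k < u k)"
        "\<not> (l' k < l k \<and> l k < u' k)" "\<not> (l' k < u k \<and> u k < u' k)"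
        by (simp_all add: adjacent_def)
      moreover have "l k < coord k z" "coord k z < u k" "l' k < coord k z" "coord k z < u' k"
        using z lu lu' by (auto simp: mem_interior_Box)
      ultimately show ?thesis by linarith
    qed
    then have "l = l'" "u = u'" by auto
    then show False using lu lu' \<beta>(3) by simp
  qed
  have memZ: "hd (Z k) \<in> set (Z k)" "last (Z k) \<in> set (Z k)" for k using Z(2) by auto
  have around: "\<exists>v v'. adjacent (set (Z k)) v v' \<and> v \<le> t \<and> t \<le> v'" if "hd (Z k) \<le> t" "t \<le> last (Z k)" for k t
    using adjacent_around[of "set (Z k)" "hd (Z k)" "last (Z k)" t] memZ Z(3) that by (metis List.finite_set)
  have cover: "\<exists>l u. z \<in> Box l u \<and> (\<forall>k. adjacent (set (Z k)) (l k) (u k))" if "z \<in> ?\<Omega>" for z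
  proof -
    have "\<forall>k. \<exists>v v'. adjacent (set (Z k)) v v' \<and> v \<le> coord k z \<and> coord k z \<le> v'"
      using around that by (auto simp: mem_Box)
    then obtain l u where "\<forall>k. adjacent (set (Z k)) (l k) (u k) \<and> l k \<le> coord k z \<and> coord k z \<le> u k"
      by metis
    then show ?thesis by (auto simp: mem_Box)
  qed
  have sub: "Box l u \<subseteq> ?\<Omega>" if "\<forall>k. adjacent (set (Z k)) (l k) (u k)" for l u
  proof
    fix z assume "z \<in> Box l u"
    then have "l k \<le> coord k z \<and> coord k z \<le> u k" for k by (simp add: mem_Box)
    moreover have "hd (Z k) \<le> l k \<and> u k \<le> last (Z k)" for k using ad that by blast
    ultimately have "hd (Z k) \<le> coord k z \<and> coord k z \<le> last (Z k)" for k by (meson order_trans)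
    then show "z \<in> ?\<Omega>" by (simp add: mem_Box)
  qed
  have "\<Union>?E = ?\<Omega>"
  proof
    show "\<Union>?E \<subseteq> ?\<Omega>"
    proof (rule Union_least)
      fix \<beta> assume "\<beta> \<in> ?E"
      then show "\<beta> \<subseteq> ?\<Omega>" unfolding E using sub by fastforce
    qed
    show "?\<Omega> \<subseteq> \<Union>?E"
    proof
      fix z assume "z \<in> ?\<Omega>"
      then obtain l u where "z \<in> Box l u" "\<forall>k. adjacent (set (Z k)) (l k) (u k)" using cover by blast
      then show "z \<in> \<Union>?E" using E[of "Box l u"] by blast
    qed
  qed
  then have bp: "box_partition ?\<Omega> ?E"
    unfolding box_partition_def rectangle_iff[of ?\<Omega>] using fin rect disj Z(3)
    by (intro conjI ballI impI exI[of _ "\<lambda>k. hd (Z k)"] exI[of _ "\<lambda>k. last (Z k)"]) simp_all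
  have "edges k ?E = (\<Union>(c, a, b)\<in>?S k. kseg k c a b)" for k
  proof
    show "edges k ?E \<subseteq> (\<Union>(c, a, b)\<in>?S k. kseg k c a b)"
    proof
      fix z assume "z \<in> edges k ?E"
      then obtain l u where lu: "Box l u \<in> ?E" "\<forall>j. l j < u j" "z \<in> Box l u" "coord k z \<in> {l k, u k}"
        by (rule edgesE)
      then obtain l' u' where lu': "Box l u = Box l' u'" "\<forall>k. adjacent (set (Z k)) (l' k) (u' k)" by (auto simp: E)
      moreover from lu'(2) have "\<forall>k. l' k < u' k" using ad by blast
      ultimately have "l = l'" "u = u'" using Box_inject[of l u l' u'] lu(2) by auto
      then have "coord k z \<in> set (Z k)" using lu' lu by (auto simp: adjacent_def)
      moreover have "z \<in> ?\<Omega>" using sub lu' lu by blast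
      ultimately show "z \<in> (\<Union>(c, a, b)\<in>?S k. kseg k c a b)" by (auto simp: mem_kseg mem_Box)
    qed
    show "(\<Union>(c, a, b)\<in>?S k. kseg k c a b) \<subseteq> edges k ?E"
    proof
      fix z assume "z \<in> (\<Union>(c, a, b)\<in>?S k. kseg k c a b)"
      then have z: "coord k z \<in> set (Z k)" "hd (Z (other k)) \<le> coord (other k) z" "coord (other k) z \<le> last (Z (other k))"
        by (auto simp: mem_kseg)
      then have "z \<in> ?\<Omega>" using sorted_hd_last[OF Z(1)] by (simp add: mem_Box all_axis[of _ k])
      then obtain l u where lu: "z \<in> Box l u" "\<forall>k. adjacent (set (Z k)) (l k) (u k)" using cover by blast
      then have "coord k z \<in> {l k, u k}" using z(1) by (force simp: adjacent_def mem_Box order.strict_iff_order)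
      then show "z \<in> edges k ?E" using lu ad by (intro edgesI[of l u]) (auto simp: E)
    qed
  qed
  moreover have "weighted w ?M" by (simp add: weighted_def tensor_of_def)
  ultimately show ?thesis using bp Z(3) by (auto simp: drawn_def)
qed

lemma tensor_mesh_tensor_of:
  assumes Z: "\<And>k. sorted (Z k)" "\<And>k. Z k \<noteq> []" "\<And>k. hd (Z k) < last (Z k)"
    and w: "\<And>k c. c \<in> set (Z k) \<Longrightarrow> w k c = count_list (Z k) c"
  shows "tensor_mesh (Z Ax1) (Z Ax2) (tensor_of Z w)"
proof -
  have "elems (tensor_of Z w) = {cbox (Z Ax1 ! i, Z Ax2 ! j) (Z Ax1 ! Suc i, Z Ax2 ! Suc j) | i j.
        Suc i < length (Z Ax1) \<and> Suc j < length (Z Ax2) \<and> Z Ax1 ! i < Z Ax1 ! Suc i \<and> Z Ax2 ! j < Z Ax2 ! Suc j}"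
    (is "?L = ?R")
  proof
    show "?L \<subseteq> ?R"
    proof
      fix \<beta> assume "\<beta> \<in> ?L"
      then obtain l u where lu: "\<beta> = Box l u" "\<forall>k. adjacent (set (Z k)) (l k) (u k)"
        by (auto simp: tensor_of_def)
      obtain i j where "Suc i < length (Z Ax1)" "Z Ax1 ! i < Z Ax1 ! Suc i" "l Ax1 = Z Ax1 ! i" "u Ax1 = Z Ax1 ! Suc i"
        "Suc j < length (Z Ax2)" "Z Ax2 ! j < Z Ax2 ! Suc j" "l Ax2 = Z Ax2 ! j" "u Ax2 = Z Ax2 ! Suc j"
        using lu(2) unfolding adjacent_set_iff[OF Z(1)] all_axis[of _ Ax1] other.simps by blast
      then show "\<beta> \<in> ?R" unfolding lu(1) Box_eq_cbox by auto
    qed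
    show "?R \<subseteq> ?L"
    proof
      fix \<beta> assume "\<beta> \<in> ?R"
      then obtain i j where ij: "\<beta> = cbox (Z Ax1 ! i, Z Ax2 ! j) (Z Ax1 ! Suc i, Z Ax2 ! Suc j)"
        "Suc i < length (Z Ax1)" "Suc j < length (Z Ax2)" "Z Ax1 ! i < Z Ax1 ! Suc i" "Z Ax2 ! j < Z Ax2 ! Suc j"
        by blast
      then show "\<beta> \<in> ?L"
        unfolding cbox_eq_Box tensor_of_def adjacent_set_iff[OF Z(1)]
        by (auto simp: all_axis[of _ Ax1])
          (rule exI[of _ "case_axis (Z Ax1 ! i) (Z Ax2 ! j)"], rule exI[of _ "case_axis (Z Ax1 ! Suc i) (Z Ax2 ! Suc j)"], auto)
    qed
  qed
  moreover have "mu (tensor_of Z w) (kseg k c a b) = count_list (Z k) c"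
    if ml: "kseg k c a b \<in> kmeshlines k (elems (tensor_of Z w))" for k c a b
  proof -
    \<comment> \<open>\<open>tensor_mesh\<close> quantifies over arbitrary bounds, so
      \<open>a < b\<close> has to be recovered from the fact that a meshline has two distinct
      ends.\<close>
    obtain c' a' b' where ab': "a' < b'" "kseg k c a b = kseg k c' a' b'" using ml by (rule kmeshlineE)
    have "kpoint k c' a' \<in> kseg k c a b" "kpoint k c' b' \<in> kseg k c a b" unfolding ab' using ab'(1) by auto
    then have ab: "a < b" "c = c'" using ab'(1) by auto
    note dr = drawn_tensor_of[where Z = Z and w = w, OF Z]
    have "kseg k c a b \<subseteq> edges k (elems (tensor_of Z w))"
      by (rule kmeshline_edges[OF _ ml]) (use dr in \<open>unfold drawn_def, blast\<close>)
    then have "kpoint k c a \<in> edges k (elems (tensor_of Z w))" using ab by auto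
    then have "c \<in> set (Z k)" unfolding drawn_edges_iff[OF dr] by auto
    then show ?thesis using ab by (simp add: tensor_of_def w)
  qed
  ultimately show ?thesis unfolding tensor_mesh_def using Z(1) by simp
qed

section \<open>Knot vectors supported by a mesh\<close>

lemma hd_less_last:
  assumes "sorted xs" "xs \<noteq> []" "count_list xs (hd xs) < length xs"
  shows "hd xs < last xs"
proof (rule ccontr)
  assume "\<not> hd xs < last xs"
  then have "x = hd xs" if "x \<in> set xs" for x
    using sorted_hd_last[OF assms(1) that] by auto
  then have "filter ((=) (hd xs)) xs = xs" by (intro filter_True) auto
  then show False using assms(3) by (simp add: count_list_eq_length_filter)
qed

text \<open>A form of \<open>has_support\<close> in terms of edges and weights. It is easily seen to
  survive refinement of the mesh and knot insertion, so all knot pairs of a run satisfy it.\<close>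

definition fits :: "(axis \<Rightarrow> nat) \<Rightarrow> (axis \<Rightarrow> real \<Rightarrow> nat) \<Rightarrow> mesh \<Rightarrow> knot_pair \<Rightarrow> bool" where
  "fits p w M B \<longleftrightarrow> is_knot_pair p B \<and>
     (\<forall>k. \<forall>t\<in>set (knots k B). bspline_split k t B \<subseteq> edges k (elems M) \<and> count_list (knots k B) t \<le> w k t)"

lemma supp_eq_Box: "supp B = Box (\<lambda>k. hd (knots k B)) (\<lambda>k. last (knots k B))"
  by (cases B) (simp add: Box_eq_cbox)

text \<open>The upper bound on \<open>w\<close> prevents a vector of \<open>p k + 2\<close> knots
  from being constant, so supports are nondegenerate. The lower bound means that a line whose knot
  is missing always has multiplicity left to insert.\<close>

locale line_mesh =
  fixes p :: "axis \<Rightarrow> nat" and w :: "axis \<Rightarrow> real \<Rightarrow> nat" and \<Omega> :: "point set" and M :: mesh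
  assumes bp: "box_partition \<Omega> (elems M)" and wt: "weighted w M"
    and w_le: "w k c \<le> p k + 1" and w_ge: "z \<in> edges k (elems M) \<Longrightarrow> 1 \<le> w k (coord k z)"
begin

lemma fits_knots:
  assumes "fits p w M B"
  shows "sorted (knots k B)" "length (knots k B) = p k + 2" "knots k B \<noteq> []" "hd (knots k B) < last (knots k B)"
    "hd (knots k B) \<in> set (knots k B)" "last (knots k B) \<in> set (knots k B)"
proof -
  show 1: "sorted (knots k B)" "length (knots k B) = p k + 2"
    using assms by (auto simp: fits_def is_knot_pair_def)
  then show 2: "knots k B \<noteq> []" by auto
  then show 3: "hd (knots k B) \<in> set (knots k B)" "last (knots k B) \<in> set (knots k B)" by auto
  have "count_list (knots k B) (hd (knots k B)) \<le> w k (hd (knots k B))"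
    using assms 3 by (auto simp: fits_def)
  then have "count_list (knots k B) (hd (knots k B)) < length (knots k B)"
    using w_le[of k "hd (knots k B)"] 1(2) by simp
  then show "hd (knots k B) < last (knots k B)" using hd_less_last 1 2 by blast
qed

lemma fits_bounds:
  assumes "fits p w M B" "t \<in> set (knots k B)"
  shows "hd (knots k B) \<le> t" "t \<le> last (knots k B)"
  using sorted_hd_last[OF fits_knots(1)[OF assms(1)] assms(2)] by auto

text \<open>The chord ends on the first and last orthogonal splits of \<open>B\<close>, which are
  edges; so both ends are crossings of edges and thus vertices.\<close>

lemma chord_mesh_split:
  assumes B: "fits p w M B" and c: "hd (knots k B) \<le> c" "c \<le> last (knots k B)"
    and e: "bspline_split k c B \<subseteq> edges k (elems M)"
  shows "mesh_split k (elems M) (bspline_split k c B)"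
proof -
  note o = fits_knots[OF B, of "other k"]
  have v: "kpoint k c t \<in> vertices (elems M)" if t: "t \<in> set (knots (other k) B)" for t
  proof -
    have "kpoint (other k) t c \<in> bspline_split (other k) t B"
      using c by (simp add: bspline_split_def)
    then have "kpoint k c t \<in> edges (other k) (elems M)"
      using B t by (auto simp: fits_def kpoint_other)
    moreover have "kpoint k c t \<in> edges k (elems M)"
      using e fits_bounds[OF B t] by (auto simp: bspline_split_def)
    ultimately show ?thesis using vertices_eq_edges[OF bp, of k] by blast
  qed
  show ?thesis
    unfolding bspline_split_def using o v
    by (intro mesh_split_intro[OF bp]) (use e in \<open>auto simp: bspline_split_def\<close>)
qed

lemma split_mult_chord:
  assumes B: "fits p w M B" and c: "hd (knots k B) \<le> c" "c \<le> last (knots k B)"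
    and e: "bspline_split k c B \<subseteq> edges k (elems M)"
  shows "split_mult M (bspline_split k c B) = w k c"
  using split_mult_weighted[OF wt chord_mesh_split[OF assms, unfolded bspline_split_def]]
    fits_knots(4)[OF B] by (simp add: bspline_split_def)

lemma has_support_fits:
  assumes B: "fits p w M B"
  shows "has_support M B"
proof -
  obtain lo hi where \<Omega>: "\<Omega> = Box lo hi" using bp by (auto simp: box_partition_def rectangle_iff)
  have "lo k \<le> hd (knots k B) \<and> last (knots k B) \<le> hi k" for k
  proof -
    note k = fits_knots[OF B, of k] and o = fits_knots[OF B, of "other k"]
    have "kpoint k t (hd (knots (other k) B)) \<in> Box lo hi" if "t \<in> set (knots k B)" for t
    proof -
      have "kpoint k t (hd (knots (other k) B)) \<in> bspline_split k t B"
        using o by (simp add: bspline_split_def)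
      then show ?thesis using B that edges_subset[OF bp, of k] \<Omega> by (auto simp: fits_def)
    qed
    from this[OF k(5)] this[OF k(6)] show ?thesis by (auto simp: mem_Box all_axis[of _ k])
  qed
  then have "supp B \<subseteq> \<Union>(elems M)"
    using bp \<Omega> by (auto simp: supp_eq_Box mem_Box box_partition_def) (meson order_trans)+
  moreover have "\<exists>\<gamma>. mesh_split k (elems M) \<gamma> \<and> bspline_split k t B \<subseteq> \<gamma> \<and> count_list (knots k B) t \<le> split_mult M \<gamma>"
    if t: "t \<in> set (knots k B)" for k t
  proof -
    have e: "bspline_split k t B \<subseteq> edges k (elems M)" "count_list (knots k B) t \<le> w k t"
      using B t by (auto simp: fits_def)
    show ?thesis
      using chord_mesh_split[OF B fits_bounds[OF B t] e(1)] split_mult_chord[OF B fits_bounds[OF B t] e(1)] e(2)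
      by (intro exI[of _ "bspline_split k t B"]) auto
  qed
  ultimately show ?thesis unfolding has_support_def by blast
qed

lemma traverses_supp_iff:
  assumes "fits p w M B"
  shows "traverses (kseg k c a b) (interior (supp B)) \<longleftrightarrow>
    hd (knots k B) < c \<and> c < last (knots k B) \<and> a \<le> hd (knots (other k) B) \<and> last (knots (other k) B) \<le> b"
  unfolding supp_eq_Box using fits_knots(4)[OF assms] by (subst traverses_interior_Box_iff) auto

text \<open>A traversing mesh split contains the whole chord of the support on its line, and every
  split on that line has multiplicity \<open>w k c\<close>. So only chords have to be tested, not
  all splits.\<close>

lemma minimal_supportI:
  assumes B: "fits p w M B"
    and mult: "\<And>k t. t \<in> set (knots k B) \<Longrightarrow> hd (knots k B) < t \<Longrightarrow> t < last (knots k B) \<Longrightarrow> count_list (knots k B) t = w k t"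
    and trav: "\<And>k c. hd (knots k B) < c \<Longrightarrow> c < last (knots k B) \<Longrightarrow> bspline_split k c B \<subseteq> edges k (elems M) \<Longrightarrow> c \<in> set (knots k B)"
  shows "minimal_support M B"
  unfolding minimal_support_def
proof (intro conjI has_support_fits[OF B] allI impI)
  fix k \<gamma> assume \<gamma>: "mesh_split k (elems M) \<gamma> \<and> \<gamma> \<inter> interior (supp B) \<noteq> {}"
  then obtain c a b where s: "a < b" "\<gamma> = kseg k c a b" using mesh_splitE by metis
  have o: "hd (knots (other k) B) < last (knots (other k) B)" using fits_knots[OF B] by simp
  obtain z where "z \<in> \<gamma>" "z \<in> interior (supp B)" using \<gamma> by blast
  then have c: "hd (knots k B) < c" "c < last (knots k B)"
    by (auto simp: s mem_kseg supp_eq_Box mem_interior_Box)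
  have sm: "split_mult M \<gamma> = w k c" using split_mult_weighted[OF wt, of k c a b] \<gamma> s by simp
  show "traverses \<gamma> (interior (supp B)) \<longleftrightarrow>
    (\<exists>t\<in>set (knots k B). bspline_split k t B \<subseteq> \<gamma> \<and> count_list (knots k B) t = split_mult M \<gamma>)"
  proof
    assume "traverses \<gamma> (interior (supp B))"
    then have ab: "a \<le> hd (knots (other k) B)" "last (knots (other k) B) \<le> b"
      unfolding s traverses_supp_iff[OF B] by auto
    then have sub: "bspline_split k c B \<subseteq> \<gamma>" using o by (simp add: bspline_split_def s kseg_subset_iff)
    then have "bspline_split k c B \<subseteq> edges k (elems M)" using mesh_split_edges[OF bp] \<gamma> by blast
    then have "c \<in> set (knots k B)" using trav c by blast
    then show "\<exists>t\<in>set (knots k B). bspline_split k t B \<subseteq> \<gamma> \<and> count_list (knots k B) t = split_mult M \<gamma>"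
      using sub mult c sm by auto
  next
    assume "\<exists>t\<in>set (knots k B). bspline_split k t B \<subseteq> \<gamma> \<and> count_list (knots k B) t = split_mult M \<gamma>"
    then obtain t where "bspline_split k t B \<subseteq> \<gamma>" by blast
    then have "t = c \<and> a \<le> hd (knots (other k) B) \<and> last (knots (other k) B) \<le> b"
      using o unfolding bspline_split_def s(2) by (subst (asm) kseg_subset_iff) auto
    then show "traverses \<gamma> (interior (supp B))" unfolding s traverses_supp_iff[OF B] using c by simp
  qed
qed

definition insertable :: "knot_pair \<Rightarrow> axis \<Rightarrow> real \<Rightarrow> bool" where
  "insertable B k c \<longleftrightarrow> hd (knots k B) < c \<and> c < last (knots k B) \<and>
     bspline_split k c B \<subseteq> edges k (elems M) \<and> count_list (knots k B) c < w k c"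

text \<open>Refinement never gets stuck: failure of minimality comes from a chord whose knot is
  absent or has too small multiplicity, and inserting that knot is allowed.\<close>

lemma not_minimal_insertable:
  assumes B: "fits p w M B" and nm: "\<not> minimal_support M B"
  obtains k c where "insertable B k c"
proof -
  have "\<exists>k c. insertable B k c"
  proof (rule ccontr)
    assume ni: "\<not> (\<exists>k c. insertable B k c)"
    have "minimal_support M B"
    proof (rule minimal_supportI[OF B])
      fix k t assume "t \<in> set (knots k B)" "hd (knots k B) < t" "t < last (knots k B)"
      moreover from this B have "bspline_split k t B \<subseteq> edges k (elems M)" "count_list (knots k B) t \<le> w k t"
        by (auto simp: fits_def)
      ultimately show "count_list (knots k B) t = w k t" using ni by (meson insertable_def le_neq_implies_less)
    next
      fix k c assume c: "hd (knots k B) < c" "c < last (knots k B)" "bspline_split k c B \<subseteq> edges k (elems M)"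
      show "c \<in> set (knots k B)"
      proof (rule ccontr)
        assume "c \<notin> set (knots k B)"
        then have "count_list (knots k B) c = 0" by simp
        moreover have "kpoint k c (hd (knots (other k) B)) \<in> bspline_split k c B"
          using fits_knots(4)[OF B, of "other k"] by (simp add: bspline_split_def)
        then have "1 \<le> w k c" using c w_ge[of "kpoint k c (hd (knots (other k) B))" k] by auto
        ultimately have "insertable B k c" using c by (simp add: insertable_def)
        then show False using ni by blast
      qed
    qed
    then show False using nm by simp
  qed
  then show thesis using that by blast
qed

lemma insertable_not_minimal:
  assumes B: "fits p w M B" and ins: "insertable B k c"
  shows "\<not> minimal_support M B"
proof
  assume mi: "minimal_support M B"
  let ?\<gamma> = "bspline_split k c B"
  have c: "hd (knots k B) < c" "c < last (knots k B)" "?\<gamma> \<subseteq> edges k (elems M)" "count_list (knots k B) c < w k c"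
    using ins by (auto simp: insertable_def)
  have o: "hd (knots (other k) B) < last (knots (other k) B)" using fits_knots[OF B] by simp
  have ms: "mesh_split k (elems M) ?\<gamma>" "split_mult M ?\<gamma> = w k c"
    using chord_mesh_split[OF B] split_mult_chord[OF B] c by auto
  obtain t where t: "hd (knots (other k) B) < t" "t < last (knots (other k) B)" using o dense by blast
  have "kpoint k c t \<in> ?\<gamma>" "kpoint k c t \<in> interior (supp B)"
    using t c by (auto simp: bspline_split_def supp_eq_Box mem_interior_Box all_axis[of _ k])
  moreover have "traverses ?\<gamma> (interior (supp B))"
    unfolding bspline_split_def traverses_supp_iff[OF B] using c by simp
  ultimately obtain s where s: "bspline_split k s B \<subseteq> ?\<gamma>" "count_list (knots k B) s = w k c"
    using mi ms unfolding minimal_support_def by (metis IntI empty_iff)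
  then have "s = c" using o by (auto simp: bspline_split_def kseg_subset_iff)
  then show False using s c by simp
qed

end

section \<open>Knot insertion\<close>

definition children :: "knot_pair \<Rightarrow> axis \<Rightarrow> real \<Rightarrow> knot_pair set" where
  "children B k c = {set_knots k (butlast (insort c (knots k B))) B, set_knots k (tl (insort c (knots k B))) B}"

lemma knots_set_knots [simp]: "knots k (set_knots k z B) = z" "knots (other k) (set_knots k z B) = knots (other k) B"
  by (cases k; cases B; simp)+

lemma childrenE:
  assumes "B' \<in> children B k c"
  obtains K where "K \<in> {butlast (insort c (knots k B)), tl (insort c (knots k B))}" "B' = set_knots k K B"
  using assms by (auto simp: children_def)

lemma count_list_insort: "count_list (insort c xs) x = count_list xs x + (if x = c then 1 else 0)"
  unfolding count_mset[symmetric] by simp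

lemma count_list_tl_hd: "xs \<noteq> [] \<Longrightarrow> count_list xs x = count_list (tl xs) x + (if x = hd xs then 1 else 0)"
  by (cases xs) auto

lemma count_list_butlast_last:
  "xs \<noteq> [] \<Longrightarrow> count_list xs x = count_list (butlast xs) x + (if x = last xs then 1 else 0)"
  by (cases xs rule: rev_cases) auto

text \<open>The discarded knot is an end of the enlarged vector, so strictly between the new ends no
  multiplicity is lost. The resulting exact count is what makes refinement terminate.\<close>

lemma child_knots:
  fixes xs :: "real list"
  assumes xs: "sorted xs" "hd xs < c" "c < last xs" "2 \<le> length xs"
    and K: "K \<in> {butlast (insort c xs), tl (insort c xs)}"
  shows "sorted K" "length K = length xs" "set K \<subseteq> insert c (set xs)" "hd xs \<le> hd K" "last K \<le> last xs"
    "count_list K x \<le> count_list xs x + (if x = c then 1 else 0)"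
    "hd K < x \<Longrightarrow> x < last K \<Longrightarrow> count_list K x = count_list xs x + (if x = c then 1 else 0)"
proof -
  let ?L = "insort c xs"
  have L: "sorted ?L" "length ?L = Suc (length xs)" "?L \<noteq> []"
    using xs by (simp_all add: sorted_insort insort_not_Nil)
  show s: "sorted K" using K L(1) by (auto simp: sorted_butlast sorted_tl)
  show l: "length K = length xs" using K L(2) by auto
  then have ne: "K \<noteq> []" using xs by auto
  have sub: "set K \<subseteq> set ?L" using K L(3) by (auto dest: in_set_butlastD simp del: set_insort_key intro: list.set_sel(2))
  then show "set K \<subseteq> insert c (set xs)" by (simp add: set_insort_key)
  then have bd: "hd xs \<le> x \<and> x \<le> last xs" if "x \<in> set K" for x
    using that sorted_hd_last[OF xs(1), of x] xs by auto
  then show "hd xs \<le> hd K" "last K \<le> last xs" using ne by auto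
  have split: "count_list ?L x = count_list (butlast ?L) x + (if x = last ?L then 1 else 0)"
    "count_list ?L x = count_list (tl ?L) x + (if x = hd ?L then 1 else 0)"
    using count_list_butlast_last[OF L(3)] count_list_tl_hd[OF L(3)] by blast+
  then have "count_list K x \<le> count_list ?L x" using K by auto
  then show "count_list K x \<le> count_list xs x + (if x = c then 1 else 0)"
    using count_list_insort[of c xs x] by simp
  have "last K \<in> set ?L" "hd K \<in> set ?L"
    using ne by (auto intro!: subsetD[OF sub] simp del: set_insort_key)
  then have "last K \<le> last ?L" "hd ?L \<le> hd K" using sorted_hd_last[OF L(1)] by blast+
  then have "count_list K x = count_list ?L x" if "hd K < x" "x < last K"
    using K split that by auto
  then show "count_list K x = count_list xs x + (if x = c then 1 else 0)" if "hd K < x" "x < last K"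
    using count_list_insort[of c xs x] that by simp
qed

context line_mesh begin

lemma fits_child:
  assumes B: "fits p w M B" and ins: "insertable B k c" and B': "B' \<in> children B k c"
  shows "fits p w M B'"
proof -
  obtain K where K: "K \<in> {butlast (insort c (knots k B)), tl (insort c (knots k B))}" "B' = set_knots k K B"
    using B' by (rule childrenE)
  have c: "hd (knots k B) < c" "c < last (knots k B)" "bspline_split k c B \<subseteq> edges k (elems M)"
    "count_list (knots k B) c < w k c"
    using ins by (auto simp: insertable_def)
  note k = fits_knots[OF B, of k]
  have two: "2 \<le> length (knots k B)" using k by simp
  note ch = child_knots[OF k(1) c(1,2) two K(1)]
  have kn: "knots k B' = K" "knots (other k) B' = knots (other k) B" using K by auto
  have "is_knot_pair p B'"
    using B ch k unfolding is_knot_pair_def all_axis[of _ k] kn by (simp add: fits_def is_knot_pair_def)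
  moreover have "bspline_split k t B' \<subseteq> edges k (elems M) \<and> count_list K t \<le> w k t" if t: "t \<in> set K" for t
  proof (cases "t = c")
    case True
    then show ?thesis using c ch(6)[of t] by (simp add: bspline_split_def kn)
  next
    case False
    then have "t \<in> set (knots k B)" using ch(3) t by auto
    then have "bspline_split k t B \<subseteq> edges k (elems M) \<and> count_list (knots k B) t \<le> w k t"
      using B by (auto simp: fits_def)
    then show ?thesis using False ch(6)[of t] by (simp add: bspline_split_def kn)
  qed
  moreover have "bspline_split (other k) t B' \<subseteq> edges (other k) (elems M) \<and> count_list (knots (other k) B) t \<le> w (other k) t"
    if t: "t \<in> set (knots (other k) B)" for t
  proof -
    have "bspline_split (other k) t B' \<subseteq> bspline_split (other k) t B"
      using ch(4,5) by (auto simp: bspline_split_def kn mem_kseg)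
    moreover have "bspline_split (other k) t B \<subseteq> edges (other k) (elems M) \<and> count_list (knots (other k) B) t \<le> w (other k) t"
      using B t by (auto simp: fits_def)
    ultimately show ?thesis by blast
  qed
  ultimately show ?thesis unfolding fits_def all_axis[of _ k] kn by blast
qed

lemma knot_insertion_children:
  assumes B: "fits p w M B" and ins: "insertable B k c" and S: "B \<in> S"
  shows "knot_insertion M S (S - {B} \<union> children B k c)"
proof -
  have c: "hd (knots k B) < c" "c < last (knots k B)" "bspline_split k c B \<subseteq> edges k (elems M)"
    "count_list (knots k B) c < w k c"
    using ins by (auto simp: insertable_def)
  let ?a = "hd (knots (other k) B)" and ?b = "last (knots (other k) B)"
  have "mesh_split k (elems M) (kseg k c ?a ?b)" "split_mult M (kseg k c ?a ?b) = w k c"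
    using chord_mesh_split[OF B, of k c] split_mult_chord[OF B, of k c] c by (simp_all add: bspline_split_def)
  moreover have "traverses (kseg k c ?a ?b) (interior (supp B))"
    unfolding traverses_supp_iff[OF B] using c by simp
  ultimately show ?thesis
    unfolding knot_insertion_def children_def using insertable_not_minimal[OF B ins] S c
    by (intro bexI[of _ B] conjI exI[of _ k] exI[of _ c] exI[of _ ?a] exI[of _ ?b]) simp_all
qed

text \<open>The missing multiplicity on all lines with coordinate inside the support, whether or not
  they traverse it at present. A partial line can start to traverse once the support shrinks;
  counting it from the beginning prevents the measure from growing.\<close>

definition deficiency :: "axis \<Rightarrow> knot_pair \<Rightarrow> nat" where
  "deficiency k B = (\<Sum>c\<in>coord k ` vertices (elems M) \<inter> {hd (knots k B)<..<last (knots k B)}.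
     w k c - count_list (knots k B) c)"

lemma deficiency_child:
  assumes B: "fits p w M B" and ins: "insertable B k c" and B': "B' \<in> children B k c"
  shows "deficiency k B' + deficiency (other k) B' < deficiency k B + deficiency (other k) B"
proof -
  obtain K where K: "K \<in> {butlast (insort c (knots k B)), tl (insort c (knots k B))}" "B' = set_knots k K B"
    using B' by (rule childrenE)
  have c: "hd (knots k B) < c" "c < last (knots k B)" "bspline_split k c B \<subseteq> edges k (elems M)"
    "count_list (knots k B) c < w k c"
    using ins by (auto simp: insertable_def)
  note k = fits_knots[OF B, of k]
  have two: "2 \<le> length (knots k B)" using k by simp
  note ch = child_knots[OF k(1) c(1,2) two K(1)]
  have kn: "knots k B' = K" "knots (other k) B' = knots (other k) B" using K by auto
  let ?C = "coord k ` vertices (elems M)"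
  let ?I = "?C \<inter> {hd (knots k B)<..<last (knots k B)}" and ?J = "?C \<inter> {hd K<..<last K}"
  let ?g = "\<lambda>x. if x \<in> ?J then w k x - count_list K x else 0"
  have fin: "finite ?I" using finite_vertices[OF bp] by simp
  have "mesh_split k (elems M) (bspline_split k c B)" using chord_mesh_split[OF B] c by simp
  then have "kpoint k c (hd (knots (other k) B)) \<in> vertices (elems M)"
    using mesh_split_ends[of k "elems M" c "hd (knots (other k) B)" "last (knots (other k) B)"]
      fits_knots(4)[OF B, of "other k"] by (simp add: bspline_split_def)
  then have cI: "c \<in> ?I" using c by (auto intro!: image_eqI[of c "coord k"])
  have JI: "?J \<subseteq> ?I" using ch(4,5) by auto
  have "deficiency k B' = sum ?g ?I"
    unfolding deficiency_def kn by (rule sum.mono_neutral_cong_left[OF fin JI]) auto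
  also have "\<dots> < (\<Sum>x\<in>?I. w k x - count_list (knots k B) x)"
  proof (rule sum_strict_mono_ex1[OF fin])
    show "\<forall>x\<in>?I. ?g x \<le> w k x - count_list (knots k B) x" using ch(7) by auto
    \<comment> \<open>At \<open>c\<close> there is a strict drop in either case: inside the child
      the count rises by one, and otherwise the positive summand of \<open>c\<close>
      disappears.\<close>
    show "\<exists>x\<in>?I. ?g x < w k x - count_list (knots k B) x"
      using cI ch(7)[of c] c by (intro bexI[of _ c]) auto
  qed
  also have "\<dots> = deficiency k B" by (simp add: deficiency_def)
  finally show ?thesis by (simp add: deficiency_def[of "other k"] kn)
qed

definition total_deficiency :: "knot_pair \<Rightarrow> nat" where
  "total_deficiency B = deficiency Ax1 B + deficiency Ax2 B"

lemma total_deficiency_child: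
  assumes "fits p w M B" "insertable B k c" "B' \<in> children B k c"
  shows "total_deficiency B' < total_deficiency B"
  using deficiency_child[OF assms] by (cases k) (auto simp: total_deficiency_def)

lemma finite_children [simp]: "finite (children B k c)"
  by (simp add: children_def)

text \<open>Give a knot pair the weight 3 to the power of its deficiency. Each of the two children
  weighs at most a third of the replaced pair, so the total falls strictly. Only pairs without
  minimal support are replaced, hence the last claim.\<close>

lemma refinement_terminates:
  assumes "finite S" "\<forall>B\<in>S. fits p w M B"
  obtains S' where "(knot_insertion M)\<^sup>*\<^sup>* S S'" "\<forall>B\<in>S'. minimal_support M B \<and> fits p w M B" "finite S'"
    "{B\<in>S. minimal_support M B} \<subseteq> S'"
proof -
  have "\<exists>S'. (knot_insertion M)\<^sup>*\<^sup>* S S' \<and> (\<forall>B\<in>S'. minimal_support M B \<and> fits p w M B) \<and> finite S' \<and>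
    {B\<in>S. minimal_support M B} \<subseteq> S'"
    using assms
  proof (induction "\<Sum>B\<in>S. 3 ^ total_deficiency B :: nat" arbitrary: S rule: less_induct)
    case less
    show ?case
    proof (cases "\<forall>B\<in>S. minimal_support M B")
      case True
      then show ?thesis using less.prems by (intro exI[of _ S]) auto
    next
      case False
      then obtain B where B: "B \<in> S" "\<not> minimal_support M B" by blast
      then have fB: "fits p w M B" using less.prems by blast
      obtain k c where ins: "insertable B k c" using not_minimal_insertable[OF fB B(2)] by blast
      let ?f = "\<lambda>B. 3 ^ total_deficiency B :: nat"
      let ?T = "S - {B} \<union> children B k c"
      have small: "3 * ?f B' \<le> ?f B" if "B' \<in> children B k c" for B'
        using power_increasing[of "Suc (total_deficiency B')" "total_deficiency B" "3::nat"]
          total_deficiency_child[OF fB ins that] by simp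
      have "3 * sum ?f (children B k c) \<le> 2 * ?f B"
      proof -
        have "3 * sum ?f (children B k c) = (\<Sum>B'\<in>children B k c. 3 * ?f B')" by (simp add: sum_distrib_left)
        also have "\<dots> \<le> (\<Sum>B'\<in>children B k c. ?f B)" by (intro sum_mono small)
        also have "\<dots> = card (children B k c) * ?f B" by simp
        also have "\<dots> \<le> 2 * ?f B"
          by (intro mult_right_mono) (auto simp: children_def card_insert_if)
        finally show ?thesis .
      qed
      moreover have "0 < ?f B" by simp
      ultimately have "sum ?f (children B k c) < ?f B" by linarith
      moreover have "sum ?f ?T \<le> sum ?f (S - {B}) + sum ?f (children B k c)"
        using less.prems by (simp add: sum_Un_nat)
      moreover have "sum ?f S = sum ?f (S - {B}) + ?f B"
        using less.prems B by (simp add: sum.remove)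
      ultimately have lt: "sum ?f ?T < sum ?f S" by linarith
      have "\<forall>B\<in>?T. fits p w M B" using less.prems fits_child[OF fB ins] by blast
      then obtain S' where S': "(knot_insertion M)\<^sup>*\<^sup>* ?T S'" "\<forall>B\<in>S'. minimal_support M B \<and> fits p w M B"
          "finite S'" "{B\<in>?T. minimal_support M B} \<subseteq> S'"
        using less.hyps[OF lt] less.prems by auto
      have "knot_insertion M S ?T" by (rule knot_insertion_children[OF fB ins B(1)])
      then have "(knot_insertion M)\<^sup>*\<^sup>* S S'" using S'(1) by (rule converse_rtranclp_into_rtranclp)
      moreover have "{B\<in>S. minimal_support M B} \<subseteq> S'" using S'(4) B(2) by blast
      ultimately show ?thesis using S' by blast
    qed
  qed
  then show thesis using that by blast
qed

end

section \<open>The B-splines of the tensor product mesh\<close>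

lemma finite_initial_bsplines: "finite (initial_bsplines p X Y)"
proof -
  have "initial_bsplines p X Y \<subseteq> (\<lambda>(i, j). (take (p Ax1 + 2) (drop i X), take (p Ax2 + 2) (drop j Y))) `
    ({..length X} \<times> {..length Y})"
    by (auto simp: initial_bsplines_def)
  then show ?thesis by (rule finite_subset) auto
qed

lemma fits_initial_bsplines:
  assumes Z: "\<And>k. sorted (Z k)" "\<And>k. Z k \<noteq> []" "\<And>k. hd (Z k) < last (Z k)"
    and w: "\<And>k c. c \<in> set (Z k) \<Longrightarrow> w k c = count_list (Z k) c"
    and B: "B \<in> initial_bsplines p (Z Ax1) (Z Ax2)"
  shows "fits p w (tensor_of Z w) B"
proof -
  have win: "\<exists>i. knots k B = take (p k + 2) (drop i (Z k)) \<and> i + (p k + 2) \<le> length (Z k)" for k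
    using B by (cases k) (auto simp: initial_bsplines_def)
  note dr = drawn_tensor_of[where Z = Z and w = w, OF Z]
  have main: "sorted (knots k B) \<and> length (knots k B) = p k + 2 \<and> set (knots k B) \<subseteq> set (Z k) \<and>
    count_list (knots k B) t \<le> count_list (Z k) t" for k t
  proof -
    obtain i where i: "knots k B = take (p k + 2) (drop i (Z k))" "i + (p k + 2) \<le> length (Z k)" using win by blast
    have "count_list (Z k) t = count_list (take i (Z k)) t + count_list (take (p k + 2) (drop i (Z k))) t +
       count_list (drop (p k + 2) (drop i (Z k))) t"
      by (metis append_take_drop_id count_list_append add.assoc)
    then have "count_list (knots k B) t \<le> count_list (Z k) t" using i by simp
    then show ?thesis using i Z(1)[of k]
      by (auto simp: sorted_wrt_take sorted_wrt_drop dest: in_set_takeD in_set_dropD)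
  qed
  have hl: "hd (Z k) \<le> hd (knots k B) \<and> last (knots k B) \<le> last (Z k)" for k
  proof -
    have "knots k B \<noteq> []" using main[of k] by auto
    then have "hd (knots k B) \<in> set (knots k B)" "last (knots k B) \<in> set (knots k B)" by auto
    then show ?thesis using main sorted_hd_last[OF Z(1)[of k]] by blast
  qed
  have "bspline_split k t B \<subseteq> edges k (elems (tensor_of Z w))" if "t \<in> set (knots k B)" for k t
  proof
    fix z assume "z \<in> bspline_split k t B"
    moreover have "t \<in> set (Z k)" using that main by blast
    ultimately show "z \<in> edges k (elems (tensor_of Z w))"
      using hl[of "other k"] unfolding drawn_edges_iff[OF dr]
      by (intro exI[of _ "hd (Z (other k))"] exI[of _ "last (Z (other k))"]) (auto simp: bspline_split_def mem_kseg)
  qed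
  moreover have "count_list (knots k B) t \<le> w k t" if "t \<in> set (knots k B)" for k t
    using that main w by (metis subsetD)
  ultimately show ?thesis unfolding fits_def is_knot_pair_def using main by blast
qed

lemma LR_knots_imp_LR_mesh: "LR_knots p M S \<Longrightarrow> LR_mesh p M"
  by (induction rule: LR_knots.induct) (auto intro: LR_mesh.intros)

section \<open>Univariate B-splines\<close>

text \<open>The recurrence with both end knots displayed, which suits arguments that treat the two
  ends symmetrically.\<close>

lemma bspline_rec:
  assumes "m \<noteq> []"
  shows "bspline (a # m @ [e]) x =
    (x - a) / (last m - a) * bspline (a # m) x + (e - x) / (e - hd m) * bspline (m @ [e]) x"
proof -
  obtain b m' where m: "m = b # m'" using assms by (cases m) auto
  show ?thesis
  proof (cases m')
    case Nil
    then show ?thesis by (simp add: m)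
  next
    case (Cons c m'')
    then show ?thesis by (simp add: m butlast_append)
  qed
qed

lemma ends_cases:
  assumes "2 \<le> length xs"
  obtains a m e where "xs = a # m @ [e]"
proof -
  obtain a ys where ys: "xs = a # ys" using assms by (cases xs) auto
  then have "ys \<noteq> []" using assms by auto
  then have "xs = a # butlast ys @ [last ys]" using ys by simp
  then show thesis by (rule that)
qed

lemma bspline_outside:
  assumes "sorted xs" "xs \<noteq> []" "x < hd xs \<or> last xs \<le> x"
  shows "bspline xs x = 0"
  using assms
proof (induction "length xs" arbitrary: xs rule: less_induct)
  case less
  show ?case
  proof (cases "2 \<le> length xs")
    case False
    then obtain a where "xs = [a]" using less.prems by (cases xs) (auto simp: Suc_le_eq)
    then show ?thesis by simp
  next
    case True
    then obtain a m e where xs: "xs = a # m @ [e]" by (rule ends_cases)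
    show ?thesis
    proof (cases "m = []")
      case True
      then show ?thesis using less.prems xs by auto
    next
      case False
      then have s: "sorted (a # m)" "sorted (m @ [e])" "a \<le> hd m" "last m \<le> e"
        using less.prems xs by (auto simp: sorted_append)
      have o: "x < a \<or> e \<le> x" using less.prems(3) by (simp add: xs)
      then have o': "x < a \<or> last m \<le> x" "x < hd m \<or> e \<le> x" using s(3,4) by linarith+
      have "bspline (a # m) x = 0" by (rule less.hyps) (use s(1) o'(1) False in \<open>auto simp: xs\<close>)
      moreover have "bspline (m @ [e]) x = 0"
        by (rule less.hyps) (use s(2) o'(2) False in \<open>simp_all add: xs\<close>)
      ultimately show ?thesis unfolding xs bspline_rec[OF False] by simp
    qed
  qed
qed

lemma bspline_nonneg:
  assumes "sorted xs"
  shows "0 \<le> bspline xs x"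
  using assms
proof (induction "length xs" arbitrary: xs rule: less_induct)
  case less
  show ?case
  proof (cases "2 \<le> length xs")
    case False
    then consider "xs = []" | a where "xs = [a]" by (cases xs) (auto simp: Suc_le_eq)
    then show ?thesis by cases auto
  next
    case True
    then obtain a m e where xs: "xs = a # m @ [e]" by (rule ends_cases)
    show ?thesis
    proof (cases "m = []")
      case True
      then show ?thesis using xs by auto
    next
      case False
      then have s: "sorted (a # m)" "sorted (m @ [e])" "a \<le> hd m" "last m \<le> e" "a \<le> last m" "hd m \<le> e"
        using less.prems xs by (auto simp: sorted_append)
      have "0 \<le> (x - a) / (last m - a) * bspline (a # m) x"
      proof (cases "x < a")
        case True
        then show ?thesis using bspline_outside[OF s(1)] by simp
      next
        case False
        then show ?thesis using s less.hyps[of "a # m"] by (simp add: xs)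
      qed
      moreover have "0 \<le> (e - x) / (e - hd m) * bspline (m @ [e]) x"
      proof (cases "e \<le> x")
        case True
        then show ?thesis using bspline_outside[OF s(2)] by simp
      next
        case False
        then show ?thesis using s less.hyps[of "m @ [e]"] by (simp add: xs)
      qed
      ultimately show ?thesis unfolding xs bspline_rec[OF False] by simp
    qed
  qed
qed

text \<open>Both terms of the recurrence are nonnegative, and since \<open>x\<close> is not the last
  inner knot, one is positive: the first if \<open>x\<close> is before that knot, the second if it
  is after.\<close>

lemma bspline_pos:
  assumes "sorted xs" "2 \<le> length xs" "hd xs < x" "x < last xs" "x \<notin> set xs"
  shows "0 < bspline xs x"
  using assms
proof (induction "length xs" arbitrary: xs rule: less_induct)
  case less
  obtain a m e where xs: "xs = a # m @ [e]" using less.prems(2) by (rule ends_cases)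
  show ?case
  proof (cases "m = []")
    case True
    then show ?thesis using xs less.prems by auto
  next
    case False
    then have s: "sorted (a # m)" "sorted (m @ [e])" "a \<le> hd m" "last m \<le> e" "a \<le> last m" "hd m \<le> e"
      using less.prems(1) xs by (auto simp: sorted_append)
    have hl: "hd m \<le> last m" using sorted_hd_last(2)[of m "hd m"] s(1) False by simp
    have x: "a < x" "x < e" "x \<notin> set m" using less.prems xs by auto
    have len: "2 \<le> length (a # m)" "2 \<le> length (m @ [e])" using False by (cases m; simp)+
    have nn: "0 \<le> (x - a) / (last m - a) * bspline (a # m) x" "0 \<le> (e - x) / (e - hd m) * bspline (m @ [e]) x"
      using s x bspline_nonneg[OF s(1)] bspline_nonneg[OF s(2)] by (simp_all add: zero_le_mult_iff)
    have "x \<noteq> last m" using x(3) False by auto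
    then consider "x < last m" | "last m < x" by linarith
    then have "0 < (x - a) / (last m - a) * bspline (a # m) x + (e - x) / (e - hd m) * bspline (m @ [e]) x"
    proof cases
      case 1
      then have "0 < bspline (a # m) x"
        using less.hyps[of "a # m"] s x len False by (simp add: xs)
      then have "0 < (x - a) / (last m - a) * bspline (a # m) x" using 1 x by simp
      then show ?thesis using nn(2) by simp
    next
      case 2
      then have "0 < bspline (m @ [e]) x"
        using less.hyps[of "m @ [e]"] s x len False hl by (simp add: xs)
      then have "0 < (e - x) / (e - hd m) * bspline (m @ [e]) x" using 2 hl s x by simp
      then show ?thesis using nn(1) by simp
    qed
    then show ?thesis unfolding xs bspline_rec[OF False] .
  qed
qed

text \<open>Boehm's knot insertion. Writing the coefficients with the end knots of the two new knot vectors avoids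
  the usual case distinction on the position of \<open>z\<close>.\<close>

lemma bspline_insert_knot:
  assumes "\<forall>y\<in>set (a # u). y < z" "\<forall>y\<in>set (v @ [e]). z < y"
  shows "bspline (a # u @ v @ [e]) x =
    (z - a) / (last (z # v) - a) * bspline (a # u @ z # v) x +
    (e - z) / (e - hd (u @ [z])) * bspline (u @ z # v @ [e]) x"
  using assms
proof (induction "length u + length v" arbitrary: a u v e rule: less_induct)
  case less
  have az: "a < z" "z < e" using less.prems by auto
  \<comment> \<open>The recurrence removes an end knot, which is \<open>z\<close> itself on a side
    without inner knots; hence four cases. With no inner knots an indicator function is cut at
    \<open>z\<close>. Otherwise the recurrence is applied to all three B-splines, the induction
    hypothesis to the terms lacking \<open>z\<close>, and coefficients are compared.\<close>
  consider "u = []" "v = []" | u0 u' where "u = u0 # u'" "v = []" | v' l where "u = []" "v = v' @ [l]"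
    | u0 u' v' l where "u = u0 # u'" "v = v' @ [l]"
    by (cases u; cases v rule: rev_cases) auto
  then show ?case
  proof cases
    case 1
    then show ?thesis using az by simp
  next
    case (2 u0 u')
    define r0 where "r0 = (x - a) / (last u - a)"
    define h where "h = hd (u' @ [z])"
    have u0: "u0 < z" using less.prems 2 by auto
    have h: "h \<le> z" using less.prems 2 by (cases u') (auto simp: h_def)
    have LHS: "bspline (a # u @ v @ [e]) x = r0 * bspline (a # u) x + (e - x) / (e - u0) * bspline (u @ [e]) x"
      using bspline_rec[of u a e x] 2 by (simp add: r0_def)
    have IH: "bspline (u @ [e]) x = bspline (u @ [z]) x + (e - z) / (e - h) * bspline (u' @ [z, e]) x"
      using less.hyps[of u' "[]" u0 e] less.prems 2 u0 by (simp add: h_def)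
    have N0: "bspline (a # u @ z # v) x = r0 * bspline (a # u) x + (z - x) / (z - u0) * bspline (u @ [z]) x"
      using bspline_rec[of u a z x] 2 by (simp add: r0_def)
    have N1: "bspline (u @ z # v @ [e]) x = (x - u0) / (z - u0) * bspline (u @ [z]) x + (e - x) / (e - h) * bspline (u' @ [z, e]) x"
      using bspline_rec[of "u' @ [z]" u0 e x] 2 by (simp add: h_def)
    have c: "last (z # v) = z" "hd (u @ [z]) = u0" using 2 by auto
    have "e - u0 > 0" "z - u0 > 0" "z - a > 0" "e - h > 0" using u0 h az by auto
    then show ?thesis unfolding LHS IH N0 N1 c by (simp add: divide_simps) algebra
  next
    case (3 v' l)
    define r2 where "r2 = (e - x) / (e - hd v)"
    define g where "g = last (z # v')"
    have l: "z < l" using less.prems 3 by auto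
    have g: "z \<le> g" using less.prems 3 by (cases v' rule: rev_cases) (auto simp: g_def)
    have LHS: "bspline (a # u @ v @ [e]) x = (x - a) / (l - a) * bspline (a # v) x + r2 * bspline (v @ [e]) x"
      using bspline_rec[of v a e x] 3 by (simp add: r2_def)
    have IH: "bspline (a # v) x = (z - a) / (g - a) * bspline (a # z # v') x + bspline (z # v) x"
      using less.hyps[of "[]" v' a l] less.prems 3 l by (simp add: g_def)
    have N0: "bspline (a # u @ z # v) x = (x - a) / (g - a) * bspline (a # z # v') x + (l - x) / (l - z) * bspline (z # v) x"
      using bspline_rec[of "z # v'" a l x] 3 by (simp add: g_def)
    have N1: "bspline (u @ z # v @ [e]) x = (x - z) / (l - z) * bspline (z # v) x + r2 * bspline (v @ [e]) x"
      using bspline_rec[of v z e x] 3 by (simp add: r2_def)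
    have c: "last (z # v) = l" "hd (u @ [z]) = z" using 3 by auto
    have "l - a > 0" "l - z > 0" "e - z > 0" "g - a > 0" using l g az by auto
    then show ?thesis unfolding LHS IH N0 N1 c by (simp add: divide_simps) algebra
  next
    case (4 u0 u' v' l)
    define h where "h = hd (u' @ [z])"
    define g where "g = last (z # v')"
    have u0: "u0 < z" using less.prems 4 by auto
    have h: "h \<le> z" using less.prems 4 by (cases u') (auto simp: h_def)
    have l: "z < l" using less.prems 4 by auto
    have g: "z \<le> g" using less.prems 4 by (cases v' rule: rev_cases) (auto simp: g_def)
    have LHS: "bspline (a # u @ v @ [e]) x = (x - a) / (l - a) * bspline (a # u @ v) x + (e - x) / (e - u0) * bspline (u @ v @ [e]) x"
      using bspline_rec[of "u @ v" a e x] 4 by simp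
    have IH1: "bspline (a # u @ v) x = (z - a) / (g - a) * bspline (a # u @ z # v') x + (l - z) / (l - u0) * bspline (u @ z # v) x"
      using less.hyps[of u v' a l] less.prems 4 by (simp add: g_def)
    have IH2: "bspline (u @ v @ [e]) x = (z - u0) / (l - u0) * bspline (u @ z # v) x + (e - z) / (e - h) * bspline (u' @ z # v @ [e]) x"
      using less.hyps[of u' v u0 e] less.prems 4 by (simp add: h_def)
    have N0: "bspline (a # u @ z # v) x = (x - a) / (g - a) * bspline (a # u @ z # v') x + (l - x) / (l - u0) * bspline (u @ z # v) x"
      using bspline_rec[of "u @ z # v'" a l x] 4 by (simp add: g_def)
    have N1: "bspline (u @ z # v @ [e]) x = (x - u0) / (l - u0) * bspline (u @ z # v) x + (e - x) / (e - h) * bspline (u' @ z # v @ [e]) x"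
      using bspline_rec[of "u' @ z # v" u0 e x] 4 by (simp add: h_def hd_append split: list.splits)
    have c: "last (z # v) = l" "hd (u @ [z]) = u0" using 4 by auto
    have "l - a > 0" "l - u0 > 0" "e - u0 > 0" "g - a > 0" "e - h > 0" using l g u0 h az by auto
    then show ?thesis unfolding LHS IH1 IH2 N0 N1 c by (simp add: divide_simps) algebra
  qed
qed

section \<open>Recovering the support from the function\<close>

lemma exists_outside_finite:
  fixes a b :: real
  assumes "a < b" "finite F"
  obtains x where "a < x" "x < b" "x \<notin> F"
proof -
  have "infinite ({a<..<b} - F)" using assms infinite_Ioo by simp
  then obtain x where "x \<in> {a<..<b} - F" by (metis ex_in_conv finite.emptyI)
  then show thesis using that by auto
qed

text \<open>A B-spline is positive off the knot lines inside its support, and the other one vanishes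
  outside its own. Used in both directions, this separates B-splines as functions by the corners of
  their supports.\<close>

lemma tensor_bspline_supp_subset:
  assumes B: "\<And>k. sorted (knots k B)" "\<And>k. 2 \<le> length (knots k B)" "\<And>k. hd (knots k B) < last (knots k B)"
    and B': "\<And>k. sorted (knots k B')" "\<And>k. 2 \<le> length (knots k B')"
    and eq: "tensor_bspline B = tensor_bspline B'"
  shows "hd (knots k B') \<le> hd (knots k B) \<and> last (knots k B) \<le> last (knots k B')"
proof -
  have val: "tensor_bspline C z = bspline (knots Ax1 C) (coord Ax1 z) * bspline (knots Ax2 C) (coord Ax2 z)" for C z
    by (cases C; cases z) simp
  have inside: "hd (knots k B') \<le> x \<and> x < last (knots k B')"
    if x: "hd (knots k B) < x" "x < last (knots k B)" "x \<notin> set (knots k B)" for x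
  proof -
    obtain y where y: "hd (knots (other k) B) < y" "y < last (knots (other k) B)" "y \<notin> set (knots (other k) B)"
      using exists_outside_finite[OF B(3)] by (metis List.finite_set)
    have "0 < bspline (knots k B) x" "0 < bspline (knots (other k) B) y"
      using bspline_pos B x y by auto
    then have "tensor_bspline B (kpoint k x y) \<noteq> 0" by (cases k) (auto simp: val)
    then have "tensor_bspline B' (kpoint k x y) \<noteq> 0" using eq by simp
    then have "bspline (knots k B') x \<noteq> 0" by (cases k) (auto simp: val)
    moreover have "knots k B' \<noteq> []" using B'(2)[of k] by auto
    ultimately show ?thesis using bspline_outside[OF B'(1)] by (meson not_le)
  qed
  show ?thesis
  proof (rule ccontr)
    assume "\<not> ?thesis"
    then consider "hd (knots k B) < hd (knots k B')" | "last (knots k B') < last (knots k B)" by linarith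
    then show False
    proof cases
      case 1
      then obtain x where "hd (knots k B) < x" "x < min (hd (knots k B')) (last (knots k B))" "x \<notin> set (knots k B)"
        using exists_outside_finite[of "hd (knots k B)" "min (hd (knots k B')) (last (knots k B))" "set (knots k B)"] B(3)
        by auto
      then show False using inside[of x] by auto
    next
      case 2
      then obtain x where "max (last (knots k B')) (hd (knots k B)) < x" "x < last (knots k B)" "x \<notin> set (knots k B)"
        using exists_outside_finite[of "max (last (knots k B')) (hd (knots k B))" "last (knots k B)" "set (knots k B)"] B(3)
        by auto
      then show False using inside[of x] by auto
    qed
  qed
qed

section \<open>Construction sequences in terms of lines\<close>

text \<open>One listed line has to cover the whole segment; this is what can be checked by
  simplification on an explicit list.\<close>

definition cov :: "(real \<times> real \<times> real) set \<Rightarrow> real \<Rightarrow> real \<Rightarrow> real \<Rightarrow> bool" where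
  "cov L c a b \<longleftrightarrow> (\<exists>a' b'. (c, a', b') \<in> L \<and> a' \<le> a \<and> b \<le> b')"

lemma cov_simps [simp]:
  "cov {} c a b \<longleftrightarrow> False"
  "cov (insert (c', a', b') L) c a b \<longleftrightarrow> c = c' \<and> a' \<le> a \<and> b \<le> b' \<or> cov L c a b"
  "cov (L \<union> L') c a b \<longleftrightarrow> cov L c a b \<or> cov L' c a b"
  by (auto simp: cov_def)

lemma cov_mono: "cov L c a b \<Longrightarrow> L \<subseteq> L' \<Longrightarrow> cov L' c a b"
  by (auto simp: cov_def)

text \<open>LR-rule 2 with a witness set of crossings, which makes the condition monotone in
  \<open>S\<close>: a line that is long once remains so after later insertions.\<close>

definition long_line :: "(axis \<Rightarrow> nat) \<Rightarrow> (axis \<Rightarrow> real \<Rightarrow> nat) \<Rightarrow> (axis \<Rightarrow> (real \<times> real \<times> real) set) \<Rightarrow>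
    axis \<Rightarrow> real \<Rightarrow> real \<Rightarrow> real \<Rightarrow> bool" where
  "long_line p w S k c a b \<longleftrightarrow> a < b \<and> 1 \<le> w k c \<and>
     (\<exists>T. T \<subseteq> {a..b} \<and> (\<forall>t\<in>T. cov (S (other k)) t c c) \<and> p (other k) + 2 \<le> sum (w (other k)) T)"

lemma long_line_mono:
  assumes "long_line p w S k c a b" "\<And>k t x y. cov (S k) t x y \<Longrightarrow> cov (S' k) t x y"
  shows "long_line p w S' k c a b"
  using assms unfolding long_line_def by meson

definition can_insert :: "(axis \<Rightarrow> (real \<times> real \<times> real) set) \<Rightarrow> (axis \<Rightarrow> real \<Rightarrow> nat) \<Rightarrow> knot_pair \<Rightarrow> axis \<Rightarrow> real \<Rightarrow> bool" where
  "can_insert S w B k c \<longleftrightarrow> hd (knots k B) < c \<and> c < last (knots k B) \<and>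
     cov (S k) c (hd (knots (other k) B)) (last (knots (other k) B)) \<and> count_list (knots k B) c < w k c"

definition min_ok :: "(axis \<Rightarrow> (real \<times> real \<times> real) set) \<Rightarrow> (axis \<Rightarrow> real \<Rightarrow> nat) \<Rightarrow> knot_pair \<Rightarrow> bool" where
  "min_ok S w B \<longleftrightarrow> (\<forall>k. (\<forall>t\<in>set (knots k B). hd (knots k B) < t \<and> t < last (knots k B) \<longrightarrow> count_list (knots k B) t = w k t) \<and>
     (\<forall>(c, a, b)\<in>S k. hd (knots k B) < c \<and> c < last (knots k B) \<and> a \<le> hd (knots (other k) B) \<and>
        last (knots (other k) B) \<le> b \<longrightarrow> c \<in> set (knots k B)))"

text \<open>Two listed lines on one coordinate could together cover a chord that neither covers
  alone, and \<open>min_ok\<close>, which tests one line at a time, would overlook it.\<close>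

definition single_lines :: "(axis \<Rightarrow> (real \<times> real \<times> real) set) \<Rightarrow> bool" where
  "single_lines S \<longleftrightarrow> (\<forall>k c a b a' b'. (c, a, b) \<in> S k \<longrightarrow> (c, a', b') \<in> S k \<longrightarrow> a = a' \<and> b = b')"

lemma chord_subset_edges:
  assumes "drawn \<Omega> w S M" "cov (S k) c a b"
  shows "kseg k c a b \<subseteq> edges k (elems M)"
  using assms(2) by (force simp: drawn_edges_iff[OF assms(1)] cov_def mem_kseg)

lemma line_mesh_drawn:
  assumes "drawn \<Omega> w S M" "\<And>k c. w k c \<le> p k + 1" "\<And>k c a b. (c, a, b) \<in> S k \<Longrightarrow> long_line p w S k c a b"
  shows "line_mesh p w \<Omega> M"
proof
  show "1 \<le> w k (coord k z)" if "z \<in> edges k (elems M)" for z k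
    using that assms(3) unfolding drawn_edges_iff[OF assms(1)] long_line_def by blast
qed (use assms in \<open>auto simp: drawn_def\<close>)

lemma minimal_support_drawn:
  assumes dr: "drawn \<Omega> w S M" and w: "\<And>k c. w k c \<le> p k + 1"
    and long: "\<And>k c a b. (c, a, b) \<in> S k \<Longrightarrow> long_line p w S k c a b"
    and sg: "single_lines S" and B: "fits p w M B" "min_ok S w B"
  shows "minimal_support M B"
proof -
  interpret line_mesh p w \<Omega> M using line_mesh_drawn[OF dr w long] .
  show ?thesis
  proof (rule minimal_supportI[OF B(1)])
    fix k c assume c: "hd (knots k B) < c" "c < last (knots k B)" "bspline_split k c B \<subseteq> edges k (elems M)"
    let ?a = "hd (knots (other k) B)" and ?b = "last (knots (other k) B)"
    have "?a < ?b" using fits_knots[OF B(1)] by simp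
    then have "kpoint k c ?a \<in> edges k (elems M)" "kpoint k c ?b \<in> edges k (elems M)"
      using c(3) by (auto simp: bspline_split_def)
    then obtain a b a' b' where "(c, a, b) \<in> S k" "a \<le> ?a" "?a \<le> b" "(c, a', b') \<in> S k" "a' \<le> ?b" "?b \<le> b'"
      by (auto simp: drawn_edges_iff[OF dr])
    \<comment> \<open>The two ends of the chord lie on listed lines with the same coordinate; by
      \<open>single_lines\<close> these coincide, so this line covers the chord.\<close>
    then show "c \<in> set (knots k B)" using sg c B(2) unfolding single_lines_def min_ok_def by fast
  qed (use B(2) in \<open>auto simp: min_ok_def\<close>)
qed

lemma fits_drawn:
  assumes "drawn \<Omega> w S M" "is_knot_pair p B"
    and "\<And>k t. t \<in> set (knots k B) \<Longrightarrow>
      cov (S k) t (hd (knots (other k) B)) (last (knots (other k) B)) \<and> count_list (knots k B) t \<le> w k t"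
  shows "fits p w M B"
  unfolding fits_def
proof (intro conjI allI ballI)
  fix k t assume "t \<in> set (knots k B)"
  from assms(3)[OF this] chord_subset_edges[OF assms(1)]
  show "bspline_split k t B \<subseteq> edges k (elems M)" "count_list (knots k B) t \<le> w k t"
    by (auto simp: bspline_split_def)
qed (rule assms(2))

text \<open>\<open>reach S w D D'\<close>: knot insertions starting from any family that contains \<open>D\<close> can lead to one that contains
  \<open>D'\<close>.\<close>

inductive reach :: "(axis \<Rightarrow> (real \<times> real \<times> real) set) \<Rightarrow> (axis \<Rightarrow> real \<Rightarrow> nat) \<Rightarrow> knot_pair set \<Rightarrow> knot_pair set \<Rightarrow> bool"
  for S w where
  reach_stop: "D' \<subseteq> D \<Longrightarrow> reach S w D D'"
| reach_insert: "B \<in> D \<Longrightarrow> can_insert S w B k c \<Longrightarrow> reach S w (D - {B} \<union> children B k c) D' \<Longrightarrow> reach S w D D'"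

text \<open>An insertion replaces one member only, so prescribed insertions can be carried out
  inside any larger family of supported knot pairs.\<close>

lemma reach_refinement:
  assumes dr: "drawn \<Omega> w S M" and lm: "line_mesh p w \<Omega> M"
    and "reach S w D D'" "D \<subseteq> F" "finite F" "\<forall>B\<in>F. fits p w M B"
  obtains F' where "(knot_insertion M)\<^sup>*\<^sup>* F F'" "D' \<subseteq> F'" "finite F'" "\<forall>B\<in>F'. fits p w M B"
proof -
  interpret line_mesh p w \<Omega> M by (rule lm)
  let ?P = "\<lambda>F D' F'. (knot_insertion M)\<^sup>*\<^sup>* F F' \<and> D' \<subseteq> F' \<and> finite F' \<and> (\<forall>B\<in>F'. fits p w M B)"
  have "\<forall>F. D \<subseteq> F \<longrightarrow> finite F \<longrightarrow> (\<forall>B\<in>F. fits p w M B) \<longrightarrow> (\<exists>F'. ?P F D' F')"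
    using assms(3)
  proof (induction rule: reach.induct)
    case (reach_stop D' D)
    show ?case
    proof (intro allI impI)
      fix F assume "D \<subseteq> F" "finite F" "\<forall>B\<in>F. fits p w M B"
      then have "?P F D' F" using reach_stop by simp
      then show "\<exists>F'. ?P F D' F'" by (rule exI)
    qed
  next
    case (reach_insert B D k c D')
    show ?case
    proof (intro allI impI)
      fix F assume F: "D \<subseteq> F" "finite F" "\<forall>B\<in>F. fits p w M B"
      then have B: "B \<in> F" "fits p w M B" using reach_insert.hyps(1) by auto
      have ins: "insertable B k c"
        using reach_insert.hyps(2) chord_subset_edges[OF dr] by (auto simp: can_insert_def insertable_def bspline_split_def)
      let ?F = "F - {B} \<union> children B k c"
      have "D - {B} \<union> children B k c \<subseteq> ?F" "finite ?F" using F by auto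
      moreover have "\<forall>B\<in>?F. fits p w M B" using F(3) fits_child[OF B(2) ins] by blast
      ultimately obtain F' where F': "?P ?F D' F'" using reach_insert.IH by presburger
      have "knot_insertion M F ?F" by (rule knot_insertion_children[OF B(2) ins B(1)])
      then have "?P F D' F'" using F' by (meson converse_rtranclp_into_rtranclp)
      then show "\<exists>F'. ?P F D' F'" by (rule exI)
    qed
  qed
  then have "\<exists>F'. ?P F D' F'" using assms(4-6) by presburger
  then obtain F' where "?P F D' F'" by (rule exE)
  then show thesis by (intro that[of F']) simp_all
qed

text \<open>\<open>w\<close> is fixed for the whole construction and prescribes in advance the
  multiplicities of lines inserted later. The family \<open>F\<close> stays existential; only its
  members in \<open>D\<close> are ever made explicit.\<close>

definition LR_state :: "(axis \<Rightarrow> nat) \<Rightarrow> (axis \<Rightarrow> real \<Rightarrow> nat) \<Rightarrow> (axis \<Rightarrow> (real \<times> real \<times> real) set) \<Rightarrow> knot_pair set \<Rightarrow> bool" where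
  "LR_state p w S D \<longleftrightarrow> (\<forall>k c. w k c \<le> p k + 1) \<and> single_lines S \<and> (\<forall>k. \<forall>(c, a, b)\<in>S k. long_line p w S k c a b) \<and>
     (\<exists>\<Omega> M F. drawn \<Omega> w S M \<and> LR_knots p M F \<and> finite F \<and> (\<forall>B\<in>F. fits p w M B) \<and> D \<subseteq> F)"

lemma admissible_long_lines:
  assumes dr: "drawn \<Omega> w S M" and w: "\<And>k c. w k c \<le> p k + 1"
    and long: "\<And>k c a b. (c, a, b) \<in> S k \<Longrightarrow> long_line p w S k c a b"
  shows "admissible p M"
proof (rule admissible_drawn[OF dr])
  fix k c a b assume "(c, a, b) \<in> S k"
  then have ll: "long_line p w S k c a b" by (rule long)
  then show "1 \<le> w k c \<and> w k c \<le> p k + 1" using w by (simp add: long_line_def)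
  from ll show "\<exists>T. T \<subseteq> {a..b} \<and> (\<forall>t\<in>T. \<exists>a' b'. (t, a', b') \<in> S (other k) \<and> a' \<le> c \<and> c \<le> b') \<and>
      p (other k) + 2 \<le> sum (w (other k)) T"
    by (simp add: long_line_def cov_def)
qed

lemma fits_insert_split:
  assumes "fits p w M B" "\<And>k. edges k (elems M) \<subseteq> edges k (elems M')"
  shows "fits p w M' B"
  using assms unfolding fits_def by blast

lemma drawn_edges_mono:
  assumes "drawn \<Omega> w S M" "drawn \<Omega> w S' M'" "\<And>k. S k \<subseteq> S' k"
  shows "edges k (elems M) \<subseteq> edges k (elems M')"
  using assms unfolding drawn_def by fast

text \<open>The refinement run has two phases: the prescribed insertions, then an arbitrary
  completion. The members of \<open>D'\<close> already have minimal support on the new mesh and so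
  survive the completion. The fresh coordinate keeps \<open>single_lines\<close> true.\<close>

lemma LR_state_step:
  assumes st: "LR_state p w S D"
    and fresh: "c \<notin> fst ` S k" and ends: "cov (S (other k)) a c c" "cov (S (other k)) b c c"
    and S': "S' = S(k := insert (c, a, b) (S k))" and new: "long_line p w S' k c a b"
    and re: "reach S' w D D'" and mn: "\<And>B. B \<in> D' \<Longrightarrow> min_ok S' w B"
  shows "LR_state p w S' D'"
proof -
  have w: "\<And>k c. w k c \<le> p k + 1" and sg: "single_lines S"
    and long: "\<And>k c a b. (c, a, b) \<in> S k \<Longrightarrow> long_line p w S k c a b"
    using st unfolding LR_state_def by blast+
  obtain \<Omega> M F where M: "drawn \<Omega> w S M" "LR_knots p M F" "finite F" "\<forall>B\<in>F. fits p w M B" "D \<subseteq> F"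
    using st unfolding LR_state_def by blast
  let ?M = "insert_split M k c a b (w k c)"
  have sub: "S j \<subseteq> S' j" for j by (auto simp: S')
  have ab: "a < b" using new by (simp add: long_line_def)
  have free: "b' \<le> a \<or> b \<le> a'" if "(c, a', b') \<in> S k" for a' b'
    using fresh that by force
  have split: "is_split k (elems M) (kseg k c a b)" and dr: "drawn \<Omega> w S' ?M"
    unfolding S' by (rule drawn_insert_split[OF M(1) ab ends[unfolded cov_def] free], assumption)+
  have long': "long_line p w S' j c' a' b'" if "(c', a', b') \<in> S' j" for j c' a' b'
  proof (cases "(c', a', b') \<in> S j")
    case True
    then show ?thesis using long[OF True] long_line_mono cov_mono[OF _ sub] by blast
  next
    case False
    then have "j = k" "c' = c" "a' = a" "b' = b" using that by (auto simp: S' split: if_splits)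
    then show ?thesis using new by simp
  qed
  have sg': "single_lines S'" using sg fresh unfolding single_lines_def S' by (auto simp: image_iff)
  have step: "mesh_step p M ?M"
    unfolding mesh_step_def using split admissible_long_lines[OF dr w long'] new[unfolded long_line_def] by blast
  have lm: "line_mesh p w \<Omega> ?M" by (rule line_mesh_drawn[OF dr w long'])
  have F: "\<forall>B\<in>F. fits p w ?M B" using M(4) fits_insert_split drawn_edges_mono[OF M(1) dr sub] by blast
  obtain F1 where F1: "(knot_insertion ?M)\<^sup>*\<^sup>* F F1" "D' \<subseteq> F1" "finite F1" "\<forall>B\<in>F1. fits p w ?M B"
    using reach_refinement[OF dr lm re M(5,3) F] by blast
  obtain F2 where F2: "(knot_insertion ?M)\<^sup>*\<^sup>* F1 F2" "\<forall>B\<in>F2. minimal_support ?M B \<and> fits p w ?M B" "finite F2"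
    "{B\<in>F1. minimal_support ?M B} \<subseteq> F2"
    using line_mesh.refinement_terminates[OF lm F1(3,4)] by blast
  have "LR_knots p ?M F2"
    by (rule LR_knots.step[OF M(2) step rtranclp_trans[OF F1(1) F2(1)]]) (use F2(2) in blast)
  moreover have "minimal_support ?M B" if "B \<in> D'" for B
    by (rule minimal_support_drawn[OF dr w long' sg' _ mn[OF that]]) (use F1 that in blast)+
  then have "D' \<subseteq> F2" using F1(2) F2(4) by blast
  ultimately show ?thesis
    unfolding LR_state_def using w sg' long' dr F2 by blast
qed

lemma LR_state_bsplines:
  assumes "LR_state p w S D"
  obtains M F where "LR_mesh p M" "LR_bsplines p M F" "\<forall>B\<in>D. tensor_bspline B \<in> F"
proof -
  obtain M F where "LR_knots p M F" "D \<subseteq> F" using assms unfolding LR_state_def by blast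
  then show thesis
    using that[of M "tensor_bspline ` F"] LR_knots_imp_LR_mesh unfolding LR_bsplines_def by blast
qed

lemma kseg_join: "a \<le> b \<Longrightarrow> b \<le> d \<Longrightarrow> kseg k c a b \<union> kseg k c b d = kseg k c a d"
  by (auto simp: mem_kseg)

text \<open>LR-rule 2 measures maximal splits, so the merged line is tested and not the added piece.
  In the application the piece by itself crosses total multiplicity \<open>n + 2\<close> only, one
  too few. Replacing two triples by one restores \<open>single_lines\<close>.\<close>

lemma LR_mesh_extend_line:
  assumes st: "LR_state p w S D" and old: "(c, b, d) \<in> S k" and ab: "a < b"
    and ends: "cov (S (other k)) a c c" "cov (S (other k)) b c c"
    and S': "S' = S(k := insert (c, a, d) (S k - {(c, b, d)}))" and new: "long_line p w S' k c a d"
  obtains \<Omega> M where "drawn \<Omega> w S' M" "LR_mesh p M" "\<And>k c. w k c \<le> p k + 1" "single_lines S'"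
    "\<And>k c a b. (c, a, b) \<in> S' k \<Longrightarrow> long_line p w S' k c a b"
proof -
  have w: "\<And>k c. w k c \<le> p k + 1" and sg: "single_lines S"
    and long: "\<And>k c a b. (c, a, b) \<in> S k \<Longrightarrow> long_line p w S k c a b"
    using st unfolding LR_state_def by blast+
  obtain \<Omega> M F where M: "drawn \<Omega> w S M" "LR_knots p M F"
    using st unfolding LR_state_def by blast
  let ?M = "insert_split M k c a b (w k c)" and ?S = "S(k := insert (c, a, b) (S k))"
  have bd: "b < d" using long[OF old] by (simp add: long_line_def)
  have only: "a' = b \<and> b' = d" if "(c, a', b') \<in> S k" for a' b'
    using sg old that unfolding single_lines_def by blast
  then have free: "b' \<le> a \<or> b \<le> a'" if "(c, a', b') \<in> S k" for a' b'
    using that by blast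
  have split: "is_split k (elems M) (kseg k c a b)" and dr: "drawn \<Omega> w ?S ?M"
    by (rule drawn_insert_split[OF M(1) ab ends[unfolded cov_def] free], assumption)+
  have un: "(\<Union>(c, a, b)\<in>S' j. kseg j c a b) = (\<Union>(c, a, b)\<in>?S j. kseg j c a b)" for j
  proof (cases "j = k")
    case True
    have "S k = insert (c, b, d) (S k - {(c, b, d)})" using old by auto
    then have "(\<Union>(c, a, b)\<in>insert (c, a, b) (S k). kseg k c a b) =
        kseg k c a b \<union> (kseg k c b d \<union> (\<Union>(c, a, b)\<in>S k - {(c, b, d)}. kseg k c a b))"
      by (metis (no_types, lifting) UN_insert case_prod_conv)
    also have "\<dots> = kseg k c a d \<union> (\<Union>(c, a, b)\<in>S k - {(c, b, d)}. kseg k c a b)"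
      using kseg_join[of a b d k c] ab bd by (simp add: Un_assoc[symmetric])
    finally show ?thesis using True by (simp add: S')
  qed (simp add: S')
  have long': "long_line p w S' j c' a' b'" if "(c', a', b') \<in> S' j" for j c' a' b'
  proof (cases "(c', a', b') \<in> S j")
    case True
    have "cov (S' j) t x y" if cv: "cov (S j) t x y" for j t x y
    proof -
      obtain a' b' where e: "(t, a', b') \<in> S j" "a' \<le> x" "y \<le> b'" using cv by (auto simp: cov_def)
      show ?thesis
      proof (cases "j = k \<and> (t, a', b') = (c, b, d)")
        case True
        then show ?thesis using e ab unfolding cov_def S' by (intro exI[of _ a] exI[of _ d]) simp
      next
        case False
        then have "(t, a', b') \<in> S' j" using e(1) by (auto simp: S')
        then show ?thesis using e by (auto simp: cov_def)
      qed
    qed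
    then show ?thesis using long[OF True] long_line_mono by blast
  next
    case False
    then have "j = k" "c' = c" "a' = a" "b' = d" using that by (auto simp: S' split: if_splits)
    then show ?thesis using new by simp
  qed
  have dr': "drawn \<Omega> w S' ?M"
    by (rule drawn_cong[OF dr un]) (use long' in \<open>auto simp: long_line_def\<close>)
  have sg': "single_lines S'"
    using sg only unfolding single_lines_def S' by (auto split: if_splits)
  have "mesh_step p M ?M"
    unfolding mesh_step_def
    using split admissible_long_lines[OF dr' w long'] new[unfolded long_line_def] by blast
  then have "LR_mesh p ?M" using LR_knots_imp_LR_mesh[OF M(2)] by (rule LR_mesh.step[rotated])
  then show thesis using that dr' w sg' long' by blast
qed

lemma MS_bspline_drawn:
  assumes dr: "drawn \<Omega> w S M" and w: "\<And>k c. w k c \<le> p k + 1"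
    and long: "\<And>k c a b. (c, a, b) \<in> S k \<Longrightarrow> long_line p w S k c a b"
    and sg: "single_lines S" and B: "is_knot_pair p B" "min_ok S w B"
    and sup: "\<And>k. \<forall>t\<in>set (knots k B).
      cov (S k) t (hd (knots (other k) B)) (last (knots (other k) B)) \<and> count_list (knots k B) t \<le> w k t"
  shows "tensor_bspline B \<in> MS_bsplines p M"
proof -
  have "fits p w M B" by (rule fits_drawn[OF dr B(1)]) (use sup in blast)
  then have "minimal_support M B" using minimal_support_drawn[OF dr w long sg] B(2) by blast
  then show ?thesis unfolding MS_bsplines_def using B(1) by blast
qed

lemma initial_bsplines_window:
  assumes "\<And>k. \<exists>pre post. Z k = pre @ knots k B @ post \<and> length (knots k B) = p k + 2"
  shows "B \<in> initial_bsplines p (Z Ax1) (Z Ax2)"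
proof -
  have "\<exists>i. knots k B = take (p k + 2) (drop i (Z k)) \<and> i + (p k + 2) \<le> length (Z k)" for k
  proof -
    obtain pre post where "Z k = pre @ knots k B @ post" "length (knots k B) = p k + 2" using assms by blast
    then show ?thesis by (intro exI[of _ "length pre"]) simp
  qed
  then obtain i j where "knots Ax1 B = take (p Ax1 + 2) (drop i (Z Ax1))" "i + (p Ax1 + 2) \<le> length (Z Ax1)"
    "knots Ax2 B = take (p Ax2 + 2) (drop j (Z Ax2))" "j + (p Ax2 + 2) \<le> length (Z Ax2)" by blast
  then show ?thesis unfolding initial_bsplines_def by (cases B) auto
qed

lemma LR_state_initial:
  assumes Z: "\<And>k. sorted (Z k)" "\<And>k. Z k \<noteq> []" "\<And>k. hd (Z k) < last (Z k)" "\<And>k. p k + 2 \<le> length (Z k)"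
    and w: "\<And>k c. c \<in> set (Z k) \<Longrightarrow> w k c = count_list (Z k) c" "\<And>k c. w k c \<le> p k + 1"
    and S: "\<And>k. S k = (\<lambda>c. (c, hd (Z (other k)), last (Z (other k)))) ` set (Z k)"
    and D: "D \<subseteq> initial_bsplines p (Z Ax1) (Z Ax2)"
  shows "LR_state p w S D"
proof -
  have S': "S = (\<lambda>k. (\<lambda>c. (c, hd (Z (other k)), last (Z (other k)))) ` set (Z k))" using S by auto
  let ?M = "tensor_of Z w"
  have dr: "drawn (Box (\<lambda>k. hd (Z k)) (\<lambda>k. last (Z k))) w S ?M"
    unfolding S' by (rule drawn_tensor_of[OF Z(1-3)])
  have long: "long_line p w S k c a b" if "(c, a, b) \<in> S k" for k c a b
  proof -
    have c: "c \<in> set (Z k)" "a = hd (Z (other k))" "b = last (Z (other k))" using that by (auto simp: S)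
    have "1 \<le> w k c" using c(1) w(1) by (simp add: Suc_le_eq count_list_0_iff neq0_conv[symmetric])
    \<comment> \<open>A line of a tensor product mesh crosses all orthogonal lines, so its length is
      the number of orthogonal knots and LR-rule 1 gives LR-rule 2.\<close>
    moreover have "sum (w (other k)) (set (Z (other k))) = length (Z (other k))"
      using w(1) by (simp add: sum_count_set[of _ "set (Z (other k))", OF subset_refl, symmetric])
    moreover have "cov (S (other k)) t c c" if "t \<in> set (Z (other k))" for t
      using that sorted_hd_last[OF Z(1) c(1)] unfolding cov_def S by auto
    moreover have "set (Z (other k)) \<subseteq> {a..b}" using sorted_hd_last[OF Z(1)] c by auto
    ultimately show ?thesis
      unfolding long_line_def using Z(3)[of "other k"] Z(4)[of "other k"] c
      by (intro conjI exI[of _ "set (Z (other k))"]) auto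
  qed
  have "initial_mesh p (Z Ax1) (Z Ax2) ?M"
    unfolding initial_mesh_def
    using tensor_mesh_tensor_of[where Z = Z and w = w, OF Z(1-3) w(1)] Z(4) admissible_long_lines[OF dr w(2) long] by simp
  then have "LR_knots p ?M (initial_bsplines p (Z Ax1) (Z Ax2))" by (rule LR_knots.initial)
  moreover have "\<forall>B\<in>initial_bsplines p (Z Ax1) (Z Ax2). fits p w ?M B"
    using fits_initial_bsplines[where Z = Z and w = w, OF Z(1-3) w(1)] by blast
  moreover have "single_lines S" by (auto simp: single_lines_def S)
  ultimately show ?thesis
    unfolding LR_state_def using w(2) long dr finite_initial_bsplines D by blast
qed

section \<open>Dependence relations from lists of knot vectors\<close>

text \<open>The \<open>k\<close>-knots come first for either value of \<open>k\<close>, so each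
  example is written only once.\<close>

definition knot_vectors :: "axis \<Rightarrow> real list \<Rightarrow> real list \<Rightarrow> knot_pair" where
  "knot_vectors k x y = (if k = Ax1 then (x, y) else (y, x))"

lemma knots_knot_vectors [simp]:
  "knots k (knot_vectors k x y) = x" "knots (other k) (knot_vectors k x y) = y"
  by (cases k; simp add: knot_vectors_def)+

lemma set_knots_knot_vectors [simp]:
  "set_knots k z (knot_vectors k x y) = knot_vectors k z y" "set_knots (other k) z (knot_vectors k x y) = knot_vectors k x z"
  by (cases k; simp add: knot_vectors_def)+

lemma knot_vectors_eq_iff [simp]: "knot_vectors k x y = knot_vectors k x' y' \<longleftrightarrow> x = x' \<and> y = y'"
  by (auto simp: knot_vectors_def)

lemma tensor_bspline_knot_vectors:
  "tensor_bspline (knot_vectors k x y) z = bspline x (coord k z) * bspline y (coord (other k) z)"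
  by (cases k; cases z) (auto simp: knot_vectors_def)

text \<open>The functions, not just the knot vectors, have to be distinct. This follows from
  distinct support rectangles, a condition on end knots that can be computed.\<close>

lemma dependence_from_list:
  fixes L :: "(real list \<times> real list) list"
  assumes len: "length \<alpha> = length L"
    and good: "\<forall>(x, y)\<in>set L. sorted x \<and> sorted y \<and> 2 \<le> length x \<and> 2 \<le> length y \<and> hd x < last x \<and> hd y < last y"
    and dist: "distinct (map (\<lambda>(x, y). (hd x, last x, hd y, last y)) L)"
    and mem: "\<forall>(x, y)\<in>set L. tensor_bspline (knot_vectors k x y) \<in> F" and nz: "0 \<notin> set \<alpha>"
    and rel: "\<And>s t. (\<Sum>i<length L. \<alpha> ! i * (bspline (fst (L ! i)) s * bspline (snd (L ! i)) t)) = 0"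
  obtains B :: "nat \<Rightarrow> point \<Rightarrow> real" and \<beta> :: "nat \<Rightarrow> real"
  where "inj_on B {1..length L}" "\<forall>j\<in>{1..length L}. B j \<in> F \<and> \<beta> j \<noteq> 0"
    "\<forall>z. (\<Sum>j=1..length L. \<beta> j * B j z) = 0"
proof -
  define K where "K j = knot_vectors k (fst (L ! (j - 1))) (snd (L ! (j - 1)))" for j
  have g: "sorted (knots k' (K j)) \<and> 2 \<le> length (knots k' (K j)) \<and> hd (knots k' (K j)) < last (knots k' (K j))"
    if "j \<in> {1..length L}" for j k'
  proof -
    have "L ! (j - 1) \<in> set L" using that by auto
    moreover obtain x y where xy: "L ! (j - 1) = (x, y)" by (cases "L ! (j - 1)")
    ultimately have "sorted x \<and> sorted y \<and> 2 \<le> length x \<and> 2 \<le> length y \<and> hd x < last x \<and> hd y < last y"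
      using good by auto
    moreover have "K j = knot_vectors k x y" unfolding K_def xy by simp
    ultimately show ?thesis using axis_eq_other_iff[of k' k] by (cases "k' = k") auto
  qed
  have "inj_on (\<lambda>j. tensor_bspline (K j)) {1..length L}"
  proof (rule inj_onI)
    fix i j assume i: "i \<in> {1..length L}" and j: "j \<in> {1..length L}" and eq: "tensor_bspline (K i) = tensor_bspline (K j)"
    have "hd (knots k' (K i)) = hd (knots k' (K j)) \<and> last (knots k' (K i)) = last (knots k' (K j))" for k'
      using tensor_bspline_supp_subset[of "K i" "K j" k'] tensor_bspline_supp_subset[of "K j" "K i" k'] g[OF i] g[OF j] eq
      by fastforce
    from this[of k] this[of "other k"]
    have "map (\<lambda>(x, y). (hd x, last x, hd y, last y)) L ! (i - 1) = map (\<lambda>(x, y). (hd x, last x, hd y, last y)) L ! (j - 1)"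
      using i j by (auto simp: K_def case_prod_beta)
    then have "i - 1 = j - 1" using dist i j by (subst (asm) nth_eq_iff_index_eq) auto
    then show "i = j" using i j by auto
  qed
  moreover have "tensor_bspline (K j) \<in> F \<and> \<alpha> ! (j - 1) \<noteq> 0" if "j \<in> {1..length L}" for j
  proof -
    have "L ! (j - 1) \<in> set L" "\<alpha> ! (j - 1) \<in> set \<alpha>" using that len by auto
    moreover obtain x y where xy: "L ! (j - 1) = (x, y)" by (cases "L ! (j - 1)")
    moreover have "K j = knot_vectors k x y" unfolding K_def xy by simp
    ultimately show ?thesis using mem nz by auto
  qed
  moreover have "(\<Sum>j=1..length L. \<alpha> ! (j - 1) * tensor_bspline (K j) z) = 0" for z
    using rel[of "coord k z" "coord (other k) z"]
    by (simp add: sum.atLeast1_atMost_eq K_def tensor_bspline_knot_vectors)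
  ultimately show thesis using that[of "\<lambda>j. tensor_bspline (K j)" "\<lambda>j. \<alpha> ! (j - 1)"] by blast
qed

section \<open>Criteria for explicitly given knot vectors\<close>

lemma can_insert_knot_vectors:
  "can_insert S w (knot_vectors k x y) k c \<longleftrightarrow> hd x < c \<and> c < last x \<and> cov (S k) c (hd y) (last y) \<and> count_list x c < w k c"
  "can_insert S w (knot_vectors k x y) (other k) c \<longleftrightarrow>
    hd y < c \<and> c < last y \<and> cov (S (other k)) c (hd x) (last x) \<and> count_list y c < w (other k) c"
  using knots_knot_vectors[of "other k" y x] by (simp_all add: can_insert_def)

lemma min_ok_knot_vectors:
  "min_ok S w (knot_vectors k x y) \<longleftrightarrow>
    (\<forall>t\<in>set x. hd x < t \<and> t < last x \<longrightarrow> count_list x t = w k t) \<and>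
    (\<forall>(c, a, b)\<in>S k. hd x < c \<and> c < last x \<and> a \<le> hd y \<and> last y \<le> b \<longrightarrow> c \<in> set x) \<and>
    (\<forall>t\<in>set y. hd y < t \<and> t < last y \<longrightarrow> count_list y t = w (other k) t) \<and>
    (\<forall>(c, a, b)\<in>S (other k). hd y < c \<and> c < last y \<and> a \<le> hd x \<and> last x \<le> b \<longrightarrow> c \<in> set y)"
  unfolding min_ok_def all_axis[of _ k] by simp

lemma is_knot_pair_knot_vectors:
  "is_knot_pair p (knot_vectors k x y) \<longleftrightarrow>
    sorted x \<and> length x = p k + 2 \<and> sorted y \<and> length y = p (other k) + 2"
  unfolding is_knot_pair_def all_axis[of _ k] by auto

lemma MS_bspline_knot_vectors:
  assumes "drawn \<Omega> w S M" "\<And>k c. w k c \<le> p k + 1" "\<And>k c a b. (c, a, b) \<in> S k \<Longrightarrow> long_line p w S k c a b"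
    and "single_lines S" "is_knot_pair p (knot_vectors k x y)" "min_ok S w (knot_vectors k x y)"
    and "(\<forall>t\<in>set x. cov (S k) t (hd y) (last y) \<and> count_list x t \<le> w k t) \<and>
      (\<forall>t\<in>set y. cov (S (other k)) t (hd x) (last x) \<and> count_list y t \<le> w (other k) t)"
  shows "tensor_bspline (knot_vectors k x y) \<in> MS_bsplines p M"
proof (rule MS_bspline_drawn[OF assms(1-6)])
  let ?B = "knot_vectors k x y"
  have "\<forall>j. \<forall>t\<in>set (knots j ?B). cov (S j) t (hd (knots (other j) ?B)) (last (knots (other j) ?B)) \<and>
      count_list (knots j ?B) t \<le> w j t"
    unfolding all_axis[of _ k] using assms(7) by simp
  then show "\<forall>t\<in>set (knots j ?B). cov (S j) t (hd (knots (other j) ?B)) (last (knots (other j) ?B)) \<and>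
      count_list (knots j ?B) t \<le> w j t" for j by blast
qed

lemma insort_append: "\<forall>a\<in>set u. a < z \<Longrightarrow> \<forall>b\<in>set v. z \<le> b \<Longrightarrow> insort z (u @ v) = u @ z # v" for z :: real
  by (induction u) (cases v; auto)+

text \<open>Displaying the vector as \<open>u @ v\<close> names the place of insertion, since sorted
  insertion cannot be evaluated past a block of symbolic length.\<close>

lemma reach_insert_first:
  assumes "knot_vectors k (u @ v) y \<in> D" "\<forall>a\<in>set u. a < z" "\<forall>b\<in>set v. z \<le> b"
    and "can_insert S w (knot_vectors k (u @ v) y) k z"
    and "reach S w (D - {knot_vectors k (u @ v) y} \<union>
      {knot_vectors k (butlast (u @ z # v)) y, knot_vectors k (tl (u @ z # v)) y}) D'"
  shows "reach S w D D'"
  using assms reach_insert[of "knot_vectors k (u @ v) y" D S w k z D']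
  by (simp add: children_def insort_append)

lemma reach_insert_second:
  assumes "knot_vectors k x (u @ v) \<in> D" "\<forall>a\<in>set u. a < z" "\<forall>b\<in>set v. z \<le> b"
    and "can_insert S w (knot_vectors k x (u @ v)) (other k) z"
    and "reach S w (D - {knot_vectors k x (u @ v)} \<union>
      {knot_vectors k x (butlast (u @ z # v)), knot_vectors k x (tl (u @ z # v))}) D'"
  shows "reach S w D D'"
  using assms reach_insert[of "knot_vectors k x (u @ v)" D S w "other k" z D']
  by (simp add: children_def insort_append)

definition by_axis :: "axis \<Rightarrow> 'a \<Rightarrow> 'a \<Rightarrow> axis \<Rightarrow> 'a" where
  "by_axis k a b j = (if j = k then a else b)"

lemma by_axis_simps [simp]:
  "by_axis k a b k = a" "by_axis k a b (other k) = b"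
  "(by_axis k a b)(k := c) = by_axis k c b" "(by_axis k a b)(other k := c) = by_axis k a c"
  by (auto simp: by_axis_def fun_eq_iff axis_eq_other_iff)

lemma count_list_replicate: "count_list (replicate n x) y = (if x = y then n else 0)"
  by (induction n) auto

lemma long_lineI:
  assumes "a < b" "1 \<le> w k c" "T \<subseteq> {a..b}" "\<forall>t\<in>T. cov (S (other k)) t c c" "p (other k) + 2 \<le> sum (w (other k)) T"
  shows "long_line p w S k c a b"
  using assms unfolding long_line_def by blast

text \<open>The value \<open>q + 1\<close> at 0 and 4 serves the arms of direction \<open>k\<close>:
  each runs from one of these lines to a simple line and so reaches the required length
  \<open>q + 2\<close>.\<close>

definition wy :: "nat \<Rightarrow> real \<Rightarrow> nat" where
  "wy q c = (if c = 0 \<or> c = 4 then q + 1 else if c = 2 then q else 1)"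

text \<open>In both examples the direction \<open>other k\<close>, of degree \<open>q\<close>, uses the coordinates 0, 1, 2, 3, 4. The line at 2
  has multiplicity \<open>q\<close> and is a knot of every B-spline of the relation; for \<open>q = 0\<close> it has to be absent.\<close>

definition mid :: "nat \<Rightarrow> real \<Rightarrow> (real \<times> real \<times> real) set" where
  "mid q l = (if q = 0 then {} else {(2, 0, l)})"

definition y_knots :: "nat \<Rightarrow> real list" where
  "y_knots q = replicate q 0 @ (0 # replicate q 2 @ [4]) @ replicate q 4"

text \<open>The coefficient in knot insertion of an outer piece. With \<open>ts\<close> present the
  relevant denominator is the distance 2 from an end to the knot 2; without it the other new knot
  takes its place at distance 1.\<close>

definition cut :: "nat \<Rightarrow> real" where
  "cut q = (if q = 0 then 1 else 1 / 2)"

text \<open>Insertion of 1 and 3. The last identity splits the factor of \<open>B\<close> into its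
  lower, middle and upper piece; the first two reassemble neighbouring pieces when two products
  share their \<open>k\<close>-factor.\<close>

lemma y_relations:
  fixes q :: nat and t :: real
  defines "ts \<equiv> replicate q (2::real)"
  shows "bspline (1 # ts @ [4]) t = bspline (1 # ts @ [3]) t + cut q * bspline (ts @ [3, 4]) t"
    "bspline (0 # ts @ [3]) t = cut q * bspline (0 # 1 # ts) t + bspline (1 # ts @ [3]) t"
    "bspline (0 # ts @ [4]) t = cut q * bspline (0 # 1 # ts) t + bspline (1 # ts @ [3]) t + cut q * bspline (ts @ [3, 4]) t"
proof -
  have ts: "\<forall>x\<in>set ts. x < 3" "\<forall>x\<in>set ts. 1 < x" "last (1 # ts) = (if q = 0 then 1 else 2)" "hd (ts @ [3]) = (if q = 0 then 3 else 2)"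
    by (auto simp: ts_def hd_append)
  note ins = bspline_insert_knot[where x = t]
  have a: "bspline (1 # ts @ [4]) t = bspline (1 # ts @ [3]) t + cut q * bspline (ts @ [3, 4]) t"
    using ins[of 1 ts 3 "[]" 4] ts by (simp add: cut_def)
  have b: "bspline (0 # ts @ [4]) t = cut q * bspline (0 # 1 # ts) t + bspline (1 # ts @ [4]) t"
    using ins[of 0 "[]" 1 ts 4] ts by (simp add: cut_def)
  have c: "bspline (0 # ts @ [3]) t = cut q * bspline (0 # 1 # ts) t + bspline (1 # ts @ [3]) t"
    using ins[of 0 "[]" 1 ts 3] ts by (simp add: cut_def)
  show "bspline (1 # ts @ [4]) t = bspline (1 # ts @ [3]) t + cut q * bspline (ts @ [3, 4]) t" by (rule a)
  show "bspline (0 # ts @ [3]) t = cut q * bspline (0 # 1 # ts) t + bspline (1 # ts @ [3]) t" by (rule c)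
  show "bspline (0 # ts @ [4]) t = cut q * bspline (0 # 1 # ts) t + bspline (1 # ts @ [3]) t + cut q * bspline (ts @ [3, 4]) t"
    using a b by simp
qed

section \<open>Eight dependent LR B-splines\<close>

text \<open>The inner line at 4 has multiplicity \<open>p k - 1\<close>. The lines at 1, 3 (direction \<open>other k\<close>) and at 5, 3, 2
  (direction \<open>k\<close>) are inserted in this order; none of them traverses the first knot pair of the families
  \<open>D0, \<dots>, D5\<close>, which are the ancestors of the eight B-splines.\<close>

locale eight =
  fixes p :: "axis \<Rightarrow> nat" and k :: axis and n q :: nat
  assumes p: "p k = n + 2" "p (other k) = q"
begin

text \<open>Multiplicity \<open>p k - 1\<close> at 4 leaves room for the simple knot 1: a window of
  \<open>p k + 2\<close> knots can slide by one knot in either direction and still contain the whole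
  inner line.\<close>

definition wx :: "real \<Rightarrow> nat" where
  "wx c = (if c = 0 \<or> c = 6 then n + 3 else if c = 4 then n + 1 else 1)"

definition w :: "axis \<Rightarrow> real \<Rightarrow> nat" where
  "w = by_axis k wx (wy q)"

text \<open>Grouped so that the three windows used in \<open>D0\<close> are visible as
  sublists.\<close>

definition x_knots :: "real list" where
  "x_knots = replicate (Suc n) 0 @ ([0, 0, 1] @ replicate (Suc n) 4 @ [6, 6]) @ replicate (Suc n) 6"

abbreviation "fs \<equiv> replicate (Suc n) (4::real)"
abbreviation "ts \<equiv> replicate q (2::real)"
abbreviation "K \<equiv> knot_vectors k"

text \<open>\<open>V\<close> collects lines of direction \<open>k\<close>, \<open>H\<close> those of
  direction \<open>other k\<close>. The arm at 1 in \<open>H1\<close> starts on the full line at 1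
  of \<open>V0\<close>; the lines at 5 and 2 start on this arm, the arm at 3 in \<open>H3\<close>
  ends on the line at 5, and the line at 3 in \<open>V4\<close> ends on that arm. The full line
  breaks the cyclic dependence, so every line is inserted in one piece.\<close>

abbreviation "V0 \<equiv> {(0, 0, 4), (1, 0, 4), (4, 0, 4), (6, 0, 4)} :: (real \<times> real \<times> real) set"
abbreviation "H0 \<equiv> {(0, 0, 6), (4, 0, 6)} \<union> mid q 6 :: (real \<times> real \<times> real) set"
abbreviation "H1 \<equiv> insert (1, 1, 6) H0"
abbreviation "V2 \<equiv> insert (5, 1, 4) V0"
abbreviation "H3 \<equiv> insert (3, 0, 5) H1"
abbreviation "V4 \<equiv> insert (3, 0, 3) V2"
abbreviation "V5 \<equiv> insert (2, 1, 4) V4"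

text \<open>\<open>B\<close> and its two neighbours in direction \<open>k\<close>. The left
  neighbour leads to the two B-splines with \<open>k\<close>-knots \<open>0 # 1 # 3 # fs\<close> and
  \<open>0 # 1 # 2 # fs\<close>, the right one to the remaining five. Children without descendants
  in the relation are left out of the families.\<close>

abbreviation "D0 \<equiv> {K (0 # 1 # fs @ [6]) (0 # ts @ [4]), K (0 # 0 # 1 # fs) (0 # ts @ [4]),
  K (1 # fs @ [6, 6]) (0 # ts @ [4])}"
abbreviation "D1 \<equiv> {K (0 # 1 # fs @ [6]) (0 # ts @ [4]), K (0 # 0 # 1 # fs) (0 # ts @ [4]),
  K (1 # fs @ [6, 6]) (0 # 1 # ts), K (1 # fs @ [6, 6]) (1 # ts @ [4])}"
abbreviation "D2 \<equiv> {K (0 # 1 # fs @ [6]) (0 # ts @ [4]), K (0 # 0 # 1 # fs) (0 # ts @ [4]),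
  K (1 # fs @ [6, 6]) (0 # 1 # ts), K (1 # fs @ [5, 6]) (1 # ts @ [4])}"
abbreviation "D3 \<equiv> {K (0 # 1 # fs @ [6]) (0 # ts @ [4]), K (0 # 0 # 1 # fs) (0 # ts @ [3]),
  K (0 # 0 # 1 # fs) (ts @ [3, 4]), K (1 # fs @ [6, 6]) (0 # 1 # ts), K (1 # fs @ [5, 6]) (1 # ts @ [4])}"
abbreviation "D4 \<equiv> {K (0 # 1 # fs @ [6]) (0 # ts @ [4]), K (0 # 1 # 3 # fs) (0 # ts @ [3]),
  K (0 # 0 # 1 # fs) (ts @ [3, 4]), K (1 # 3 # fs @ [6]) (0 # 1 # ts), K (1 # fs @ [5, 6]) (1 # ts @ [4])}"
abbreviation "D5 \<equiv> {K (0 # 1 # fs @ [6]) (0 # ts @ [4]), K (0 # 1 # 3 # fs) (0 # ts @ [3]),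
  K (0 # 1 # 2 # fs) (ts @ [3, 4]), K (1 # 3 # fs @ [6]) (0 # 1 # ts), K (2 # fs @ [5, 6]) (1 # ts @ [4]),
  K (1 # 2 # fs @ [5]) (ts @ [3, 4]), K (1 # 2 # 3 # fs) (1 # ts @ [3]), K (2 # 3 # fs @ [5]) (1 # ts @ [3])}"

lemmas data = w_def wx_def wy_def mid_def p count_list_replicate set_replicate_conv_if

lemma state0: "LR_state p w (by_axis k V0 H0) D0"
proof (rule LR_state_initial[where Z = "by_axis k x_knots (y_knots q)"])
  let ?Z = "by_axis k x_knots (y_knots q)"
  have Z: "sorted x_knots" "x_knots \<noteq> []" "hd x_knots = 0" "last x_knots = 6" "set x_knots = {0, 1, 4, 6}"
      "length x_knots = 3 * n + 8"
      "sorted (y_knots q)" "y_knots q \<noteq> []" "hd (y_knots q) = 0" "last (y_knots q) = 4"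
      "set (y_knots q) = {0, 4} \<union> (if q = 0 then {} else {2})" "length (y_knots q) = 3 * q + 2"
    by (auto simp: x_knots_def y_knots_def sorted_append hd_append set_replicate_conv_if)
  have all: "Q k \<Longrightarrow> Q (other k) \<Longrightarrow> Q j" for Q j using all_axis[of Q k] by blast
  fix j
  show "sorted (?Z j)" by (rule all) (simp_all add: Z)
  show "?Z j \<noteq> []" by (rule all) (simp_all add: Z)
  show "hd (?Z j) < last (?Z j)" by (rule all) (simp_all add: Z)
  show "p j + 2 \<le> length (?Z j)" by (rule all) (simp_all add: Z p)
  show "by_axis k V0 H0 j = (\<lambda>c. (c, hd (?Z (other j)), last (?Z (other j)))) ` set (?Z j)"
    by (rule all) (auto simp add: Z mid_def)
  show "w j c \<le> p j + 1" for c by (rule all) (simp_all add: data)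
  show "w j c = count_list (?Z j) c" if "c \<in> set (?Z j)" for c
    using that all[of "\<lambda>j. c \<in> set (?Z j) \<longrightarrow> w j c = count_list (?Z j) c" j]
    by (auto simp add: data Z x_knots_def y_knots_def split: if_splits)
next
  have "K x y \<in> initial_bsplines p (by_axis k x_knots (y_knots q) Ax1) (by_axis k x_knots (y_knots q) Ax2)"
    if "\<exists>pre post. x_knots = pre @ x @ post" "length x = n + 4" "y = 0 # ts @ [4]" for x y
  proof (rule initial_bsplines_window)
    fix j
    have "\<exists>pre post. y_knots q = pre @ y @ post" unfolding that(3) y_knots_def by blast
    then have "\<forall>j. \<exists>pre post. by_axis k x_knots (y_knots q) j = pre @ knots j (K x y) @ post \<and> length (knots j (K x y)) = p j + 2"
      using that unfolding all_axis[of _ k] by (simp add: p)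
    then show "\<exists>pre post. by_axis k x_knots (y_knots q) j = pre @ knots j (K x y) @ post \<and> length (knots j (K x y)) = p j + 2" by blast
  qed
  moreover have "\<exists>pre post. x_knots = pre @ (0 # 1 # fs @ [6]) @ post"
    unfolding x_knots_def by (rule exI[of _ "replicate (Suc n) 0 @ [0]"], rule exI[of _ "[6] @ replicate (Suc n) 6"]) simp
  moreover have "\<exists>pre post. x_knots = pre @ (0 # 0 # 1 # fs) @ post"
    unfolding x_knots_def by (rule exI[of _ "replicate (Suc n) 0"], rule exI[of _ "[6, 6] @ replicate (Suc n) 6"]) simp
  moreover have "\<exists>pre post. x_knots = pre @ (1 # fs @ [6, 6]) @ post"
    unfolding x_knots_def by (rule exI[of _ "replicate (Suc n) 0 @ [0, 0]"], rule exI[of _ "replicate (Suc n) 6"]) simp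
  ultimately show "{K (0 # 1 # fs @ [6]) (0 # ts @ [4]), K (0 # 0 # 1 # fs) (0 # ts @ [4]), K (1 # fs @ [6, 6]) (0 # ts @ [4])}
    \<subseteq> initial_bsplines p (by_axis k x_knots (y_knots q) Ax1) (by_axis k x_knots (y_knots q) Ax2)"
    by simp
qed

lemma state1: "LR_state p w (by_axis k V0 H1) D1"
proof (rule LR_state_step[OF state0, where k = "other k" and c = 1 and a = 1 and b = 6])
  let ?S = "by_axis k V0 H1"
  show "long_line p w ?S (other k) 1 1 6"
    by (rule long_lineI[where T = "{1, 4, 6}"]) (auto simp: data)
  show "reach ?S w D0 D1"
    apply (rule reach_insert_second[where k = k and x = "1 # fs @ [6, 6]" and u = "[0]" and v = "ts @ [4]" and z = 1])
        apply (cases q; simp add: butlast_append)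
       apply simp
      apply simp
     apply (simp add: can_insert_knot_vectors data hd_append)
    apply (rule reach_stop)
    apply (cases q; simp add: butlast_append)
    done
  show "min_ok ?S w B" if "B \<in> D1" for B
    using that by (elim insertE emptyE; simp add: min_ok_knot_vectors data hd_append)
qed (simp_all add: data)

lemma state2: "LR_state p w (by_axis k V2 H1) D2"
proof (rule LR_state_step[OF state1, where k = "k" and c = 5 and a = 1 and b = 4])
  let ?S = "by_axis k V2 H1"
  show "long_line p w ?S (k) 5 1 4"
    by (rule long_lineI[where T = "{1, 4}"]) (auto simp: data)
  show "reach ?S w D1 D2"
    apply (rule reach_insert_first[where k = k and y = "1 # ts @ [4]" and u = "1 # fs" and v = "[6, 6]" and z = 5])
        apply (cases q; simp add: butlast_append)
       apply simp
      apply simp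
     apply (simp add: can_insert_knot_vectors data hd_append)
    apply (rule reach_stop)
    apply (cases q; simp add: butlast_append)
    done
  show "min_ok ?S w B" if "B \<in> D2" for B
    using that by (elim insertE emptyE; simp add: min_ok_knot_vectors data hd_append)
qed (simp_all add: data)

lemma state3: "LR_state p w (by_axis k V2 H3) D3"
proof (rule LR_state_step[OF state2, where k = "other k" and c = 3 and a = 0 and b = 5])
  let ?S = "by_axis k V2 H3"
  show "long_line p w ?S (other k) 3 0 5"
    by (rule long_lineI[where T = "{0, 4}"]) (auto simp: data)
  show "reach ?S w D2 D3"
    apply (rule reach_insert_second[where k = k and x = "0 # 0 # 1 # fs" and u = "0 # ts" and v = "[4]" and z = 3])
        apply (cases q; simp add: butlast_append)
       apply simp
      apply simp
     apply (simp add: can_insert_knot_vectors data hd_append)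
    apply (rule reach_stop)
    apply (cases q; simp add: butlast_append)
    done
  show "min_ok ?S w B" if "B \<in> D3" for B
    using that by (elim insertE emptyE; simp add: min_ok_knot_vectors data hd_append)
qed (simp_all add: data)

lemma state4: "LR_state p w (by_axis k V4 H3) D4"
proof (rule LR_state_step[OF state3, where k = "k" and c = 3 and a = 0 and b = 3])
  let ?S = "by_axis k V4 H3"
  show "long_line p w ?S (k) 3 0 3"
    by (rule long_lineI[where T = "{0, 3}"]) (auto simp: data)
  show "reach ?S w D3 D4"
    apply (rule reach_insert_first[where k = k and y = "0 # ts @ [3]" and u = "[0, 0, 1]" and v = "fs" and z = 3])
        apply (cases q; simp add: butlast_append)
       apply simp
      apply simp
     apply (simp add: can_insert_knot_vectors data hd_append)
    apply (rule reach_insert_first[where k = k and y = "0 # 1 # ts" and u = "[1]" and v = "fs @ [6, 6]" and z = 3])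
        apply (cases q; simp add: butlast_append)
       apply simp
      apply simp
     apply (simp add: can_insert_knot_vectors data hd_append)
    apply (rule reach_stop)
    apply (cases q; simp add: butlast_append)
    done
  show "min_ok ?S w B" if "B \<in> D4" for B
    using that by (elim insertE emptyE; simp add: min_ok_knot_vectors data hd_append)
qed (simp_all add: data)

lemma state5: "LR_state p w (by_axis k V5 H3) D5"
proof (rule LR_state_step[OF state4, where k = "k" and c = 2 and a = 1 and b = 4])
  let ?S = "by_axis k V5 H3"
  show "long_line p w ?S (k) 2 1 4"
    by (rule long_lineI[where T = "{1, 4}"]) (auto simp: data)
  show "reach ?S w D4 D5"
    apply (rule reach_insert_first[where k = k and y = "ts @ [3, 4]" and u = "[0, 0, 1]" and v = "fs" and z = 2])
        apply (cases q; simp add: butlast_append)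
       apply simp
      apply simp
     apply (simp add: can_insert_knot_vectors data hd_append)
    apply (rule reach_insert_first[where k = k and y = "1 # ts @ [4]" and u = "[1]" and v = "fs @ [5, 6]" and z = 2])
        apply (cases q; simp add: butlast_append)
       apply simp
      apply simp
     apply (simp add: can_insert_knot_vectors data hd_append)
    \<comment> \<open>The previous insertion dropped the knot 6, so the support now ends at 5, where
      the line at 3 of direction \<open>other k\<close> ends too; it traverses only from here on.
      Cutting there shrinks the support to \<open>[1, 3]\<close> in the other coordinate (for
      positive \<open>q\<close> as for \<open>q = 0\<close>), and then the line at 3 of direction
      \<open>k\<close> traverses as well.\<close>
    apply (rule reach_insert_second[where k = k and x = "1 # 2 # fs @ [5]" and u = "1 # ts" and v = "[4]" and z = 3])
        apply (cases q; simp add: butlast_append)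
       apply simp
      apply simp
     apply (simp add: can_insert_knot_vectors data hd_append)
    apply (rule reach_insert_first[where k = k and y = "1 # ts @ [3]" and u = "[1, 2]" and v = "fs @ [5]" and z = 3])
        apply (cases q; simp add: butlast_append)
       apply simp
      apply simp
     apply (simp add: can_insert_knot_vectors data hd_append)
    apply (rule reach_stop)
    apply (cases q; simp add: butlast_append)
    done
  show "min_ok ?S w B" if "B \<in> D5" for B
    using that by (elim insertE emptyE; simp add: min_ok_knot_vectors data hd_append)
qed (simp_all add: data)

text \<open>Expansions for the lower, middle and upper piece: there the lines at 3, at 2, 3, 5, and
  at 2, 5 are available. The coefficients are the knot insertion ratios, for instance 3/4 = (3 -
  0)/(4 - 0) and 3/5 = (6 - 3)/(6 - 1).\<close>

lemma x_relations:
  "bspline (0 # 1 # fs @ [6]) s = 3 / 4 * bspline (0 # 1 # 3 # fs) s + 3 / 5 * bspline (1 # 3 # fs @ [6]) s"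
  "bspline (0 # 1 # fs @ [6]) s = 3 / 4 * bspline (0 # 1 # 3 # fs) s + 1 / 5 * bspline (1 # 2 # 3 # fs) s +
     8 / 15 * bspline (2 # 3 # fs @ [5]) s + 1 / 5 * bspline (2 # fs @ [5, 6]) s"
  "bspline (0 # 1 # fs @ [6]) s = 1 / 2 * bspline (0 # 1 # 2 # fs) s + 4 / 5 * bspline (1 # 2 # fs @ [5]) s +
     1 / 5 * bspline (2 # fs @ [5, 6]) s"
proof -
  have four: "last (4 # replicate n 4) = (4::real)" by (cases n) auto
  note ins = bspline_insert_knot[where x = s]
  have a: "bspline (0 # 1 # fs @ [6]) s = 3 / 4 * bspline (0 # 1 # 3 # fs) s + 3 / 5 * bspline (1 # 3 # fs @ [6]) s"
    using ins[of 0 "[1]" 3 fs 6] four by simp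
  have b: "bspline (1 # 3 # fs @ [6]) s = 1 / 3 * bspline (1 # 2 # 3 # fs) s + bspline (2 # 3 # fs @ [6]) s"
    using ins[of 1 "[]" 2 "3 # fs" 6] four by simp
  have c: "bspline (2 # 3 # fs @ [6]) s = bspline (2 # 3 # fs @ [5]) s + 1 / 3 * bspline (3 # fs @ [5, 6]) s"
    using ins[of 2 "3 # fs" 5 "[]" 6] by simp
  \<comment> \<open>Used backwards: it removes the knot 3 from the last piece, so that the middle
    and the upper expansion share the factor \<open>2 # fs @ [5, 6]\<close>. This turns 3/5 into 3/5
    - 1/15 = 8/15.\<close>
  have d: "bspline (2 # fs @ [5, 6]) s = 1 / 3 * bspline (2 # 3 # fs @ [5]) s + bspline (3 # fs @ [5, 6]) s"
    using ins[of 2 "[]" 3 "fs @ [5]" 6] by simp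
  have e: "bspline (0 # 1 # fs @ [6]) s = 1 / 2 * bspline (0 # 1 # 2 # fs) s + 4 / 5 * bspline (1 # 2 # fs @ [6]) s"
    using ins[of 0 "[1]" 2 fs 6] four by simp
  have f: "bspline (1 # 2 # fs @ [6]) s = bspline (1 # 2 # fs @ [5]) s + 1 / 4 * bspline (2 # fs @ [5, 6]) s"
    using ins[of 1 "2 # fs" 5 "[]" 6] by simp
  show "bspline (0 # 1 # fs @ [6]) s = 3 / 4 * bspline (0 # 1 # 3 # fs) s + 3 / 5 * bspline (1 # 3 # fs @ [6]) s"
    by (rule a)
  show "bspline (0 # 1 # fs @ [6]) s = 3 / 4 * bspline (0 # 1 # 3 # fs) s + 1 / 5 * bspline (1 # 2 # 3 # fs) s +
     8 / 15 * bspline (2 # 3 # fs @ [5]) s + 1 / 5 * bspline (2 # fs @ [5, 6]) s"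
    using a b c d by linarith
  show "bspline (0 # 1 # fs @ [6]) s = 1 / 2 * bspline (0 # 1 # 2 # fs) s + 4 / 5 * bspline (1 # 2 # fs @ [5]) s +
     1 / 5 * bspline (2 # fs @ [5, 6]) s"
    using e f by linarith
qed

abbreviation "knot_list \<equiv> [(0 # 1 # fs @ [6], 0 # ts @ [4]), (0 # 1 # 3 # fs, 0 # ts @ [3]),
  (0 # 1 # 2 # fs, ts @ [3, 4]), (1 # 3 # fs @ [6], 0 # 1 # ts), (2 # fs @ [5, 6], 1 # ts @ [4]),
  (1 # 2 # fs @ [5], ts @ [3, 4]), (1 # 2 # 3 # fs, 1 # ts @ [3]), (2 # 3 # fs @ [5], 1 # ts @ [3])]"

lemma dependent:
  "\<exists>M F (B :: nat \<Rightarrow> point \<Rightarrow> real) (\<alpha> :: nat \<Rightarrow> real).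
     LR_mesh p M \<and> LR_bsplines p M F \<and> inj_on B {1..8} \<and> (\<forall>j\<in>{1..8}. B j \<in> F \<and> \<alpha> j \<noteq> 0) \<and>
     (\<forall>z. (\<Sum>j=1..8. \<alpha> j * B j z) = 0)"
proof -
  obtain M F where MF: "LR_mesh p M" "LR_bsplines p M F" "\<forall>B\<in>D5. tensor_bspline B \<in> F"
    using LR_state_bsplines[OF state5] by blast
  let ?c = "cut q"
  \<comment> \<open>The coefficient of the \<open>k\<close>-factor in its expansion, times
    \<open>cut q\<close> where the other factor is a lower or upper piece by itself; for merged
    factors the relations in the other direction absorb \<open>cut q\<close>.\<close>
  let ?\<alpha> = "[-1, 3/4, ?c/2, 3/5 * ?c, 1/5, 4/5 * ?c, 1/5, 8/15] :: real list"
  obtain B :: "nat \<Rightarrow> point \<Rightarrow> real" and \<beta> :: "nat \<Rightarrow> real"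
    where "inj_on B {1..length knot_list}" "\<forall>j\<in>{1..length knot_list}. B j \<in> F \<and> \<beta> j \<noteq> 0"
      "\<forall>z. (\<Sum>j=1..length knot_list. \<beta> j * B j z) = 0"
  proof (rule dependence_from_list[of ?\<alpha> knot_list k F])
    show "\<forall>(x, y)\<in>set knot_list. tensor_bspline (knot_vectors k x y) \<in> F"
      using MF(3) by simp
    show "\<forall>(x, y)\<in>set knot_list. sorted x \<and> sorted y \<and> 2 \<le> length x \<and> 2 \<le> length y \<and> hd x < last x \<and> hd y < last y"
      by (simp add: sorted_append hd_append)
    show "distinct (map (\<lambda>(x, y). (hd x, last x, hd y, last y)) knot_list)"
      by (simp add: hd_append)
    show "0 \<notin> set ?\<alpha>" by (simp add: cut_def)
    fix s t :: real
    \<comment> \<open>Every other factor is split into lower, middle and upper pieces; what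
      multiplies each of the three is one of the expansions of the \<open>k\<close>-factor of
      \<open>B\<close>, minus that factor.\<close>
    have "(\<Sum>i<length knot_list. ?\<alpha> ! i * (bspline (fst (knot_list ! i)) s * bspline (snd (knot_list ! i)) t)) =
      ?c * bspline (0 # 1 # ts) t * (3 / 4 * bspline (0 # 1 # 3 # fs) s + 3 / 5 * bspline (1 # 3 # fs @ [6]) s
        - bspline (0 # 1 # fs @ [6]) s) +
      bspline (1 # ts @ [3]) t * (3 / 4 * bspline (0 # 1 # 3 # fs) s + 1 / 5 * bspline (1 # 2 # 3 # fs) s +
        8 / 15 * bspline (2 # 3 # fs @ [5]) s + 1 / 5 * bspline (2 # fs @ [5, 6]) s - bspline (0 # 1 # fs @ [6]) s) +
      ?c * bspline (ts @ [3, 4]) t * (1 / 2 * bspline (0 # 1 # 2 # fs) s + 4 / 5 * bspline (1 # 2 # fs @ [5]) s +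
        1 / 5 * bspline (2 # fs @ [5, 6]) s - bspline (0 # 1 # fs @ [6]) s)"
      by (simp add: eval_nat_numeral y_relations del: bspline.simps replicate.simps) (simp add: algebra_simps add_divide_distrib del: bspline.simps replicate.simps)
    also have "\<dots> = 0" unfolding x_relations[of s, symmetric] by simp
    finally show "(\<Sum>i<length knot_list. ?\<alpha> ! i * (bspline (fst (knot_list ! i)) s * bspline (snd (knot_list ! i)) t)) = 0" .
  qed simp
  moreover have "length knot_list = 8" by simp
  ultimately show ?thesis using MF by metis
qed

end

section \<open>Six dependent minimal support B-splines\<close>

text \<open>The inner line at 2 has multiplicity \<open>p k\<close>. The line at 1 of direction \<open>other k\<close> is inserted in two pieces, since
  its left end lies on the last arm of the pinwheel, which in turn needs the other three.\<close>

locale six =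
  fixes p :: "axis \<Rightarrow> nat" and k :: axis and n q :: nat
  assumes p: "p k = n + 1" "p (other k) = q"
begin

definition wx :: "real \<Rightarrow> nat" where
  "wx c = (if c = 0 \<or> c = 4 then n + 2 else if c = 2 then n + 1 else 1)"

definition w :: "axis \<Rightarrow> real \<Rightarrow> nat" where
  "w = by_axis k wx (wy q)"

definition x_knots :: "real list" where
  "x_knots = replicate (n + 2) 0 @ replicate (Suc n) 2 @ replicate (n + 2) 4"

abbreviation "cs \<equiv> replicate (Suc n) (2::real)"
abbreviation "ts \<equiv> replicate q (2::real)"
abbreviation "K \<equiv> knot_vectors k"

abbreviation "V0 \<equiv> {(0, 0, 4), (2, 0, 4), (4, 0, 4)} :: (real \<times> real \<times> real) set"
abbreviation "H0 \<equiv> {(0, 0, 4), (4, 0, 4)} \<union> mid q 4 :: (real \<times> real \<times> real) set"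
abbreviation "H1 \<equiv> insert (1, 2, 4) H0"
abbreviation "V2 \<equiv> insert (3, 1, 4) V0"
abbreviation "H3 \<equiv> insert (3, 0, 3) H1"
abbreviation "V4 \<equiv> insert (1, 0, 3) V2"
abbreviation "H5 \<equiv> insert (1, 1, 4) (insert (3, 0, 3) H0)"

lemmas data = w_def wx_def wy_def mid_def p count_list_replicate set_replicate_conv_if

text \<open>No knot pairs are tracked: minimal support depends on the final mesh alone, and the
  sequence only has to show that this mesh is an LR-mesh.\<close>

lemma state0: "LR_state p w (by_axis k V0 H0) {}"
proof (rule LR_state_initial[where Z = "by_axis k x_knots (y_knots q)"])
  let ?Z = "by_axis k x_knots (y_knots q)"
  have Z: "sorted x_knots" "x_knots \<noteq> []" "hd x_knots = 0" "last x_knots = 4" "set x_knots = {0, 2, 4}"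
      "length x_knots = 3 * n + 5"
      "sorted (y_knots q)" "y_knots q \<noteq> []" "hd (y_knots q) = 0" "last (y_knots q) = 4"
      "set (y_knots q) = {0, 4} \<union> (if q = 0 then {} else {2})" "length (y_knots q) = 3 * q + 2"
    by (auto simp: x_knots_def y_knots_def sorted_append hd_append set_replicate_conv_if)
  have all: "Q k \<Longrightarrow> Q (other k) \<Longrightarrow> Q j" for Q j using all_axis[of Q k] by blast
  fix j
  show "sorted (?Z j)" by (rule all) (simp_all add: Z)
  show "?Z j \<noteq> []" by (rule all) (simp_all add: Z)
  show "hd (?Z j) < last (?Z j)" by (rule all) (simp_all add: Z)
  show "p j + 2 \<le> length (?Z j)" by (rule all) (simp_all add: Z p)
  show "by_axis k V0 H0 j = (\<lambda>c. (c, hd (?Z (other j)), last (?Z (other j)))) ` set (?Z j)"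
    by (rule all) (auto simp add: Z mid_def)
  show "w j c \<le> p j + 1" for c by (rule all) (simp_all add: data)
  show "w j c = count_list (?Z j) c" if "c \<in> set (?Z j)" for c
    using that all[of "\<lambda>j. c \<in> set (?Z j) \<longrightarrow> w j c = count_list (?Z j) c" j]
    by (auto simp add: data Z x_knots_def y_knots_def split: if_splits)
qed simp

lemma state1: "LR_state p w (by_axis k V0 H1) {}"
proof (rule LR_state_step[OF state0, where k = "other k" and c = 1 and a = 2 and b = 4])
  show "long_line p w (by_axis k V0 H1) (other k) 1 2 4"
    by (rule long_lineI[where T = "{2, 4}"]) (auto simp: data)
qed (simp_all add: data reach_stop)

lemma state2: "LR_state p w (by_axis k V2 H1) {}"
proof (rule LR_state_step[OF state1, where k = "k" and c = 3 and a = 1 and b = 4])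
  show "long_line p w (by_axis k V2 H1) (k) 3 1 4"
    by (rule long_lineI[where T = "{1, 4}"]) (auto simp: data)
qed (simp_all add: data reach_stop)

lemma state3: "LR_state p w (by_axis k V2 H3) {}"
proof (rule LR_state_step[OF state2, where k = "other k" and c = 3 and a = 0 and b = 3])
  show "long_line p w (by_axis k V2 H3) (other k) 3 0 3"
    by (rule long_lineI[where T = "{0, 2}"]) (auto simp: data)
qed (simp_all add: data reach_stop)

lemma state4: "LR_state p w (by_axis k V4 H3) {}"
proof (rule LR_state_step[OF state3, where k = "k" and c = 1 and a = 0 and b = 3])
  show "long_line p w (by_axis k V4 H3) (k) 1 0 3"
    by (rule long_lineI[where T = "{0, 3}"]) (auto simp: data)
qed (simp_all add: data reach_stop)

text \<open>Insertion of 1, of 1 and 3, and of 3: the knots whose lines are available in the lower,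
  middle and upper part of the pinwheel.\<close>

lemma x_relations:
  "bspline (0 # cs @ [4]) s = 1 / 2 * bspline (0 # 1 # cs) s + bspline (1 # cs @ [4]) s"
  "bspline (0 # cs @ [4]) s = 1 / 2 * bspline (0 # 1 # cs) s + bspline (1 # cs @ [3]) s + 1 / 2 * bspline (cs @ [3, 4]) s"
  "bspline (0 # cs @ [4]) s = bspline (0 # cs @ [3]) s + 1 / 2 * bspline (cs @ [3, 4]) s"
proof -
  have two: "last (2 # replicate n 2) = (2::real)" by (cases n) auto
  note ins = bspline_insert_knot[where x = s]
  have a: "bspline (0 # cs @ [4]) s = 1 / 2 * bspline (0 # 1 # cs) s + bspline (1 # cs @ [4]) s"
    using ins[of 0 "[]" 1 cs 4] two by simp
  have b: "bspline (1 # cs @ [4]) s = bspline (1 # cs @ [3]) s + 1 / 2 * bspline (cs @ [3, 4]) s"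
    using ins[of 1 cs 3 "[]" 4] by simp
  have c: "bspline (0 # cs @ [4]) s = bspline (0 # cs @ [3]) s + 1 / 2 * bspline (cs @ [3, 4]) s"
    using ins[of 0 cs 3 "[]" 4] by simp
  show "bspline (0 # cs @ [4]) s = 1 / 2 * bspline (0 # 1 # cs) s + bspline (1 # cs @ [4]) s" by (rule a)
  show "bspline (0 # cs @ [4]) s = 1 / 2 * bspline (0 # 1 # cs) s + bspline (1 # cs @ [3]) s + 1 / 2 * bspline (cs @ [3, 4]) s"
    using a b by linarith
  show "bspline (0 # cs @ [4]) s = bspline (0 # cs @ [3]) s + 1 / 2 * bspline (cs @ [3, 4]) s" by (rule c)
qed

text \<open>For positive \<open>q\<close>, and with the \<open>k\<close>-coordinate first, the five
  smaller supports are \<open>[0,2] x [0,3]\<close>, \<open>[2,4] x [1,4]\<close>,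
  \<open>[1,4] x [0,2]\<close>, the central square \<open>[1,3] x [1,3]\<close>, and
  \<open>[0,3] x [2,4]\<close>.\<close>

abbreviation "knot_list \<equiv> [(0 # cs @ [4], 0 # ts @ [4]), (0 # 1 # cs, 0 # ts @ [3]), (cs @ [3, 4], 1 # ts @ [4]),
  (1 # cs @ [4], 0 # 1 # ts), (1 # cs @ [3], 1 # ts @ [3]), (0 # cs @ [3], ts @ [3, 4])]"

lemma dependent:
  "\<exists>M (B :: nat \<Rightarrow> point \<Rightarrow> real) (\<alpha> :: nat \<Rightarrow> real).
     LR_mesh p M \<and> inj_on B {1..6} \<and> (\<forall>j\<in>{1..6}. B j \<in> MS_bsplines p M \<and> \<alpha> j \<noteq> 0) \<and>
     (\<forall>z. (\<Sum>j=1..6. \<alpha> j * B j z) = 0)"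
proof -
  let ?S = "by_axis k V4 H5"
  \<comment> \<open>The multiplicities \<open>n + 1\<close> at 2 and \<open>n + 2\<close> at 4
    already exceed the required \<open>n + 3\<close> or equal it.\<close>
  have new: "long_line p w ?S (other k) 1 1 4"
    by (rule long_lineI[where T = "{2, 4}"]) (auto simp: data)
  have H5: "insert (1, 1, 4) (H3 - {(1, 2, 4)}) = H5" by (auto simp: mid_def)
  have old: "(1, 2, 4) \<in> by_axis k V4 H3 (other k)"
    and ends: "cov (by_axis k V4 H3 (other (other k))) 1 1 1" "cov (by_axis k V4 H3 (other (other k))) 2 1 1"
    by simp_all
  have S': "?S = (by_axis k V4 H3)(other k := insert (1, 1, 4) (by_axis k V4 H3 (other k) - {(1, 2, 4)}))"
    by (simp only: by_axis_simps H5)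
  obtain \<Omega> M where dr: "drawn \<Omega> w ?S M" and LR: "LR_mesh p M" and w: "\<And>k c. w k c \<le> p k + 1"
    and sg: "single_lines ?S" and long: "\<And>k c a b. (c, a, b) \<in> ?S k \<Longrightarrow> long_line p w ?S k c a b"
    by (rule LR_mesh_extend_line[OF state4 old _ ends S' new]) simp_all
  have "\<forall>(x, y)\<in>set knot_list. is_knot_pair p (K x y)"
    by (simp add: is_knot_pair_knot_vectors p sorted_append)
  moreover have "\<forall>(x, y)\<in>set knot_list. min_ok ?S w (K x y)"
    by (simp add: min_ok_knot_vectors data hd_append)
  moreover have "\<forall>(x, y)\<in>set knot_list.
      (\<forall>t\<in>set x. cov (?S k) t (hd y) (last y) \<and> count_list x t \<le> w k t) \<and>
      (\<forall>t\<in>set y. cov (?S (other k)) t (hd x) (last x) \<and> count_list y t \<le> w (other k) t)"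
    by (simp add: data hd_append)
  ultimately have MS: "\<forall>(x, y)\<in>set knot_list. tensor_bspline (K x y) \<in> MS_bsplines p M"
    using MS_bspline_knot_vectors[OF dr w long sg] by blast
  let ?c = "cut q"
  let ?\<alpha> = "[-1, 1/2, 1/2, ?c, 1, ?c] :: real list"
  obtain B :: "nat \<Rightarrow> point \<Rightarrow> real" and \<beta> :: "nat \<Rightarrow> real"
    where "inj_on B {1..length knot_list}" "\<forall>j\<in>{1..length knot_list}. B j \<in> MS_bsplines p M \<and> \<beta> j \<noteq> 0"
      "\<forall>z. (\<Sum>j=1..length knot_list. \<beta> j * B j z) = 0"
  proof (rule dependence_from_list[of ?\<alpha> knot_list k "MS_bsplines p M"])
    show "\<forall>(x, y)\<in>set knot_list. tensor_bspline (knot_vectors k x y) \<in> MS_bsplines p M" by (rule MS)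
    show "\<forall>(x, y)\<in>set knot_list. sorted x \<and> sorted y \<and> 2 \<le> length x \<and> 2 \<le> length y \<and> hd x < last x \<and> hd y < last y"
      by (simp add: sorted_append hd_append)
    show "distinct (map (\<lambda>(x, y). (hd x, last x, hd y, last y)) knot_list)"
      by (simp add: hd_append)
    show "0 \<notin> set ?\<alpha>" by (simp add: cut_def)
    fix s t :: real
    have "(\<Sum>i<length knot_list. ?\<alpha> ! i * (bspline (fst (knot_list ! i)) s * bspline (snd (knot_list ! i)) t)) =
      ?c * bspline (0 # 1 # ts) t * (1 / 2 * bspline (0 # 1 # cs) s + bspline (1 # cs @ [4]) s - bspline (0 # cs @ [4]) s) +
      bspline (1 # ts @ [3]) t * (1 / 2 * bspline (0 # 1 # cs) s + bspline (1 # cs @ [3]) s +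
        1 / 2 * bspline (cs @ [3, 4]) s - bspline (0 # cs @ [4]) s) +
      ?c * bspline (ts @ [3, 4]) t * (bspline (0 # cs @ [3]) s + 1 / 2 * bspline (cs @ [3, 4]) s - bspline (0 # cs @ [4]) s)"
      by (simp add: eval_nat_numeral y_relations del: bspline.simps replicate.simps) (simp add: algebra_simps add_divide_distrib del: bspline.simps replicate.simps)
    also have "\<dots> = 0" unfolding x_relations[of s, symmetric] by simp
    finally show "(\<Sum>i<length knot_list. ?\<alpha> ! i * (bspline (fst (knot_list ! i)) s * bspline (snd (knot_list ! i)) t)) = 0" .
  qed simp
  moreover have "length knot_list = 6" by simp
  ultimately show ?thesis using LR by metis
qed

end

theorem mainTheorem3:
  fixes p :: "axis \<Rightarrow> nat"
  shows
    "((\<exists>k. p k \<ge> 1) \<longrightarrow>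
       (\<exists>M (B :: nat \<Rightarrow> point \<Rightarrow> real) (\<alpha> :: nat \<Rightarrow> real).
          LR_mesh p M \<and> inj_on B {1..6} \<and>
          (\<forall>j\<in>{1..6}. B j \<in> MS_bsplines p M \<and> \<alpha> j \<noteq> 0) \<and>
          (\<forall>z. (\<Sum>j=1..6. \<alpha> j * B j z) = 0))) \<and>
     ((\<exists>k. p k \<ge> 2) \<longrightarrow>
       (\<exists>M F (B :: nat \<Rightarrow> point \<Rightarrow> real) (\<alpha> :: nat \<Rightarrow> real).
          LR_mesh p M \<and> LR_bsplines p M F \<and> inj_on B {1..8} \<and>
          (\<forall>j\<in>{1..8}. B j \<in> F \<and> \<alpha> j \<noteq> 0) \<and>
          (\<forall>z. (\<Sum>j=1..8. \<alpha> j * B j z) = 0)))"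
proof (intro conjI impI)
  assume "\<exists>k. p k \<ge> 1"
  then obtain k where "p k \<ge> 1" by blast
  then have "six p k (p k - 1) (p (other k))" by unfold_locales auto
  then show "\<exists>M (B :: nat \<Rightarrow> point \<Rightarrow> real) (\<alpha> :: nat \<Rightarrow> real).
      LR_mesh p M \<and> inj_on B {1..6} \<and> (\<forall>j\<in>{1..6}. B j \<in> MS_bsplines p M \<and> \<alpha> j \<noteq> 0) \<and>
      (\<forall>z. (\<Sum>j=1..6. \<alpha> j * B j z) = 0)"
    by (rule six.dependent)
next
  assume "\<exists>k. p k \<ge> 2"
  then obtain k where "p k \<ge> 2" by blast
  then have "eight p k (p k - 2) (p (other k))" by unfold_locales auto
  then show "\<exists>M F (B :: nat \<Rightarrow> point \<Rightarrow> real) (\<alpha> :: nat \<Rightarrow> real).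
      LR_mesh p M \<and> LR_bsplines p M F \<and> inj_on B {1..8} \<and> (\<forall>j\<in>{1..8}. B j \<in> F \<and> \<alpha> j \<noteq> 0) \<and>
      (\<forall>z. (\<Sum>j=1..8. \<alpha> j * B j z) = 0)"
    by (rule eight.dependent)
qed

end
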